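(* Let $N\ge 2$ and let $(\xi_t)_{t\ge0}=(\xi_t(1),\dots,\xi_t(N))_{t\ge 0}$ be the Markov process on $\mathbb{R}^N$ with generator \[ \mathcal{L} f(\xi)=\frac{1}{2} \sum_{i=1}^{N} \partial^2_{x_i} f(\xi) + \frac{1}{2 (N-1)} \sum_{i=1}^{N} \sum_{j \neq i} \left(f(\theta_{ij}(\xi))-f(\xi)\right),\qquad f\in C^2_0(\mathbb{R}^N), \] where $\theta_{ij}(\xi)(k)=\max\{\xi(i),\xi(j)\}$ if $k\in\{i,j\}$ and $\theta_{ij}(\xi)(k)=\xi(k)$ otherwise, started from a (possibly random) initial configuration $\xi_0$ with law $\rho^N_0$. Let $F_N(x,t)=\frac1N\#\{i:\xi_t(i)\le x\}$ be the cumulative distribution function of the empirical measure $\mu^N_t=\frac1N\sum_{i=1}^N\delta_{\xi_t(i)}$. Let $u_0$ be a distribution function on $\mathbb{R}$ such that $\lim_{N\to\infty}\|F_N(\cdot,0)-u_0\|_\infty=0$ in probability, and let $u$ be the solution of the F-KPP equation \[ \partial_t u=\tfrac12\partial_x^2 u+u^2-u,\quad x\in\mathbb{R},\ t>0,\qquad u(0,x)=u_0(x). \] Then for every $t>0$, \[ \lim_{N\to\infty}\|F_N(\cdot,t)-u(\cdot,t)\|_\infty=0\quad\text{in probability}. \]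
   Context: $C^2_0(\mathbb{R}^N)$ denotes twice differentiable functions with compact support; $\|\cdot\|_\infty$ is the sup norm over $x\in\mathbb{R}$. Informally, the process consists of $N$ particles performing independent standard Brownian motions; each particle carries a rate-one Poisson clock and when it rings it picks another particle uniformly at random, and if the chosen particle is to its right it jumps onto its position. *)

theory Defs
  imports "HOL-Probability.Probability"
begin

text \<open>Configurations of N particles are encoded as functions nat \<Rightarrow> real, of which
  only the coordinates 0,...,N-1 are relevant (R^N).\<close>

definition theta :: "nat \<Rightarrow> nat \<Rightarrow> (nat \<Rightarrow> real) \<Rightarrow> (nat \<Rightarrow> real)" where
  "theta i j \<xi> = (\<lambda>k. if k = i \<or> k = j then max (\<xi> i) (\<xi> j) else \<xi> k)"

definition pderiv_coord :: "nat \<Rightarrow> ((nat \<Rightarrow> real) \<Rightarrow> real) \<Rightarrow> (nat \<Rightarrow> real) \<Rightarrow> real" where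
  "pderiv_coord i f x = deriv (\<lambda>s. f (x(i := s))) (x i)"

definition C2c :: "nat \<Rightarrow> ((nat \<Rightarrow> real) \<Rightarrow> real) \<Rightarrow> bool" where
  "C2c N f \<longleftrightarrow>
     (\<forall>x y. (\<forall>i<N. x i = y i) \<longrightarrow> f x = f y) \<and>
     (\<exists>R. \<forall>x. f x \<noteq> 0 \<longrightarrow> (\<forall>i<N. \<bar>x i\<bar> \<le> R)) \<and>
     continuous_on UNIV f \<and>
     (\<forall>i<N. \<forall>x. (\<lambda>s. f (x(i := s))) differentiable (at (x i))) \<and>
     (\<forall>i<N. continuous_on UNIV (pderiv_coord i f)) \<and>
     (\<forall>i<N. \<forall>j<N. \<forall>x. (\<lambda>s. pderiv_coord i f (x(j := s))) differentiable (at (x j))) \<and>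
     (\<forall>i<N. \<forall>j<N. continuous_on UNIV (pderiv_coord j (pderiv_coord i f)))"

definition gen :: "nat \<Rightarrow> ((nat \<Rightarrow> real) \<Rightarrow> real) \<Rightarrow> (nat \<Rightarrow> real) \<Rightarrow> real" where
  "gen N f \<xi> =
     1/2 * (\<Sum>i<N. pderiv_coord i (pderiv_coord i f) \<xi>)
     + 1 / (2 * (real N - 1)) * (\<Sum>i<N. \<Sum>j\<in>{..<N} - {i}. f (theta i j \<xi>) - f \<xi>)"

definition nat_filtration ::
  "'a measure \<Rightarrow> nat \<Rightarrow> (real \<Rightarrow> 'a \<Rightarrow> nat \<Rightarrow> real) \<Rightarrow> real \<Rightarrow> 'a measure" where
  "nat_filtration M N X s =
     sigma (space M)
       (\<Union>r\<in>{0..s}. \<Union>i\<in>{..<N}. {(\<lambda>\<omega>. X r \<omega> i) -` B \<inter> space M | B. B \<in> sets borel})"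

text \<open>X (on the probability space M) is a Markov process with generator gen N, expressed
  through the (well-posed) martingale problem: measurable, cadlag sample paths, and for
  every f in C^2_0(R^N) the process f(X_t) - f(X_0) - int_0^t L f(X_r) dr is a martingale
  with respect to the natural filtration.  The initial law is arbitrary.\<close>
definition solves_mp :: "'a measure \<Rightarrow> nat \<Rightarrow> (real \<Rightarrow> 'a \<Rightarrow> nat \<Rightarrow> real) \<Rightarrow> bool" where
  "solves_mp M N X \<longleftrightarrow>
     (\<forall>t\<ge>0. \<forall>i<N. (\<lambda>\<omega>. X t \<omega> i) \<in> borel_measurable M) \<and>
     (\<forall>\<omega>\<in>space M. \<forall>i<N.
        (\<forall>t\<ge>0. continuous (at_right t) (\<lambda>s. X s \<omega> i)) \<and>
        (\<forall>t>0. \<exists>l. ((\<lambda>s. X s \<omega> i) \<longlongrightarrow> l) (at_left t))) \<and>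
     (\<forall>f. C2c N f \<longrightarrow>
        (let Mf = (\<lambda>t \<omega>. f (X t \<omega>) - f (X 0 \<omega>) - integral {0..t} (\<lambda>r. gen N f (X r \<omega>)))
         in (\<forall>t\<ge>0. integrable M (Mf t)) \<and>
            (\<forall>s t. 0 \<le> s \<and> s \<le> t \<longrightarrow>
               (AE \<omega> in M. real_cond_exp M (nat_filtration M N X s) (Mf t) \<omega> = Mf s \<omega>))))"

definition emp_cdf :: "nat \<Rightarrow> (nat \<Rightarrow> real) \<Rightarrow> real \<Rightarrow> real" where
  "emp_cdf N \<xi> x = real (card {i. i < N \<and> \<xi> i \<le> x}) / real N"

definition distribution_function :: "(real \<Rightarrow> real) \<Rightarrow> bool" where
  "distribution_function F \<longleftrightarrow> mono F \<and> (\<forall>x. continuous (at_right x) F) \<and>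
     (F \<longlongrightarrow> 0) at_bot \<and> (F \<longlongrightarrow> 1) at_top"

definition fkpp_solution :: "(real \<Rightarrow> real) \<Rightarrow> (real \<Rightarrow> real \<Rightarrow> real) \<Rightarrow> bool" where
  "fkpp_solution u0 u \<longleftrightarrow>
     (\<exists>C. \<forall>t>0. \<forall>x. \<bar>u t x\<bar> \<le> C) \<and>
     continuous_on ({0<..} \<times> UNIV) (\<lambda>(t, x). u t x) \<and>
     (\<exists>ux uxx. \<forall>t>0. \<forall>x.
        ((u t) has_real_derivative ux t x) (at x) \<and>
        ((ux t) has_real_derivative uxx t x) (at x) \<and>
        ((\<lambda>s. u s x) has_real_derivative (1/2 * uxx t x + (u t x)^2 - u t x)) (at t)) \<and>
     (\<forall>x. isCont u0 x \<longrightarrow> ((\<lambda>s. u s x) \<longlongrightarrow> u0 x) (at_right 0))"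

end

theory Submission
  imports Defs
begin

text \<open>
  Write \<open>F\<close> for the empirical distribution function and \<open>F_k\<close> for its convolution with a logistic
  kernel of width \<open>k\<close>. The martingale problem, extended from compactly supported to bounded \<open>C\<^sup>2\<close>
  functions, gives the left time derivatives of the first two moments of \<open>F_k(x,t)\<close>, and these combine to
  \<open>a_t \<le> a_xx/2 + 2(1+C) a + 4(1+C) E V + O_k(1/N)\<close> for \<open>a(t,x) = E (F_k - u)\<^sup>2\<close>, where \<open>\<bar>u\<bar> \<le> C\<close>.
  Here \<open>V\<close> is at most the fraction of particles within distance about \<open>k\<close> of \<open>x\<close>; it measures how far
  smoothing is from commuting with \<open>F\<^sup>2 - F\<close>. Since Fourier modes \<open>E cos(\<lambda>(x - \<xi>))\<close> of the empirical measure are damped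
  at rate \<open>\<lambda>\<^sup>2/2\<close> by the Brownian motion while the jumps contribute at most \<open>1\<close>, no mass can concentrate and
  \<open>E V\<close> is small, uniformly in \<open>x\<close> and \<open>N\<close>, as \<open>k\<close> tends to \<open>0\<close>.

  A maximum principle bounds \<open>a\<close> by the heat evolution of its values at a small time \<open>\<tau>\<close>. It only uses pointwise
  derivatives of \<open>u\<close>, so no regularity theory for the F-KPP equation is needed, and letting \<open>\<tau>\<close> tend to \<open>0\<close> by
  dominated convergence only uses convergence of \<open>u(\<tau>,y)\<close> to \<open>u_0(y)\<close> at continuity points of \<open>u_0\<close>. Hence \<open>F(x,t)\<close>
  converges to \<open>u(t,x)\<close> in probability for each \<open>x\<close>; monotonicity and a tail estimate make this uniform.
\<close>

section \<open>Bounded cylinder functionals\<close>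

text \<open>Taking the square is what makes the estimate close. With \<open>f = F_k\<close> and
  \<open>v = u\<close> the reaction terms combine to \<open>2 (f - v)^2 (f + v - 1)\<close>, a
  bounded multiple of the squared deviation, so first and second moments at single times suffice and
  no correlation structure of the particles has to be understood.

  Smoothing is forced: an indicator is no admissible test function, and the Brownian noise in the
  second moment is of size \<open>1/(N k^2)\<close>, so \<open>k\<close> must be fixed before
  \<open>N\<close> grows. The price is the commutator, which has to be small uniformly in
  \<open>N\<close>. The initial law gives no help here, since \<open>u_0\<close> may jump and
  particles may start on top of each other. The spreading must come from the Brownian motion at
  positive times; its cost near time 0 is a source \<open>exp (- l^2 t / 2)\<close>, whose time
  integral \<open>2 / l^2\<close> is small for large \<open>l\<close>. Jumps of \<open>u_0\<close>
  also explain why the initial deviation enters through a Gaussian integral and not through a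
  supremum over \<open>x\<close>.

  A maximum principle argues at a first touching time, where only the past is known. Hence all time
  derivatives are taken from the left, and left limits of the process appear.\<close>

inductive bdd_cyl :: "nat \<Rightarrow> ((nat \<Rightarrow> real) \<Rightarrow> real) \<Rightarrow> bool" for N where
  bdd_cyl_const: "bdd_cyl N (\<lambda>_. c)"
| bdd_cyl_coord: "i < N \<Longrightarrow> j < N \<Longrightarrow> continuous_on UNIV h \<Longrightarrow> bounded (range h)
    \<Longrightarrow> bdd_cyl N (\<lambda>x. h (max (x i) (x j)))"
| bdd_cyl_add: "bdd_cyl N f \<Longrightarrow> bdd_cyl N g \<Longrightarrow> bdd_cyl N (\<lambda>x. f x + g x)"
| bdd_cyl_mult: "bdd_cyl N f \<Longrightarrow> bdd_cyl N g \<Longrightarrow> bdd_cyl N (\<lambda>x. f x * g x)"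

lemma bdd_cyl_bounded:
  assumes "bdd_cyl N f"
  obtains B where "B > 0" "\<And>x. \<bar>f x\<bar> \<le> B"
proof -
  have "\<exists>B>0. \<forall>x. \<bar>f x\<bar> \<le> B"
    using assms
  proof induction
    case (bdd_cyl_const c)
    show ?case by (rule exI[of _ "\<bar>c\<bar> + 1"]) auto
  next
    case (bdd_cyl_coord i j h)
    then obtain B where "B > 0" "\<forall>y\<in>range h. norm y \<le> B"
      using bounded_pos by blast
    then show ?case by (intro exI[of _ B]) auto
  next
    case (bdd_cyl_add f g)
    then obtain B C where B: "B > 0" "\<forall>x. \<bar>f x\<bar> \<le> B" and C: "C > 0" "\<forall>x. \<bar>g x\<bar> \<le> C" by blast
    have "\<bar>f x + g x\<bar> \<le> B + C" for x
      using B(2)[rule_format, of x] C(2)[rule_format, of x] by linarith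
    then show ?case using B C by (intro exI[of _ "B + C"]) auto
  next
    case (bdd_cyl_mult f g)
    then obtain B C where B: "B > 0" "\<forall>x. \<bar>f x\<bar> \<le> B" and C: "C > 0" "\<forall>x. \<bar>g x\<bar> \<le> C" by blast
    have "\<bar>f x * g x\<bar> \<le> B * C" for x
      unfolding abs_mult using B C by (intro mult_mono) auto
    then show ?case using B C by (intro exI[of _ "B * C"]) auto
  qed
  then show ?thesis using that by blast
qed

text \<open>Convergence is asked only of the coordinates below \<open>N\<close>, because the paths
  are controlled only there. Together with boundedness this lets one-sided limits along paths pass
  through expectations by dominated convergence.\<close>

lemma bdd_cyl_tendsto:
  assumes "bdd_cyl N f" and "\<And>i. i < N \<Longrightarrow> ((\<lambda>s. Z s i) \<longlongrightarrow> z i) F"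
  shows "((\<lambda>s. f (Z s)) \<longlongrightarrow> f z) F"
  using assms(1)
proof induction
  case (bdd_cyl_coord i j h)
  have "isCont h (max (z i) (z j))"
    using bdd_cyl_coord(3) by (simp add: continuous_on_eq_continuous_at)
  moreover have "((\<lambda>s. max (Z s i) (Z s j)) \<longlongrightarrow> max (z i) (z j)) F"
    by (intro tendsto_max assms(2) bdd_cyl_coord)
  ultimately show ?case by (rule isCont_tendsto_compose)
qed (auto intro: tendsto_intros)

lemma bdd_cyl_measurable:
  assumes "bdd_cyl N f" and [measurable]: "\<And>i. i < N \<Longrightarrow> (\<lambda>s. Z s i) \<in> borel_measurable M"
  shows "(\<lambda>s. f (Z s)) \<in> borel_measurable M"
  using assms(1)
proof induction
  case (bdd_cyl_coord i j h)
  have [measurable]: "h \<in> borel_measurable borel"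
    using bdd_cyl_coord(3) by (rule borel_measurable_continuous_onI)
  have [measurable]: "(\<lambda>s. Z s i) \<in> borel_measurable M" "(\<lambda>s. Z s j) \<in> borel_measurable M"
    using assms(2) bdd_cyl_coord by auto
  show ?case by measurable
qed auto

lemma bdd_cyl_coord1: "i < N \<Longrightarrow> continuous_on UNIV h \<Longrightarrow> bounded (range h) \<Longrightarrow> bdd_cyl N (\<lambda>x. h (x i))"
  using bdd_cyl_coord[of i N i h] by simp

lemma bdd_cyl_cmult: "bdd_cyl N f \<Longrightarrow> bdd_cyl N (\<lambda>x. c * f x)"
  using bdd_cyl_mult[OF bdd_cyl_const] by blast

lemma bdd_cyl_diff: "bdd_cyl N f \<Longrightarrow> bdd_cyl N g \<Longrightarrow> bdd_cyl N (\<lambda>x. f x - g x)"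
  using bdd_cyl_add[of N f "\<lambda>x. (-1) * g x"] bdd_cyl_cmult[of N g "-1"] by simp

lemma bdd_cyl_sum: "(\<And>k. k \<in> A \<Longrightarrow> bdd_cyl N (f k)) \<Longrightarrow> bdd_cyl N (\<lambda>x. \<Sum>k\<in>A. f k x)"
  by (induction A rule: infinite_finite_induct) (auto intro: bdd_cyl_const bdd_cyl_add)

lemma bdd_cyl_prod: "(\<And>k. k \<in> A \<Longrightarrow> bdd_cyl N (f k)) \<Longrightarrow> bdd_cyl N (\<lambda>x. \<Prod>k\<in>A. f k x)"
  by (induction A rule: infinite_finite_induct) (auto intro: bdd_cyl_const bdd_cyl_mult)

text \<open>Products of one-variable functions serve as test functions: differentiating or cutting
  off acts on one factor at a time, so regularity in \<open>N\<close> variables reduces to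
  regularity in one, and empirical means and their squares are linear combinations of such
  products.\<close>

definition tensor :: "nat \<Rightarrow> (nat \<Rightarrow> real \<Rightarrow> real) \<Rightarrow> (nat \<Rightarrow> real) \<Rightarrow> real" where
  "tensor N h x = (\<Prod>k<N. h k (x k))"

definition jump :: "nat \<Rightarrow> ((nat \<Rightarrow> real) \<Rightarrow> real) \<Rightarrow> (nat \<Rightarrow> real) \<Rightarrow> real" where
  "jump N f x = 1 / (2 * (real N - 1)) * (\<Sum>i<N. \<Sum>j\<in>{..<N} - {i}. f (theta i j x) - f x)"

lemma jump_sum: "jump N (\<lambda>x. \<Sum>a\<in>A. f a x) x = (\<Sum>a\<in>A. jump N (f a) x)"
proof -
  have "(\<Sum>i<N. \<Sum>j\<in>{..<N} - {i}. (\<Sum>a\<in>A. f a (theta i j x)) - (\<Sum>a\<in>A. f a x))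
      = (\<Sum>i<N. \<Sum>j\<in>{..<N} - {i}. \<Sum>a\<in>A. f a (theta i j x) - f a x)"
    by (simp add: sum_subtractf)
  also have "\<dots> = (\<Sum>i<N. \<Sum>a\<in>A. \<Sum>j\<in>{..<N} - {i}. f a (theta i j x) - f a x)"
    by (intro sum.cong refl sum.swap)
  also have "\<dots> = (\<Sum>a\<in>A. \<Sum>i<N. \<Sum>j\<in>{..<N} - {i}. f a (theta i j x) - f a x)"
    by (rule sum.swap)
  finally show ?thesis
    unfolding jump_def by (simp add: sum_distrib_left)
qed

lemma jump_cmult: "jump N (\<lambda>x. c * f x) x = c * jump N f x"
  unfolding jump_def by (simp add: sum_distrib_left right_diff_distrib mult_ac)

lemma bdd_cyl_jump:
  assumes "\<And>i j. i < N \<Longrightarrow> j < N \<Longrightarrow> bdd_cyl N (\<lambda>x. f (theta i j x))" "bdd_cyl N f"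
  shows "bdd_cyl N (jump N f)"
proof -
  have "bdd_cyl N (\<lambda>x. jump N f x)"
    unfolding jump_def by (intro bdd_cyl_cmult bdd_cyl_sum bdd_cyl_diff assms) auto
  then show ?thesis by simp
qed

lemma bdd_cyl_tensor:
  assumes "\<And>k. k < N \<Longrightarrow> continuous_on UNIV (h k)" "\<And>k. k < N \<Longrightarrow> bounded (range (h k))"
  shows "bdd_cyl N (tensor N h)"
proof -
  have "bdd_cyl N (\<lambda>x. tensor N h x)"
    unfolding tensor_def by (intro bdd_cyl_prod bdd_cyl_coord1 assms) auto
  then show ?thesis by simp
qed

text \<open>This is what the maximum in the clause \<open>bdd_cyl_coord\<close> is for: after a jump
  of the pair \<open>i\<close>, \<open>j\<close> a factor reads either its own coordinate or
  \<open>max (x i) (x j)\<close>, so the jump part of a tensor stays in the class.\<close>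

lemma bdd_cyl_tensor_theta:
  assumes "\<And>k. k < N \<Longrightarrow> continuous_on UNIV (h k)" "\<And>k. k < N \<Longrightarrow> bounded (range (h k))"
    and "i < N" "j < N"
  shows "bdd_cyl N (\<lambda>x. tensor N h (theta i j x))"
proof -
  have "bdd_cyl N (\<lambda>x. h k (theta i j x k))" if k: "k < N" for k
  proof (cases "k = i \<or> k = j")
    case True
    then have "(\<lambda>x. h k (theta i j x k)) = (\<lambda>x. h k (max (x i) (x j)))"
      by (auto simp: theta_def)
    then show ?thesis using bdd_cyl_coord assms k by simp
  next
    case False
    then have "(\<lambda>x. h k (theta i j x k)) = (\<lambda>x. h k (x k))"
      by (auto simp: theta_def)
    then show ?thesis using bdd_cyl_coord1 assms k by simp
  qed
  then show ?thesis
    unfolding tensor_def by (intro bdd_cyl_prod) auto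
qed

text \<open>The derivatives are arguments, so that products and affine substitutions can be computed
  explicitly instead of through \<open>deriv\<close>. The common bound on all three functions makes
  the generator applied to a tensor a bounded functional.\<close>

definition C2b :: "(real \<Rightarrow> real) \<Rightarrow> (real \<Rightarrow> real) \<Rightarrow> (real \<Rightarrow> real) \<Rightarrow> bool" where
  "C2b h h1 h2 \<longleftrightarrow> (\<forall>x. (h has_real_derivative h1 x) (at x)) \<and>
     (\<forall>x. (h1 has_real_derivative h2 x) (at x)) \<and> continuous_on UNIV h2 \<and>
     (\<exists>B. \<forall>x. \<bar>h x\<bar> \<le> B \<and> \<bar>h1 x\<bar> \<le> B \<and> \<bar>h2 x\<bar> \<le> B)"

lemma C2bD:
  assumes "C2b h h1 h2"
  shows "(h has_real_derivative h1 x) (at x)" "(h1 has_real_derivative h2 x) (at x)"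
    "continuous_on UNIV h" "continuous_on UNIV h1" "continuous_on UNIV h2"
    "bounded (range h)" "bounded (range h1)" "bounded (range h2)"
proof -
  show 1: "(h has_real_derivative h1 x) (at x)" "(h1 has_real_derivative h2 x) (at x)" for x
    using assms by (auto simp: C2b_def)
  show "continuous_on UNIV h" "continuous_on UNIV h1" "continuous_on UNIV h2"
    using 1 assms by (auto simp: C2b_def continuous_on_eq_continuous_at intro: DERIV_isCont)
  show "bounded (range h)" "bounded (range h1)" "bounded (range h2)"
    using assms unfolding C2b_def bounded_iff by auto
qed

lemma tensor_upd:
  assumes "i < N"
  shows "tensor N (h(i := g)) x = g (x i) * (\<Prod>k\<in>{..<N} - {i}. h k (x k))"
proof -
  have "tensor N (h(i := g)) x = (h(i := g)) i (x i) * (\<Prod>k\<in>{..<N} - {i}. (h(i := g)) k (x k))"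
    unfolding tensor_def by (rule prod.remove) (use assms in auto)
  also have "(\<Prod>k\<in>{..<N} - {i}. (h(i := g)) k (x k)) = (\<Prod>k\<in>{..<N} - {i}. h k (x k))"
    by (intro prod.cong) auto
  finally show ?thesis by (simp only: fun_upd_same)
qed

lemma tensor_upd_arg:
  assumes "i < N"
  shows "tensor N h (x(i := s)) = h i s * (\<Prod>k\<in>{..<N} - {i}. h k (x k))"
proof -
  have "tensor N h (x(i := s)) = h i ((x(i:=s)) i) * (\<Prod>k\<in>{..<N} - {i}. h k ((x(i:=s)) k))"
    unfolding tensor_def by (rule prod.remove) (use assms in auto)
  also have "(\<Prod>k\<in>{..<N} - {i}. h k ((x(i:=s)) k)) = (\<Prod>k\<in>{..<N} - {i}. h k (x k))"
    by (intro prod.cong) auto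
  finally show ?thesis by (simp only: fun_upd_same)
qed

lemma tensor_section_deriv:
  assumes "i < N" "\<And>y. (h i has_real_derivative h' y) (at y)"
  shows "((\<lambda>s. tensor N h (x(i := s))) has_real_derivative tensor N (h(i := h')) x) (at (x i))"
  unfolding tensor_upd_arg[OF assms(1)] tensor_upd[OF assms(1)]
  by (rule DERIV_cmult_right) (rule assms(2))

lemma pderiv_tensor:
  assumes "i < N" "\<And>y. (h i has_real_derivative h' y) (at y)"
  shows "pderiv_coord i (tensor N h) = tensor N (h(i := h'))"
  unfolding pderiv_coord_def by (intro ext DERIV_imp_deriv tensor_section_deriv assms)

lemma continuous_on_tensor:
  assumes "\<And>k. continuous_on UNIV (h k)"
  shows "continuous_on UNIV (tensor N h)"
proof -
  have "continuous_on UNIV (\<lambda>x. h k (x k))" for k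
    by (rule continuous_on_compose2[OF assms continuous_on_product_coordinates]) auto
  then have "continuous_on UNIV (\<lambda>x. tensor N h x)"
    unfolding tensor_def by (intro continuous_on_prod)
  then show ?thesis by simp
qed

text \<open>A partial derivative of a product replaces one factor, so all derivatives up to second
  order are again tensors. A common support bound for the factors confines the coordinates below
  \<open>N\<close> to a box, which is what compact support means in \<open>C2c\<close>.\<close>

lemma tensor_C2c:
  assumes h: "\<And>k. C2b (h k) (h1 k) (h2 k)" and supp: "\<And>k y. h k y \<noteq> 0 \<Longrightarrow> \<bar>y\<bar> \<le> R"
  shows "C2c N (tensor N h)"
    and "gen N (tensor N h) x = 1/2 * (\<Sum>i<N. tensor N (h(i := h2 i)) x) + jump N (tensor N h) x"
proof -
  note d = C2bD(1)[OF h] C2bD(2)[OF h] and c = C2bD(3-5)[OF h]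
  have p1: "pderiv_coord i (tensor N h) = tensor N (h(i := h1 i))" if "i < N" for i
    by (rule pderiv_tensor[OF that]) (rule d)
  \<comment> \<open>For \<open>j = i\<close> the factor \<open>h1 i\<close> is differentiated once
    more and becomes \<open>h2 i\<close>; for \<open>j\<close> different from \<open>i\<close> a
    mixed derivative arises.\<close>
  have p2: "pderiv_coord j (tensor N (h(i := h1 i)))
      = tensor N ((h(i := h1 i))(j := (if j = i then h2 i else h1 j)))" if "i < N" "j < N" for i j
    by (rule pderiv_tensor[OF that(2)]) (auto intro: d)
  show "gen N (tensor N h) x = 1/2 * (\<Sum>i<N. tensor N (h(i := h2 i)) x) + jump N (tensor N h) x"
    unfolding gen_def jump_def by (simp add: p1 p2)
  show "C2c N (tensor N h)"
    unfolding C2c_def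
  proof (intro conjI allI impI)
    fix x y :: "nat \<Rightarrow> real" assume "\<forall>i<N. x i = y i"
    then show "tensor N h x = tensor N h y" unfolding tensor_def by (intro prod.cong) auto
  next
    have "\<bar>x i\<bar> \<le> R" if "tensor N h x \<noteq> 0" "i < N" for x i
      using that supp[of i "x i"] unfolding tensor_def by auto
    then show "\<exists>R. \<forall>x. tensor N h x \<noteq> 0 \<longrightarrow> (\<forall>i<N. \<bar>x i\<bar> \<le> R)" by blast
  next
    show "continuous_on UNIV (tensor N h)" by (intro continuous_on_tensor c)
  next
    fix i x assume "i < N"
    then show "(\<lambda>s. tensor N h (x(i := s))) differentiable at (x i)"
      using tensor_section_deriv d real_differentiable_def by blast
  next
    fix i assume "i < N"
    then show "continuous_on UNIV (pderiv_coord i (tensor N h))"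
      unfolding p1[OF \<open>i < N\<close>] by (intro continuous_on_tensor) (auto intro: c)
  next
    fix i j x assume ij: "i < N" "j < N"
    show "(\<lambda>s. pderiv_coord i (tensor N h) (x(j := s))) differentiable at (x j)"
      unfolding p1[OF ij(1)] real_differentiable_def
      by (rule exI, rule tensor_section_deriv[OF ij(2), where h' = "if j = i then h2 i else h1 j"])
        (auto intro: d)
  next
    fix i j assume ij: "i < N" "j < N"
    show "continuous_on UNIV (pderiv_coord j (pderiv_coord i (tensor N h)))"
      unfolding p1[OF ij(1)] p2[OF ij] by (intro continuous_on_tensor) (auto intro: c)
  qed
qed

lemma DERIV_pos_part_power:
  "((\<lambda>y::real. (max 0 y) ^ (m + 2)) has_real_derivative real (m + 2) * (max 0 x) ^ (m + 1)) (at x)"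
proof (cases x "0 :: real" rule: linorder_cases)
  case less
  have "((\<lambda>y::real. 0) has_real_derivative 0) (at x)" by simp
  then have "((\<lambda>y::real. (max 0 y) ^ (m + 2)) has_real_derivative 0) (at x)"
    by (rule has_field_derivative_transform_within_open[where S = "{..<0}"]) (use less in auto)
  then show ?thesis using less by simp
next
  case equal
  \<comment> \<open>Caratheodory's criterion at the kink:
    \<open>max 0 z ^ (m + 2) = max 0 z ^ (m + 1) * z\<close> on both sides of 0, and the slope
    \<open>max 0 z ^ (m + 1)\<close> is continuous with value 0 there.\<close>
  have "((\<lambda>y::real. (max 0 y) ^ (m + 2)) has_real_derivative 0) (at 0)"
    unfolding CARAT_DERIV
  proof (intro exI conjI allI)
    show "isCont (\<lambda>z::real. (max 0 z) ^ (m + 1)) 0" by (intro continuous_intros)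
  qed (auto simp: max_def)
  then show ?thesis using equal by simp
next
  case greater
  have "((\<lambda>y::real. y ^ (m + 2)) has_real_derivative real (m + 2) * x ^ (m + 1)) (at x)"
    using DERIV_pow[of "m + 2" x] by simp
  then have "((\<lambda>y::real. (max 0 y) ^ (m + 2)) has_real_derivative real (m + 2) * x ^ (m + 1)) (at x)"
    by (rule has_field_derivative_transform_within_open[where S = "{0<..}"]) (use greater in auto)
  then show ?thesis using greater by simp
qed

text \<open>The witness is the cube of the positive part of \<open>1 - z^2\<close>; the third power
  is the least one for which the second derivative is continuous at the edges. The bound 30 used
  below is \<open>6 + 24\<close>, the sum of the coefficients of the second derivative.\<close>

lemma cutoff_exists:
  obtains c0 c1 c2 :: "real \<Rightarrow> real" where "C2b c0 c1 c2" "c0 0 = 1" "\<And>z. c0 z \<noteq> 0 \<Longrightarrow> \<bar>z\<bar> \<le> 1"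
proof
  define p where "p z = max 0 (1 - z ^ 2)" for z :: real
  let ?c = "\<lambda>z. p z ^ 3" and ?c1 = "\<lambda>z. - 6 * z * p z ^ 2" and ?c2 = "\<lambda>z. - 6 * p z ^ 2 + 24 * z ^ 2 * p z"
  have d3: "((\<lambda>z. p z ^ 3) has_real_derivative 3 * p z ^ 2 * (- 2 * z)) (at z)" for z
    unfolding p_def
    by (rule DERIV_chain2[where f = "\<lambda>y. (max 0 y) ^ 3"])
      (use DERIV_pos_part_power[of 1 "1 - z^2"] in \<open>auto intro!: derivative_eq_intros simp: eval_nat_numeral\<close>)
  have d2: "((\<lambda>z. p z ^ 2) has_real_derivative 2 * p z * (- 2 * z)) (at z)" for z
    unfolding p_def
    by (rule DERIV_chain2[where f = "\<lambda>y. (max 0 y) ^ 2"])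
      (use DERIV_pos_part_power[of 0 "1 - z^2"] in \<open>auto intro!: derivative_eq_intros simp: eval_nat_numeral\<close>)
  have cp: "continuous_on UNIV p" unfolding p_def by (intro continuous_intros)
  have p01: "0 \<le> p z" "p z \<le> 1" for z by (auto simp: p_def)
  have pz: "\<bar>z\<bar> \<le> 1" if "p z \<noteq> 0" for z
    using that abs_square_le_1[of z] by (auto simp: p_def max_def split: if_splits)
  have zb: "\<bar>z\<bar> * p z \<le> 1" for z
  proof (cases "p z = 0")
    case False
    then show ?thesis using mult_mono[OF pz p01(2), of z z] p01 by auto
  qed auto
  have zb2: "\<bar>z\<bar> * p z ^ 2 \<le> 1" for z
    using mult_mono[OF zb[of z] p01(2)[of z]] p01 by (auto simp: power2_eq_square mult_ac)
  have zb3: "z ^ 2 * p z \<le> 1" for z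
  proof (cases "p z = 0")
    case False
    then have "z ^ 2 \<le> 1" using pz abs_square_le_1 by blast
    then show ?thesis using mult_mono[of "z^2" 1 "p z" 1] p01 by auto
  qed auto
  show "C2b ?c ?c1 ?c2"
    unfolding C2b_def
  proof (intro conjI allI)
    show "((\<lambda>z. p z ^ 3) has_real_derivative ?c1 z) (at z)" for z
      using d3[of z] by (simp add: algebra_simps)
    show "(?c1 has_real_derivative ?c2 z) (at z)" for z
    proof -
      have "((\<lambda>z. (- 6 * z) * p z ^ 2) has_real_derivative (- 6) * p z ^ 2 + (2 * p z * (- 2 * z)) * (- 6 * z)) (at z)"
        by (rule DERIV_mult[OF _ d2]) (auto intro!: derivative_eq_intros)
      then show ?thesis by (simp add: algebra_simps power2_eq_square)
    qed
    show "continuous_on UNIV ?c2"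
      by (intro continuous_intros cp)
    have "\<bar>?c z\<bar> \<le> 30" for z
      using power_le_one[OF p01, of z 3] p01(1)[of z] by simp
    moreover have "\<bar>?c1 z\<bar> \<le> 30" for z
      using zb2[of z] by (simp add: abs_mult)
    moreover have "\<bar>?c2 z\<bar> \<le> 30" for z
    proof -
      have "0 \<le> p z ^ 2" "p z ^ 2 \<le> 1" "0 \<le> z ^ 2 * p z" "z ^ 2 * p z \<le> 1"
        using zb3[of z] power_le_one[OF p01, of z 2] p01(1)[of z] by auto
      then show ?thesis unfolding abs_le_iff mult.assoc by linarith
    qed
    ultimately show "\<exists>B. \<forall>z. \<bar>?c z\<bar> \<le> B \<and> \<bar>?c1 z\<bar> \<le> B \<and> \<bar>?c2 z\<bar> \<le> B" by blast
  qed
  show "p 0 ^ 3 = 1" by (simp add: p_def)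
  show "\<bar>z\<bar> \<le> 1" if "p z ^ 3 \<noteq> 0" for z using pz that by auto
qed

text \<open>\<open>F x\<close> is the limit of the values of \<open>F\<close> at the next point of a
  grid of mesh \<open>1 / (n + 1)\<close>. The grid point lies strictly to the right of
  \<open>x\<close>, as the filter \<open>at_right x\<close> demands; this is why 1 is added to the
  floor.\<close>

lemma right_continuous_measurable:
  fixes F :: "real \<Rightarrow> real"
  assumes "\<And>x. continuous (at_right x) F"
  shows "F \<in> borel_measurable borel"
proof (rule borel_measurable_LIMSEQ_real)
  let ?a = "\<lambda>n x. (real_of_int \<lfloor>real (Suc n) * x\<rfloor> + 1) / real (Suc n)"
  show "(\<lambda>x. F (?a n x)) \<in> borel_measurable borel" for n
  proof -
    have "(\<lambda>x. \<lfloor>real (Suc n) * x\<rfloor>) \<in> borel \<rightarrow>\<^sub>M count_space UNIV" by measurable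
    then show ?thesis
      by (rule measurable_compose[where g = "\<lambda>i. F ((real_of_int i + 1) / real (Suc n))"]) simp
  qed
  show "(\<lambda>n. F (?a n x)) \<longlonglongrightarrow> F x" for x
  proof -
    have gt: "?a n x > x" for n
      using floor_correct[of "real (Suc n) * x"] by (simp add: field_simps)
    have le: "?a n x \<le> x + 1 / real (Suc n)" for n
    proof -
      have "?a n x \<le> (real (Suc n) * x + 1) / real (Suc n)"
        by (intro divide_right_mono add_mono of_int_floor_le) auto
      then show ?thesis by (simp add: add_divide_distrib del: of_nat_Suc)
    qed
    have "(\<lambda>n. x + 1 / real (Suc n)) \<longlonglongrightarrow> x"
      using tendsto_add[OF tendsto_const LIMSEQ_inverse_real_of_nat, of x] by (simp add: inverse_eq_divide)
    then have "(\<lambda>n. ?a n x) \<longlonglongrightarrow> x"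
      using le gt by (intro tendsto_sandwich[OF _ _ tendsto_const, of x "\<lambda>n. ?a n x" sequentially "\<lambda>n. x + 1 / real (Suc n)"])
        (auto intro!: always_eventually less_imp_le simp del: of_nat_Suc)
    then have "filterlim (\<lambda>n. ?a n x) (at_right x) sequentially"
      using gt by (intro tendsto_imp_filterlim_at_right) auto
    then show ?thesis
      using assms[of x] unfolding continuous_within
      by (rule filterlim_compose[rotated])
  qed
qed

section \<open>The martingale problem for bounded test functions\<close>

lemma C2b_mult:
  assumes "C2b f f1 f2" "C2b g g1 g2"
  shows "C2b (\<lambda>x. f x * g x) (\<lambda>x. f1 x * g x + f x * g1 x) (\<lambda>x. f2 x * g x + 2 * f1 x * g1 x + f x * g2 x)"
proof -
  obtain B where B: "\<And>x. \<bar>f x\<bar> \<le> B \<and> \<bar>f1 x\<bar> \<le> B \<and> \<bar>f2 x\<bar> \<le> B"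
    using assms(1) unfolding C2b_def by blast
  obtain C where C: "\<And>x. \<bar>g x\<bar> \<le> C \<and> \<bar>g1 x\<bar> \<le> C \<and> \<bar>g2 x\<bar> \<le> C"
    using assms(2) unfolding C2b_def by blast
  have "0 \<le> B" "0 \<le> C" using B[of 0] C[of 0] by linarith+
  then have m: "\<bar>a * b\<bar> \<le> B * C" if "\<bar>a\<bar> \<le> B" "\<bar>b\<bar> \<le> C" for a b
    unfolding abs_mult using that by (intro mult_mono) auto
  have BC: "0 \<le> B * C" using \<open>0 \<le> B\<close> \<open>0 \<le> C\<close> by simp
  note df = C2bD[OF assms(1)] and dg = C2bD[OF assms(2)]
  show ?thesis
    unfolding C2b_def
  proof (intro conjI allI)
    show "((\<lambda>x. f x * g x) has_real_derivative f1 x * g x + f x * g1 x) (at x)" for x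
      using DERIV_mult[OF df(1) dg(1), of x] by (simp add: algebra_simps)
    show "((\<lambda>x. f1 x * g x + f x * g1 x) has_real_derivative f2 x * g x + 2 * f1 x * g1 x + f x * g2 x) (at x)" for x
      using DERIV_add[OF DERIV_mult[OF df(2) dg(1)] DERIV_mult[OF df(1) dg(2)], of x]
      by (simp add: algebra_simps)
    show "continuous_on UNIV (\<lambda>x. f2 x * g x + 2 * f1 x * g1 x + f x * g2 x)"
      by (intro continuous_intros df dg)
    have "\<bar>f x * g x\<bar> \<le> 4 * (B * C)" for x using m[of "f x" "g x"] B[of x] C[of x] BC by simp
    moreover have "\<bar>f1 x * g x + f x * g1 x\<bar> \<le> 4 * (B * C)" for x
      using m[of "f1 x" "g x"] m[of "f x" "g1 x"] B[of x] C[of x] BC by (simp add: abs_le_iff)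
    moreover have "\<bar>f2 x * g x + 2 * f1 x * g1 x + f x * g2 x\<bar> \<le> 4 * (B * C)" for x
      using m[of "f2 x" "g x"] m[of "f x" "g2 x"] m[of "f1 x" "g1 x"] B[of x] C[of x] BC
      by (simp add: abs_le_iff mult.assoc)
    ultimately show "\<exists>K. \<forall>x. \<bar>f x * g x\<bar> \<le> K \<and> \<bar>f1 x * g x + f x * g1 x\<bar> \<le> K \<and>
        \<bar>f2 x * g x + 2 * f1 x * g1 x + f x * g2 x\<bar> \<le> K" by blast
  qed
qed

lemma C2b_affine:
  assumes "C2b g g1 g2"
  shows "C2b (\<lambda>x. g (a * x + b)) (\<lambda>x. a * g1 (a * x + b)) (\<lambda>x. a ^ 2 * g2 (a * x + b))"
proof -
  obtain C where C: "\<And>x. \<bar>g x\<bar> \<le> C \<and> \<bar>g1 x\<bar> \<le> C \<and> \<bar>g2 x\<bar> \<le> C"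
    using assms(1) unfolding C2b_def by blast
  have C0: "0 \<le> C" using C[of 0] by linarith
  note dg = C2bD[OF assms(1)]
  have l: "((\<lambda>x. a * x + b) has_real_derivative a) (at x)" for x
    by (auto intro!: derivative_eq_intros)
  show ?thesis
    unfolding C2b_def
  proof (intro conjI allI)
    show "((\<lambda>x. g (a * x + b)) has_real_derivative a * g1 (a * x + b)) (at x)" for x
      using DERIV_chain2[OF dg(1) l, of x] by (simp only: mult.commute[of "g1 (a * x + b)"])
    show "((\<lambda>x. a * g1 (a * x + b)) has_real_derivative a ^ 2 * g2 (a * x + b)) (at x)" for x
      using DERIV_cmult[OF DERIV_chain2[OF dg(2) l[of x]], where c = a] by (simp only: mult.commute[of "g2 (a * x + b)"] power2_eq_square mult.assoc)
    show "continuous_on UNIV (\<lambda>x. a ^ 2 * g2 (a * x + b))"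
      by (intro continuous_intros continuous_on_compose2[OF dg(5)]) auto
    have 1: "\<bar>c * y\<bar> \<le> (1 + \<bar>a\<bar> + a ^ 2) * C" if "\<bar>c\<bar> \<le> 1 + \<bar>a\<bar> + a ^ 2" "\<bar>y\<bar> \<le> C" for c y
      unfolding abs_mult using that by (intro mult_mono) auto
    have "\<bar>g (a * x + b)\<bar> \<le> (1 + \<bar>a\<bar> + a ^ 2) * C" "\<bar>a * g1 (a * x + b)\<bar> \<le> (1 + \<bar>a\<bar> + a ^ 2) * C"
      "\<bar>a ^ 2 * g2 (a * x + b)\<bar> \<le> (1 + \<bar>a\<bar> + a ^ 2) * C" for x
      using 1[of 1 "g (a * x + b)"] 1[of a "g1 (a * x + b)"] 1[of "a ^ 2" "g2 (a * x + b)"] C[of "a * x + b"]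
      by auto
    then show "\<exists>K. \<forall>x. \<bar>g (a * x + b)\<bar> \<le> K \<and> \<bar>a * g1 (a * x + b)\<bar> \<le> K \<and> \<bar>a ^ 2 * g2 (a * x + b)\<bar> \<le> K"
      by blast
  qed
qed

lemma C2b_const: "C2b (\<lambda>_. c) (\<lambda>_. 0) (\<lambda>_. 0)"
  unfolding C2b_def by (auto intro!: exI[of _ "\<bar>c\<bar>"])

lemma tensor_bound:
  assumes "\<And>k. k < N \<Longrightarrow> \<bar>h k (x k)\<bar> \<le> B k"
  shows "\<bar>tensor N h x\<bar> \<le> (\<Prod>k<N. B k)"
  unfolding tensor_def abs_prod using assms by (intro prod_mono) auto

lemma jump_bound:
  assumes "\<And>x. \<bar>f x\<bar> \<le> B" "2 \<le> N"
  shows "\<bar>jump N f x\<bar> \<le> real N * B"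
proof -
  have "\<bar>\<Sum>i<N. \<Sum>j\<in>{..<N} - {i}. f (theta i j x) - f x\<bar> \<le> (\<Sum>i<N. \<Sum>j\<in>{..<N} - {i}. 2 * B)"
  proof (intro sum_abs[THEN order_trans] sum_mono)
    fix i j
    show "\<bar>f (theta i j x) - f x\<bar> \<le> 2 * B"
      using assms(1)[of x] assms(1)[of "theta i j x"] by linarith
  qed
  also have "\<dots> = real N * (real N - 1) * (2 * B)"
    using assms(2) by (simp add: of_nat_diff)
  finally have "1 / (2 * (real N - 1)) * \<bar>\<Sum>i<N. \<Sum>j\<in>{..<N} - {i}. f (theta i j x) - f x\<bar>
      \<le> 1 / (2 * (real N - 1)) * (real N * (real N - 1) * (2 * B))"
    using assms(2) by (intro mult_left_mono) auto
  also have "\<dots> = real N * B" using assms(2) by (simp add: field_simps)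
  finally show ?thesis
    unfolding jump_def abs_mult using assms(2) by simp
qed

text \<open>The endpoint is a null set, so the averages see \<open>F\<close> only before
  \<open>t\<close> and converge to its left limit, whatever the value at \<open>t\<close>. Applied
  to the drift along a path, this produces left derivatives of expectations.\<close>

lemma left_average_tendsto:
  fixes F :: "real \<Rightarrow> real"
  assumes "(F \<longlongrightarrow> L) (at_left t)" "F integrable_on {a..t}" "a < t"
    and Z: "Z \<longlonglongrightarrow> t" "\<And>n. Z n < t"
  shows "(\<lambda>n. integral {Z n..t} F / (t - Z n)) \<longlonglongrightarrow> L"
proof (rule LIMSEQ_I)
  fix e :: real assume "e > 0"
  then have "\<forall>\<^sub>F x in at_left t. dist (F x) L < e / 2"
    using assms(1)[unfolded tendsto_iff, rule_format, of "e / 2"] by simp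
  then obtain b where b: "b < t" "\<And>x. b < x \<Longrightarrow> x < t \<Longrightarrow> dist (F x) L < e / 2"
    using eventually_at_left[OF \<open>a < t\<close>] by auto
  have "\<forall>\<^sub>F n in sequentially. Z n > max a b"
    using order_tendstoD(1)[OF Z(1), of "max a b"] b assms(3) by auto
  then obtain n0 where n0: "\<And>n. n \<ge> n0 \<Longrightarrow> Z n > max a b"
    by (auto simp: eventually_sequentially)
  have "norm (integral {Z n..t} F / (t - Z n) - L) < e" if "n \<ge> n0" for n
  proof -
    have z: "a < Z n" "b < Z n" "Z n < t" using n0[OF that] Z(2) by auto
    have "F integrable_on {Z n..t}"
      by (rule integrable_subinterval_real[OF assms(2)]) (use z in auto)
    then have "(F has_integral integral {Z n..t} F) {Z n..t}" by (rule integrable_integral)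
    moreover have "((\<lambda>x. L) has_integral (t - Z n) * L) {Z n..t}"
      using has_integral_const_real[of L "Z n" t] z by simp
    ultimately have "((\<lambda>x. F x - L) has_integral (integral {Z n..t} F - (t - Z n) * L)) {Z n..t}"
      by (rule has_integral_diff)
    then have "norm (integral {Z n..t} F - (t - Z n) * L) \<le> e / 2 * measure lborel {Z n..t}"
    proof (rule has_integral_bound_real[rotated 2])
      show "norm (F x - L) \<le> e / 2" if "x \<in> {Z n..t} - {t}" for x
        using b(2)[of x] z that by (auto simp: dist_norm)
    qed (use \<open>e > 0\<close> in auto)
    then have "\<bar>integral {Z n..t} F - (t - Z n) * L\<bar> \<le> e / 2 * (t - Z n)" using z by simp
    also have "\<dots> < e * (t - Z n)" using z \<open>e > 0\<close> by simp
    finally have "\<bar>integral {Z n..t} F - (t - Z n) * L\<bar> / (t - Z n) < e"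
      using z by (simp add: field_simps)
    moreover have "integral {Z n..t} F / (t - Z n) - L = (integral {Z n..t} F - (t - Z n) * L) / (t - Z n)"
      using z by (simp add: field_simps)
    ultimately show ?thesis using z by (simp add: abs_divide)
  qed
  then show "\<exists>no. \<forall>n\<ge>no. norm (integral {Z n..t} F / (t - Z n) - L) < e" by blast
qed

section \<open>The particle system for a fixed number of particles\<close>

locale particle_system = prob_space M for M :: "'a measure" +
  fixes N :: nat and X :: "real \<Rightarrow> 'a \<Rightarrow> nat \<Rightarrow> real"
  assumes N2: "2 \<le> N" and mp: "solves_mp M N X"
begin

lemma X_measurable [measurable]: "0 \<le> t \<Longrightarrow> i < N \<Longrightarrow> (\<lambda>\<omega>. X t \<omega> i) \<in> borel_measurable M"
  using mp unfolding solves_mp_def by blast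

lemma X_right: "\<omega> \<in> space M \<Longrightarrow> i < N \<Longrightarrow> 0 \<le> t \<Longrightarrow> ((\<lambda>s. X s \<omega> i) \<longlongrightarrow> X t \<omega> i) (at_right t)"
  using mp unfolding solves_mp_def continuous_within by blast

text \<open>The martingale problem does not by itself exclude jumps at fixed times, so left time derivatives
  of expectations are expressed through the left limit of the process.\<close>

definition Y :: "real \<Rightarrow> 'a \<Rightarrow> nat \<Rightarrow> real" where
  "Y t \<omega> i = Lim (at_left t) (\<lambda>s. X s \<omega> i)"

lemma X_left: 
  assumes "\<omega> \<in> space M" "i < N" "0 < t"
  shows "((\<lambda>s. X s \<omega> i) \<longlongrightarrow> Y t \<omega> i) (at_left t)"
proof -
  obtain l where l: "((\<lambda>s. X s \<omega> i) \<longlongrightarrow> l) (at_left t)"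
    using mp assms unfolding solves_mp_def by blast
  then have "Y t \<omega> i = l" unfolding Y_def by (intro tendsto_Lim) auto
  then show ?thesis using l by simp
qed

lemma left_sequence:
  assumes "0 < (t::real)"
  obtains Z where "Z \<longlonglongrightarrow> t" "\<And>n. Z n < t" "\<And>n. 0 \<le> Z n" "filterlim Z (at_left t) sequentially"
proof
  define Z where "Z n = t - t / real (Suc n)" for n
  have "(\<lambda>n. t * inverse (real (Suc n))) \<longlonglongrightarrow> t * 0"
    by (intro tendsto_intros LIMSEQ_inverse_real_of_nat)
  from tendsto_diff[OF tendsto_const[of t] this] show Z: "Z \<longlonglongrightarrow> t"
    by (simp add: Z_def[abs_def] inverse_eq_divide)
  show Zl: "Z n < t" for n using assms by (simp add: Z_def)
  show "0 \<le> Z n" for n using assms by (simp add: Z_def field_simps)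
  show "filterlim Z (at_left t) sequentially"
    by (intro tendsto_imp_filterlim_at_left Z always_eventually allI Zl)
qed

lemma Y_measurable [measurable]:
  assumes "0 < t" "i < N"
  shows "(\<lambda>\<omega>. Y t \<omega> i) \<in> borel_measurable M"
proof -
  obtain Z where Z: "Z \<longlonglongrightarrow> t" "\<And>n. Z n < t" "\<And>n. 0 \<le> Z n" "filterlim Z (at_left t) sequentially"
    using left_sequence[OF assms(1)] by blast
  show ?thesis
  proof (rule borel_measurable_LIMSEQ_real)
    show "(\<lambda>n. X (Z n) \<omega> i) \<longlonglongrightarrow> Y t \<omega> i" if "\<omega> \<in> space M" for \<omega>
      by (rule filterlim_compose[OF X_left[OF that assms(2,1)] Z(4)])
  qed (use Z assms in auto)
qed

lemma bdd_cyl_X_measurable: "bdd_cyl N f \<Longrightarrow> 0 \<le> t \<Longrightarrow> (\<lambda>\<omega>. f (X t \<omega>)) \<in> borel_measurable M"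
  by (rule bdd_cyl_measurable) auto

lemma bdd_cyl_Y_measurable: "bdd_cyl N f \<Longrightarrow> 0 < t \<Longrightarrow> (\<lambda>\<omega>. f (Y t \<omega>)) \<in> borel_measurable M"
  by (rule bdd_cyl_measurable) auto

lemma bdd_cyl_X_integrable:
  assumes "bdd_cyl N f" "0 \<le> t" shows "integrable M (\<lambda>\<omega>. f (X t \<omega>))"
proof -
  obtain B where "\<And>x. \<bar>f x\<bar> \<le> B" using bdd_cyl_bounded[OF assms(1)] by blast
  then show ?thesis
    by (intro integrable_const_bound[where B = B] bdd_cyl_X_measurable assms) auto
qed

lemma bdd_cyl_Y_integrable:
  assumes "bdd_cyl N f" "0 < t" shows "integrable M (\<lambda>\<omega>. f (Y t \<omega>))"
proof -
  obtain B where "\<And>x. \<bar>f x\<bar> \<le> B" using bdd_cyl_bounded[OF assms(1)] by blast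
  then show ?thesis
    by (intro integrable_const_bound[where B = B] bdd_cyl_Y_measurable assms) auto
qed

lemma path_integrable:
  assumes g: "bdd_cyl N g" and \<omega>: "\<omega> \<in> space M" and "0 \<le> a"
  shows "(\<lambda>q. g (X q \<omega>)) integrable_on {a..b}"
proof -
  \<comment> \<open>Freezing the path before time 0 gives a function that is right continuous on the
    whole line, hence Borel.\<close>
  define F where "F q = g (X (max q 0) \<omega>)" for q
  have "continuous (at_right x) F" for x
  proof (cases "x < 0")
    case True
    have "\<forall>\<^sub>F y in at_right x. y < 0"
      using True by (intro order_tendstoD(2)[OF tendsto_ident_at])
    then have "\<forall>\<^sub>F y in at_right x. F y = F x"
      by eventually_elim (use True in \<open>simp add: F_def\<close>)
    then have "(F \<longlongrightarrow> F x) (at_right x)" by (rule tendsto_eventually)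
    then show ?thesis by (simp add: continuous_within)
  next
    case False
    then have "((\<lambda>q. g (X q \<omega>)) \<longlongrightarrow> g (X x \<omega>)) (at_right x)"
      by (intro bdd_cyl_tendsto[OF g] X_right \<omega>) auto
    moreover have "\<forall>\<^sub>F y in at_right x. F y = g (X y \<omega>)"
      using eventually_at_right_less[of x] by eventually_elim (use False in \<open>auto simp: F_def max_def\<close>)
    ultimately have "(F \<longlongrightarrow> g (X x \<omega>)) (at_right x)"
      by (simp add: tendsto_cong)
    then show ?thesis using False by (simp add: continuous_within F_def max_def)
  qed
  then have [measurable]: "F \<in> borel_measurable borel" by (rule right_continuous_measurable)
  obtain B where B: "\<And>x. \<bar>g x\<bar> \<le> B" using bdd_cyl_bounded[OF g] by blast
  have "set_integrable lborel {a..b} F"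
    unfolding set_integrable_def
    by (rule integrableI_bounded_set_indicator[where B = B]) (auto simp: emeasure_lborel_Icc_eq, simp add: F_def B)
  then have "F integrable_on {a..b}" by (rule set_borel_integral_eq_integral)
  then show ?thesis
    by (rule integrable_eq) (use assms(3) in \<open>auto simp: F_def\<close>)
qed

lemma path_integral_bound:
  assumes g: "bdd_cyl N g" and \<omega>: "\<omega> \<in> space M" and "0 \<le> a" "a \<le> b" and B: "\<And>x. \<bar>g x\<bar> \<le> B"
  shows "\<bar>integral {a..b} (\<lambda>q. g (X q \<omega>))\<bar> \<le> B * (b - a)"
proof -
  have "0 \<le> B" using B[of "\<lambda>_. 0"] by linarith
  then have "norm (integral {a..b} (\<lambda>q. g (X q \<omega>))) \<le> B * measure lborel {a..b}"
    by (rule has_integral_bound_real[where S = "{}"])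
      (use B path_integrable[OF g \<omega> assms(3)] in \<open>auto intro: integrable_integral\<close>)
  then show ?thesis using assms by simp
qed

text \<open>Conditioning on time 0 and integrating turns the martingale property into an identity
  between expectations, since the martingale vanishes at time 0. This is all that is extracted from
  the martingale property; the rest works with one-time expectations and path regularity.\<close>

lemma mp_expectation:
  assumes "C2c N f" "0 \<le> t"
  shows "integrable M (\<lambda>\<omega>. f (X t \<omega>) - f (X 0 \<omega>) - integral {0..t} (\<lambda>r. gen N f (X r \<omega>)))"
    and "expectation (\<lambda>\<omega>. f (X t \<omega>) - f (X 0 \<omega>) - integral {0..t} (\<lambda>r. gen N f (X r \<omega>))) = 0"
proof -
  let ?M = "\<lambda>t \<omega>. f (X t \<omega>) - f (X 0 \<omega>) - integral {0..t} (\<lambda>r. gen N f (X r \<omega>))"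
  let ?F = "nat_filtration M N X 0"
  from mp have "\<forall>f. C2c N f \<longrightarrow>
        (let Mf = (\<lambda>t \<omega>. f (X t \<omega>) - f (X 0 \<omega>) - integral {0..t} (\<lambda>r. gen N f (X r \<omega>)))
         in (\<forall>t\<ge>0. integrable M (Mf t)) \<and>
            (\<forall>s t. 0 \<le> s \<and> s \<le> t \<longrightarrow>
               (AE \<omega> in M. real_cond_exp M (nat_filtration M N X s) (Mf t) \<omega> = Mf s \<omega>)))"
    unfolding solves_mp_def by (elim conjE)
  from this[rule_format, OF assms(1)] have i: "\<forall>t\<ge>0. integrable M (?M t)"
    and ce: "\<forall>s t. 0 \<le> s \<and> s \<le> t \<longrightarrow>
               (AE \<omega> in M. real_cond_exp M (nat_filtration M N X s) (?M t) \<omega> = ?M s \<omega>)"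
    unfolding Let_def by (rule conjunct1, rule conjunct2)
  show int: "integrable M (?M t)" using i assms(2) by simp
  from ce[rule_format, of 0 t] assms(2)
  have ce: "AE \<omega> in M. real_cond_exp M ?F (?M t) \<omega> = ?M 0 \<omega>" by simp
  let ?A = "\<Union>r\<in>{0..0::real}. \<Union>i\<in>{..<N}. {(\<lambda>\<omega>. X r \<omega> i) -` B \<inter> space M |B. B \<in> sets borel}"
  have A: "?A \<subseteq> sets M"
  proof (intro UN_least subsetI)
    fix r i A assume "r \<in> {0..0::real}" "i \<in> {..<N}" 
      and "A \<in> {(\<lambda>\<omega>. X r \<omega> i) -` B \<inter> space M |B. B \<in> sets borel}"
    then obtain B where "0 \<le> r" "i < N" "A = (\<lambda>\<omega>. X r \<omega> i) -` B \<inter> space M" "B \<in> sets borel"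
      by auto
    then show "A \<in> sets M" using measurable_sets[OF X_measurable] by simp
  qed
  have sub: "subalgebra M ?F"
    unfolding subalgebra_def
  proof
    show "space ?F = space M" unfolding nat_filtration_def by (simp add: space_measure_of_conv)
    have "sets ?F = sigma_sets (space M) ?A"
      unfolding nat_filtration_def using A sets.space_closed by (intro sets_measure_of) blast
    also have "\<dots> \<subseteq> sets M" using A by (rule sets.sigma_sets_subset)
    finally show "sets ?F \<subseteq> sets M" .
  qed
  interpret sub: finite_measure_subalgebra M ?F
    by unfold_locales (rule sub)
  have "expectation (?M t) = expectation (real_cond_exp M ?F (?M t))"
    using sub.real_cond_exp_int(2)[OF int] by simp
  also have "\<dots> = expectation (\<lambda>\<omega>. 0)"
    by (rule integral_cong_AE) (use ce in auto)
  finally show "expectation (?M t) = 0" by simp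
qed

text \<open>\<open>l\<close> plays the role of the Laplacian of \<open>f\<close>; keeping it apart from the jump part makes the
  relation linear in \<open>(f, l)\<close>.\<close>

definition dyn :: "((nat \<Rightarrow> real) \<Rightarrow> real) \<Rightarrow> ((nat \<Rightarrow> real) \<Rightarrow> real) \<Rightarrow> bool" where
  "dyn f l \<longleftrightarrow> bdd_cyl N f \<and> bdd_cyl N l \<and> bdd_cyl N (jump N f) \<and>
    (\<forall>t\<ge>0. (\<lambda>\<omega>. integral {0..t} (\<lambda>r. 1/2 * l (X r \<omega>) + jump N f (X r \<omega>))) \<in> borel_measurable M \<and>
       expectation (\<lambda>\<omega>. f (X t \<omega>)) - expectation (\<lambda>\<omega>. f (X 0 \<omega>)) =
       expectation (\<lambda>\<omega>. integral {0..t} (\<lambda>r. 1/2 * l (X r \<omega>) + jump N f (X r \<omega>))))"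

text \<open>Each factor is multiplied by a cutoff stretched to width \<open>n + 1\<close>.
  Differentiating the cutoff costs a factor \<open>r n\<close> or \<open>r n ^ 2\<close>, which
  tends to 0, and all functions stay bounded uniformly in \<open>n\<close>; dominated convergence,
  first in time and then in probability, removes the cutoff.\<close>

lemma dyn_tensor:
  assumes h: "\<And>k. C2b (h k) (h1 k) (h2 k)"
  shows "dyn (tensor N h) (\<lambda>x. \<Sum>i<N. tensor N (h(i := h2 i)) x)"
proof -
  obtain c0 c1 c2 where c: "C2b c0 c1 c2" and c00: "c0 0 = 1" and csupp: "\<And>z. c0 z \<noteq> 0 \<Longrightarrow> \<bar>z\<bar> \<le> 1"
    by (rule cutoff_exists) blast
  define r where "r n = inverse (real (Suc n))" for n
  have r: "0 < r n" "r n \<le> 1" for n by (auto simp: r_def inverse_le_1_iff)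
  have rlim: "r \<longlonglongrightarrow> 0" unfolding r_def by (rule LIMSEQ_inverse_real_of_nat)
  define p where "p n k y = h k y * c0 (r n * y)" for n k y
  define p1 where "p1 n k y = h1 k y * c0 (r n * y) + h k y * (r n * c1 (r n * y))" for n k y
  define p2 where "p2 n k y = h2 k y * c0 (r n * y) + 2 * h1 k y * (r n * c1 (r n * y)) + h k y * (r n ^ 2 * c2 (r n * y))" for n k y
  have p: "C2b (p n k) (p1 n k) (p2 n k)" for n k
    using C2b_mult[OF h C2b_affine[OF c, of "r n" 0], of k] unfolding p_def p1_def p2_def by simp
  have psupp: "\<bar>y\<bar> \<le> real (Suc n)" if "p n k y \<noteq> 0" for n k y
  proof -
    have "\<bar>r n * y\<bar> \<le> 1" using that csupp[of "r n * y"] by (auto simp: p_def)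
    then show ?thesis by (simp add: r_def abs_mult field_simps)
  qed
  have C: "C2c N (tensor N (p n))"
    "gen N (tensor N (p n)) x = 1/2 * (\<Sum>i<N. tensor N ((p n)(i := p2 n i)) x) + jump N (tensor N (p n)) x" for n x
    using tensor_C2c[of "p n" "p1 n" "p2 n" "real (Suc n)" N, OF p] psupp by blast+
  obtain C where C0: "\<And>x. \<bar>c0 x\<bar> \<le> C \<and> \<bar>c1 x\<bar> \<le> C \<and> \<bar>c2 x\<bar> \<le> C"
    using c unfolding C2b_def by blast
  have "0 \<le> C" using C0[of 0] by linarith
  obtain B where B: "\<And>k x. \<bar>h k x\<bar> \<le> B k \<and> \<bar>h1 k x\<bar> \<le> B k \<and> \<bar>h2 k x\<bar> \<le> B k"
    using h unfolding C2b_def by metis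
  have B0: "0 \<le> B k" for k using B[of k 0] by linarith
  \<comment> \<open>The factor 4 counts the products in \<open>p2\<close> with multiplicity: one,
    two and one.\<close>
  define D where "D k = 4 * (B k * C)" for k
  have m: "\<bar>a * b\<bar> \<le> B k * C" if "\<bar>a\<bar> \<le> B k" "\<bar>b\<bar> \<le> C" for a b k
    unfolding abs_mult using that \<open>0 \<le> C\<close> B0 by (intro mult_mono) auto
  have rC: "\<bar>r n * y\<bar> \<le> C" "\<bar>r n ^ 2 * y\<bar> \<le> C" if "\<bar>y\<bar> \<le> C" for n y
  proof -
    have "\<bar>a * y\<bar> \<le> C" if "0 \<le> a" "a \<le> 1" for a
      using mult_mono[of a 1 "\<bar>y\<bar>" C] that \<open>\<bar>y\<bar> \<le> C\<close> \<open>0 \<le> C\<close> by (simp add: abs_mult)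
    then show "\<bar>r n * y\<bar> \<le> C" "\<bar>r n ^ 2 * y\<bar> \<le> C"
      using r[of n] by (auto simp: power_le_one)
  qed
  have pD: "\<bar>p n k y\<bar> \<le> D k" "\<bar>p2 n k y\<bar> \<le> D k" for n k y
  proof -
    have BC: "0 \<le> B k * C" using B0 \<open>0 \<le> C\<close> by simp
    show "\<bar>p n k y\<bar> \<le> D k"
      using m[of "h k y" k "c0 (r n * y)"] B[of k y] C0[of "r n * y"] BC by (simp add: p_def D_def)
    show "\<bar>p2 n k y\<bar> \<le> D k"
      using m[of "h2 k y" k "c0 (r n * y)"] m[of "h1 k y" k "r n * c1 (r n * y)"] m[of "h k y" k "r n ^ 2 * c2 (r n * y)"]
        rC[of "c1 (r n * y)" n] rC[of "c2 (r n * y)" n]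
        B[of k y] C0[of "r n * y"] BC by (simp add: p2_def D_def abs_le_iff mult.assoc)
  qed
  have cl: "(\<lambda>n. c0 (r n * y)) \<longlonglongrightarrow> 1" "(\<lambda>n. r n * c1 (r n * y)) \<longlonglongrightarrow> 0" "(\<lambda>n. r n ^ 2 * c2 (r n * y)) \<longlonglongrightarrow> 0" for y
  proof -
    have ry: "(\<lambda>n. r n * y) \<longlonglongrightarrow> 0" using tendsto_mult_right[OF rlim, of y] by simp
    have "(\<lambda>n. c (r n * y)) \<longlonglongrightarrow> c 0" if "continuous_on UNIV c" for c :: "real \<Rightarrow> real"
      by (rule isCont_tendsto_compose[OF _ ry]) (use that in \<open>simp add: continuous_on_eq_continuous_at\<close>)
    note q = this[OF C2bD(3)[OF c]] this[OF C2bD(4)[OF c]] this[OF C2bD(5)[OF c]]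
    show "(\<lambda>n. c0 (r n * y)) \<longlonglongrightarrow> 1" using q(1) c00 by simp
    show "(\<lambda>n. r n * c1 (r n * y)) \<longlonglongrightarrow> 0" using tendsto_mult[OF rlim q(2)] by simp
    show "(\<lambda>n. r n ^ 2 * c2 (r n * y)) \<longlonglongrightarrow> 0"
      using tendsto_mult[OF tendsto_power[OF rlim, of 2] q(3)] by simp
  qed
  have plim: "(\<lambda>n. p n k y) \<longlonglongrightarrow> h k y" for k y
    using tendsto_mult[OF tendsto_const[of "h k y"] cl(1)[of y]] by (simp add: p_def)
  have p2lim: "(\<lambda>n. p2 n k y) \<longlonglongrightarrow> h2 k y" for k y
    using tendsto_add[OF tendsto_add[OF tendsto_mult[OF tendsto_const[of "h2 k y"] cl(1)[of y]]
       tendsto_mult[OF tendsto_const[of "2 * h1 k y"] cl(2)[of y]]] tendsto_mult[OF tendsto_const[of "h k y"] cl(3)[of y]]]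
    by (simp add: p2_def)
  have tl: "(\<lambda>n. tensor N (p n) x) \<longlonglongrightarrow> tensor N h x" for x
    unfolding tensor_def by (intro tendsto_prod plim)
  have t2l: "(\<lambda>n. tensor N ((p n)(i := p2 n i)) x) \<longlonglongrightarrow> tensor N (h(i := h2 i)) x" for x i
    unfolding tensor_def by (intro tendsto_prod) (auto intro: plim p2lim)
  have jl: "(\<lambda>n. jump N (tensor N (p n)) x) \<longlonglongrightarrow> jump N (tensor N h) x" for x
    unfolding jump_def by (intro tendsto_intros tl)
  let ?gn = "\<lambda>n x. 1/2 * (\<Sum>i<N. tensor N ((p n)(i := p2 n i)) x) + jump N (tensor N (p n)) x"
  let ?g = "\<lambda>x. 1/2 * (\<Sum>i<N. tensor N (h(i := h2 i)) x) + jump N (tensor N h) x"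
  define E where "E = (\<Prod>k<N. D k)"
  have tb: "\<bar>tensor N (p n) x\<bar> \<le> E" "\<bar>tensor N ((p n)(i := p2 n i)) x\<bar> \<le> E" for n x i
    unfolding E_def by (intro tensor_bound; auto intro: pD)+
  have E0: "0 \<le> E" using tb(1)[of 0 "\<lambda>_. 0"] by linarith
  have gnb: "\<bar>?gn n x\<bar> \<le> real N * (2 * E)" for n x
  proof -
    have "\<bar>\<Sum>i<N. tensor N ((p n)(i := p2 n i)) x\<bar> \<le> (\<Sum>i<N. E)"
      by (intro sum_abs[THEN order_trans] sum_mono tb)
    moreover have "\<bar>jump N (tensor N (p n)) x\<bar> \<le> real N * E"
      by (intro jump_bound tb N2)
    moreover have "0 \<le> real N * E" using E0 by simp
    ultimately show ?thesis by (simp add: abs_le_iff)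
  qed
  have cbs: "bdd_cyl N (tensor N h)" "bdd_cyl N (\<lambda>x. \<Sum>i<N. tensor N (h(i := h2 i)) x)" "bdd_cyl N (jump N (tensor N h))"
    if "\<And>k. C2b (h k) (h1 k) (h2 k)" for h h1 h2
    using C2bD[OF that]
    by (auto intro!: bdd_cyl_tensor bdd_cyl_sum bdd_cyl_jump bdd_cyl_tensor_theta)
  have cg: "bdd_cyl N ?g" by (intro bdd_cyl_add bdd_cyl_cmult cbs[OF h])
  have cgn: "bdd_cyl N (?gn n)" for n by (intro bdd_cyl_add bdd_cyl_cmult cbs[OF p])
  have main: "(\<lambda>\<omega>. integral {0..t} (\<lambda>r. ?g (X r \<omega>))) \<in> borel_measurable M \<and>
      expectation (\<lambda>\<omega>. tensor N h (X t \<omega>) - tensor N h (X 0 \<omega>) - integral {0..t} (\<lambda>r. ?g (X r \<omega>))) = 0"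
    if t: "0 \<le> t" for t
  proof -
    let ?I = "\<lambda>n \<omega>. integral {0..t} (\<lambda>r. ?gn n (X r \<omega>))"
    let ?K = "\<lambda>n \<omega>. tensor N (p n) (X t \<omega>) - tensor N (p n) (X 0 \<omega>) - ?I n \<omega>"
    have K: "integrable M (?K n)" "expectation (?K n) = 0" for n
      using mp_expectation[OF C(1)[of n] t] unfolding C(2) by auto
    have tm: "(\<lambda>\<omega>. tensor N (p n) (X s \<omega>)) \<in> borel_measurable M" if "0 \<le> s" for n s
      by (intro bdd_cyl_X_measurable cbs(1)[OF p] that)
    \<comment> \<open>Measurability of the time integral is read off from the integrability
      contained in the martingale problem: the integral is a difference of measurable functions.
      This avoids joint measurability of the process in time and randomness.\<close>
    have Im: "?I n \<in> borel_measurable M" for n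
    proof -
      have "(\<lambda>\<omega>. tensor N (p n) (X t \<omega>) - tensor N (p n) (X 0 \<omega>) - ?K n \<omega>) \<in> borel_measurable M"
        by (intro borel_measurable_diff tm t order_refl borel_measurable_integrable[OF K(1)])
      then show ?thesis by simp
    qed
    have Il: "(\<lambda>n. ?I n \<omega>) \<longlonglongrightarrow> integral {0..t} (\<lambda>r. ?g (X r \<omega>))" if w: "\<omega> \<in> space M" for \<omega>
    proof (rule dominated_convergence(2)[where h = "\<lambda>_. real N * (2 * E)"])
      show "(\<lambda>r. ?gn n (X r \<omega>)) integrable_on {0..t}" for n
        by (rule path_integrable[OF cgn w]) auto
      show "norm (?gn n (X r \<omega>)) \<le> real N * (2 * E)" for n r
        using gnb[of n "X r \<omega>"] by simp
      show "(\<lambda>n. ?gn n (X r \<omega>)) \<longlonglongrightarrow> ?g (X r \<omega>)" for r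
        by (intro tendsto_intros t2l jl)
    qed auto
    have Ib: "\<bar>?I n \<omega>\<bar> \<le> real N * (2 * E) * (t - 0)" if w: "\<omega> \<in> space M" for n \<omega>
      by (rule path_integral_bound[OF cgn w]) (use gnb t in auto)
    have Igm: "(\<lambda>\<omega>. integral {0..t} (\<lambda>r. ?g (X r \<omega>))) \<in> borel_measurable M"
      by (rule borel_measurable_LIMSEQ_real[OF Il Im])
    have "(\<lambda>n. expectation (?K n)) \<longlonglongrightarrow> expectation (\<lambda>\<omega>. tensor N h (X t \<omega>) - tensor N h (X 0 \<omega>) - integral {0..t} (\<lambda>r. ?g (X r \<omega>)))"
    proof (rule integral_dominated_convergence[where w = "\<lambda>_. 2 * E + real N * (2 * E) * t"])
      show "(\<lambda>\<omega>. tensor N h (X t \<omega>) - tensor N h (X 0 \<omega>) - integral {0..t} (\<lambda>r. ?g (X r \<omega>))) \<in> borel_measurable M"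
        by (intro borel_measurable_diff bdd_cyl_X_measurable cbs(1)[OF h] Igm t order_refl)
      show "?K n \<in> borel_measurable M" for n using K(1) by (rule borel_measurable_integrable)
      show "AE \<omega> in M. (\<lambda>n. ?K n \<omega>) \<longlonglongrightarrow> tensor N h (X t \<omega>) - tensor N h (X 0 \<omega>) - integral {0..t} (\<lambda>r. ?g (X r \<omega>))"
        by (intro AE_I2 tendsto_diff tl Il)
      show "AE \<omega> in M. norm (?K n \<omega>) \<le> 2 * E + real N * (2 * E) * t" for n
      proof (rule AE_I2)
        fix \<omega> assume w: "\<omega> \<in> space M"
        show "norm (?K n \<omega>) \<le> 2 * E + real N * (2 * E) * t"
        proof -
          have "\<bar>a - b - c\<bar> \<le> 2 * E + K" if "\<bar>a\<bar> \<le> E" "\<bar>b\<bar> \<le> E" "\<bar>c\<bar> \<le> K" for a b c K :: real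
            using that by linarith
          from this[OF tb(1) tb(1) Ib[OF w]] show ?thesis by simp
        qed
      qed
    qed auto
    then have "expectation (\<lambda>\<omega>. tensor N h (X t \<omega>) - tensor N h (X 0 \<omega>) - integral {0..t} (\<lambda>r. ?g (X r \<omega>))) = 0"
      unfolding K(2) by (simp add: LIMSEQ_const_iff)
    with Igm show ?thesis by blast
  qed
  have Ii: "integrable M (\<lambda>\<omega>. integral {0..t} (\<lambda>r. ?g (X r \<omega>)))" if t: "0 \<le> t" for t
  proof -
    obtain G where G: "\<And>x. \<bar>?g x\<bar> \<le> G" using bdd_cyl_bounded[OF cg] by blast
    show ?thesis
    proof (rule integrable_const_bound[where B = "G * (t - 0)"])
      show "AE \<omega> in M. norm (integral {0..t} (\<lambda>r. ?g (X r \<omega>))) \<le> G * (t - 0)"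
        unfolding real_norm_def by (intro AE_I2 path_integral_bound[OF cg _ _ _ G] t) auto
    qed (rule conjunct1[OF main[OF t]])
  qed
  have "expectation (\<lambda>\<omega>. tensor N h (X t \<omega>)) - expectation (\<lambda>\<omega>. tensor N h (X 0 \<omega>)) =
      expectation (\<lambda>\<omega>. integral {0..t} (\<lambda>r. ?g (X r \<omega>)))" if t: "0 \<le> t" for t
  proof -
    have "expectation (\<lambda>\<omega>. tensor N h (X t \<omega>) - tensor N h (X 0 \<omega>) - integral {0..t} (\<lambda>r. ?g (X r \<omega>)))
      = expectation (\<lambda>\<omega>. tensor N h (X t \<omega>)) - expectation (\<lambda>\<omega>. tensor N h (X 0 \<omega>)) -
        expectation (\<lambda>\<omega>. integral {0..t} (\<lambda>r. ?g (X r \<omega>)))"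
    proof -
      have i: "integrable M (\<lambda>\<omega>. tensor N h (X s \<omega>))" if "0 \<le> s" for s
        by (rule bdd_cyl_X_integrable[OF cbs(1)[OF h] that])
      have i2: "integrable M (\<lambda>\<omega>. tensor N h (X t \<omega>) - tensor N h (X 0 \<omega>))"
        by (rule Bochner_Integration.integrable_diff[OF i[OF t] i[OF order_refl]])
      show ?thesis
        unfolding Bochner_Integration.integral_diff[OF i2 Ii[OF t]]
        unfolding Bochner_Integration.integral_diff[OF i[OF t] i[OF order_refl]] by (rule refl)
    qed
    then show ?thesis using conjunct2[OF main[OF t]] by linarith
  qed
  then show ?thesis
    unfolding dyn_def using cbs[OF h] conjunct1[OF main] by (intro conjI allI impI)
qed

end

section \<open>Left derivatives in time and linearity of the dynamics\<close>

lemma DERIV_left_iff: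
  fixes f :: "real \<Rightarrow> real"
  shows "(f has_real_derivative D) (at_left t) \<longleftrightarrow> ((\<lambda>r. (f t - f r) / (t - r)) \<longlongrightarrow> D) (at_left t)"
proof -
  have "(f y - f t) / (y - t) = (f t - f y) / (t - y)" for y
    using minus_divide_divide[of "f t - f y" "t - y"] by simp
  then show ?thesis unfolding has_field_derivative_iff by simp
qed

text \<open>Dominated convergence is applied along sequences. Dropping an initial segment keeps the
  sequence above \<open>a\<close>, so that in the application all times are nonnegative.\<close>

lemma tendsto_at_leftI_seq:
  fixes f :: "real \<Rightarrow> real"
  assumes "a < t"
    and "\<And>Z. Z \<longlonglongrightarrow> t \<Longrightarrow> (\<And>n. a \<le> Z n) \<Longrightarrow> (\<And>n. Z n < t) \<Longrightarrow> filterlim Z (at_left t) sequentially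
      \<Longrightarrow> (\<lambda>n. f (Z n)) \<longlonglongrightarrow> L"
  shows "(f \<longlongrightarrow> L) (at_left t)"
  unfolding tendsto_at_iff_sequentially
proof (intro allI impI)
  fix Z assume Z: "\<forall>i. Z i \<in> {..<t} - {t}" "Z \<longlonglongrightarrow> t"
  have "\<forall>\<^sub>F n in sequentially. a < Z n" using order_tendstoD(1)[OF Z(2) assms(1)] .
  then obtain n0 where n0: "\<And>n. n0 \<le> n \<Longrightarrow> a < Z n" by (auto simp: eventually_sequentially)
  let ?Z = "\<lambda>n. Z (n + n0)"
  have Z': "?Z \<longlonglongrightarrow> t" using Z(2) by (rule LIMSEQ_ignore_initial_segment)
  have Zl: "?Z n < t" for n using Z(1) by auto
  have Zf: "filterlim ?Z (at_left t) sequentially"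
    by (intro tendsto_imp_filterlim_at_left Z' always_eventually allI Zl)
  have Za: "a \<le> ?Z n" for n using n0[of "n + n0"] by simp
  have "(\<lambda>n. f (?Z n)) \<longlonglongrightarrow> L"
    by (rule assms(2)[OF Z' Za Zl Zf])
  then show "(f \<circ> Z) \<longlonglongrightarrow> L"
    unfolding o_def by (rule LIMSEQ_offset)
qed

context particle_system
begin

lemma dyn_bdd_cyl: "dyn f l \<Longrightarrow> bdd_cyl N f" "dyn f l \<Longrightarrow> bdd_cyl N (\<lambda>x. 1/2 * l x + jump N f x)"
  unfolding dyn_def by (elim conjE, assumption) (elim conjE, intro bdd_cyl_add bdd_cyl_cmult)

lemma path_integral_integrable:
  assumes g: "bdd_cyl N g" and "0 \<le> t"
    and "(\<lambda>\<omega>. integral {0..t} (\<lambda>r. g (X r \<omega>))) \<in> borel_measurable M"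
  shows "integrable M (\<lambda>\<omega>. integral {0..t} (\<lambda>r. g (X r \<omega>)))"
proof -
  obtain G where G: "\<And>x. \<bar>g x\<bar> \<le> G" using bdd_cyl_bounded[OF g] by blast
  show ?thesis
  proof (rule integrable_const_bound[where B = "G * (t - 0)"])
    show "AE \<omega> in M. norm (integral {0..t} (\<lambda>r. g (X r \<omega>))) \<le> G * (t - 0)"
      unfolding real_norm_def by (intro AE_I2 path_integral_bound[OF g _ _ _ G] assms) auto
  qed (rule assms)
qed

lemma dyn_sum:
  assumes "finite A" and d: "\<And>a. a \<in> A \<Longrightarrow> dyn (f a) (l a)"
  shows "dyn (\<lambda>x. \<Sum>a\<in>A. f a x) (\<lambda>x. \<Sum>a\<in>A. l a x)"
proof -
  let ?g = "\<lambda>a x. 1/2 * l a x + jump N (f a) x"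
  have j: "jump N (\<lambda>x. \<Sum>a\<in>A. f a x) = (\<lambda>x. \<Sum>a\<in>A. jump N (f a) x)" by (rule ext) (rule jump_sum)
  have g: "1/2 * (\<Sum>a\<in>A. l a x) + jump N (\<lambda>x. \<Sum>a\<in>A. f a x) x = (\<Sum>a\<in>A. ?g a x)" for x
    unfolding j by (simp add: sum.distrib sum_distrib_left)
  have cg: "bdd_cyl N (?g a)" if "a \<in> A" for a using dyn_bdd_cyl(2)[OF d[OF that]] .
  have I: "integral {0..t} (\<lambda>r. \<Sum>a\<in>A. ?g a (X r \<omega>)) = (\<Sum>a\<in>A. integral {0..t} (\<lambda>r. ?g a (X r \<omega>)))"
    if "\<omega> \<in> space M" for t \<omega>
    by (rule integral_sum[OF assms(1)]) (rule path_integrable[OF cg that], auto)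
  have m: "(\<lambda>\<omega>. integral {0..t} (\<lambda>r. ?g a (X r \<omega>))) \<in> borel_measurable M" if "a \<in> A" "0 \<le> t" for a t
    using d[OF that(1)] that(2) unfolding dyn_def by blast
  show ?thesis
    unfolding dyn_def g
  proof (intro conjI allI impI)
    show "bdd_cyl N (\<lambda>x. \<Sum>a\<in>A. f a x)" "bdd_cyl N (\<lambda>x. \<Sum>a\<in>A. l a x)" "bdd_cyl N (jump N (\<lambda>x. \<Sum>a\<in>A. f a x))"
      unfolding j using d by (auto intro!: bdd_cyl_sum simp: dyn_def)
  next
    fix t :: real assume t: "0 \<le> t"
    show "(\<lambda>\<omega>. integral {0..t} (\<lambda>r. \<Sum>a\<in>A. ?g a (X r \<omega>))) \<in> borel_measurable M"
      by (subst measurable_cong[OF I]) (assumption, intro borel_measurable_sum m t)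
    have "expectation (\<lambda>\<omega>. \<Sum>a\<in>A. f a (X t \<omega>)) - expectation (\<lambda>\<omega>. \<Sum>a\<in>A. f a (X 0 \<omega>))
        = (\<Sum>a\<in>A. expectation (\<lambda>\<omega>. f a (X t \<omega>)) - expectation (\<lambda>\<omega>. f a (X 0 \<omega>)))"
      by (subst (1 2) Bochner_Integration.integral_sum)
         (auto intro!: bdd_cyl_X_integrable dyn_bdd_cyl(1)[OF d] t simp: sum_subtractf)
    also have "\<dots> = (\<Sum>a\<in>A. expectation (\<lambda>\<omega>. integral {0..t} (\<lambda>r. ?g a (X r \<omega>))))"
      using d t by (intro sum.cong) (auto simp: dyn_def)
    also have "\<dots> = expectation (\<lambda>\<omega>. \<Sum>a\<in>A. integral {0..t} (\<lambda>r. ?g a (X r \<omega>)))"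
      by (rule Bochner_Integration.integral_sum[symmetric])
        (intro path_integral_integrable cg m t)
    also have "\<dots> = expectation (\<lambda>\<omega>. integral {0..t} (\<lambda>r. \<Sum>a\<in>A. ?g a (X r \<omega>)))"
      by (intro Bochner_Integration.integral_cong refl I[symmetric])
    finally show "expectation (\<lambda>\<omega>. \<Sum>a\<in>A. f a (X t \<omega>)) - expectation (\<lambda>\<omega>. \<Sum>a\<in>A. f a (X 0 \<omega>)) =
      expectation (\<lambda>\<omega>. integral {0..t} (\<lambda>r. \<Sum>a\<in>A. ?g a (X r \<omega>)))" .
  qed
qed

lemma dyn_cmult:
  assumes d: "dyn f l"
  shows "dyn (\<lambda>x. c * f x) (\<lambda>x. c * l x)"
proof -
  have j: "jump N (\<lambda>x. c * f x) = (\<lambda>x. c * jump N f x)" by (rule ext) (rule jump_cmult)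
  let ?g = "\<lambda>x. 1/2 * l x + jump N f x"
  have g: "1/2 * (c * l x) + jump N (\<lambda>x. c * f x) x = c * ?g x" for x
    unfolding j by (simp add: algebra_simps)
  have e: "(\<lambda>\<omega>. integral {0..t} (\<lambda>r. ?g (X r \<omega>))) \<in> borel_measurable M"
    "expectation (\<lambda>\<omega>. f (X t \<omega>)) - expectation (\<lambda>\<omega>. f (X 0 \<omega>)) =
       expectation (\<lambda>\<omega>. integral {0..t} (\<lambda>r. ?g (X r \<omega>)))" if "0 \<le> t" for t
    using d that unfolding dyn_def by blast+
  show ?thesis
    unfolding dyn_def g integral_mult_right integral_mult_right_zero
  proof (intro conjI allI impI)
    show "bdd_cyl N (\<lambda>x. c * f x)" "bdd_cyl N (\<lambda>x. c * l x)" "bdd_cyl N (jump N (\<lambda>x. c * f x))"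
      unfolding j using d by (auto intro!: bdd_cyl_cmult simp: dyn_def)
  next
    fix t :: real assume t: "0 \<le> t"
    show "(\<lambda>\<omega>. c * integral {0..t} (\<lambda>r. ?g (X r \<omega>))) \<in> borel_measurable M"
      by (intro borel_measurable_times borel_measurable_const e t)
    show "c * expectation (\<lambda>\<omega>. f (X t \<omega>)) - c * expectation (\<lambda>\<omega>. f (X 0 \<omega>)) =
       c * expectation (\<lambda>\<omega>. integral {0..t} (\<lambda>r. ?g (X r \<omega>)))"
      unfolding e(2)[OF t, symmetric] by (rule right_diff_distrib[symmetric])
  qed
qed

lemma dyn_increment:
  assumes d: "dyn f l" and "0 \<le> s" "s \<le> t"
  defines "g \<equiv> \<lambda>x. 1/2 * l x + jump N f x"
  shows "integrable M (\<lambda>\<omega>. integral {s..t} (\<lambda>r. g (X r \<omega>)))"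
    and "expectation (\<lambda>\<omega>. f (X t \<omega>)) - expectation (\<lambda>\<omega>. f (X s \<omega>)) = expectation (\<lambda>\<omega>. integral {s..t} (\<lambda>r. g (X r \<omega>)))"
proof -
  have cg: "bdd_cyl N g" unfolding g_def by (rule dyn_bdd_cyl(2)[OF d])
  have m: "(\<lambda>\<omega>. integral {0..t} (\<lambda>r. g (X r \<omega>))) \<in> borel_measurable M"
    and e: "expectation (\<lambda>\<omega>. f (X t \<omega>)) - expectation (\<lambda>\<omega>. f (X 0 \<omega>)) = expectation (\<lambda>\<omega>. integral {0..t} (\<lambda>r. g (X r \<omega>)))"
    if "0 \<le> t" for t
    using d that unfolding dyn_def g_def by blast+
  have i: "integrable M (\<lambda>\<omega>. integral {0..t} (\<lambda>r. g (X r \<omega>)))" if "0 \<le> t" for t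
    by (rule path_integral_integrable[OF cg that m[OF that]])
  have eq: "integral {0..t} (\<lambda>r. g (X r \<omega>)) - integral {0..s} (\<lambda>r. g (X r \<omega>)) = integral {s..t} (\<lambda>r. g (X r \<omega>))"
    if "\<omega> \<in> space M" for \<omega>
    using Henstock_Kurzweil_Integration.integral_combine[OF assms(2,3) path_integrable[OF cg that order_refl, of t]] by simp
  have t: "0 \<le> t" using assms by simp
  have i2: "integrable M (\<lambda>\<omega>. integral {0..t} (\<lambda>r. g (X r \<omega>)) - integral {0..s} (\<lambda>r. g (X r \<omega>)))"
    using i assms t by auto
  then show "integrable M (\<lambda>\<omega>. integral {s..t} (\<lambda>r. g (X r \<omega>)))"
    by (subst (asm) Bochner_Integration.integrable_cong[OF refl eq])
  have "expectation (\<lambda>\<omega>. f (X t \<omega>)) - expectation (\<lambda>\<omega>. f (X s \<omega>)) =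
    expectation (\<lambda>\<omega>. integral {0..t} (\<lambda>r. g (X r \<omega>))) - expectation (\<lambda>\<omega>. integral {0..s} (\<lambda>r. g (X r \<omega>)))"
    using e[OF t] e[OF assms(2)] by simp
  also have "\<dots> = expectation (\<lambda>\<omega>. integral {0..t} (\<lambda>r. g (X r \<omega>)) - integral {0..s} (\<lambda>r. g (X r \<omega>)))"
    by (rule Bochner_Integration.integral_diff[symmetric]) (use i t assms(2) in auto)
  also have "\<dots> = expectation (\<lambda>\<omega>. integral {s..t} (\<lambda>r. g (X r \<omega>)))"
    by (rule Bochner_Integration.integral_cong[OF refl eq])
  finally show "expectation (\<lambda>\<omega>. f (X t \<omega>)) - expectation (\<lambda>\<omega>. f (X s \<omega>)) = expectation (\<lambda>\<omega>. integral {s..t} (\<lambda>r. g (X r \<omega>)))" .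
qed

lemma expectation_abs_bound:
  fixes f :: "'a \<Rightarrow> real"
  assumes "integrable M f" "\<And>\<omega>. \<omega> \<in> space M \<Longrightarrow> \<bar>f \<omega>\<bar> \<le> B"
  shows "\<bar>expectation f\<bar> \<le> B"
proof -
  have "\<bar>expectation f\<bar> \<le> expectation (\<lambda>\<omega>. \<bar>f \<omega>\<bar>)"
    using integral_norm_bound[of M f] by simp
  also have "\<dots> \<le> expectation (\<lambda>\<omega>. B)" by (intro integral_mono) (use assms in auto)
  finally show ?thesis by (simp add: prob_space)
qed

text \<open>The drift is bounded, so expectations move continuously in time even though the paths
  jump. The maximum principle relies on this continuity.\<close>

lemma dyn_lipschitz:
  assumes d: "dyn f l" and B: "\<And>x. \<bar>1/2 * l x + jump N f x\<bar> \<le> B" and "0 \<le> s" "0 \<le> t"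
  shows "\<bar>expectation (\<lambda>\<omega>. f (X t \<omega>)) - expectation (\<lambda>\<omega>. f (X s \<omega>))\<bar> \<le> B * \<bar>t - s\<bar>"
proof -
  have *: "\<bar>expectation (\<lambda>\<omega>. f (X t \<omega>)) - expectation (\<lambda>\<omega>. f (X s \<omega>))\<bar> \<le> B * (t - s)" if "0 \<le> s" "s \<le> t" for s t
    unfolding dyn_increment(2)[OF d that]
    by (intro expectation_abs_bound dyn_increment(1)[OF d that]
      path_integral_bound[OF dyn_bdd_cyl(2)[OF d]] B that)
  show ?thesis
    using *[OF assms(3), of t] *[OF assms(4), of s] by (cases "s \<le> t") (auto simp: abs_minus_commute)
qed

lemma bdd_cyl_left_limit:
  assumes f: "bdd_cyl N f" and t: "0 < t" and Z: "filterlim Z (at_left t) sequentially" "\<And>n. 0 \<le> Z n"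
  shows "(\<lambda>n. expectation (\<lambda>\<omega>. f (X (Z n) \<omega>))) \<longlonglongrightarrow> expectation (\<lambda>\<omega>. f (Y t \<omega>))"
proof -
  obtain B where B: "\<And>x. \<bar>f x\<bar> \<le> B" using bdd_cyl_bounded[OF f] by blast
  show ?thesis
  proof (rule integral_dominated_convergence[where w = "\<lambda>_. B"])
    show "AE \<omega> in M. (\<lambda>n. f (X (Z n) \<omega>)) \<longlonglongrightarrow> f (Y t \<omega>)"
      by (intro AE_I2 bdd_cyl_tendsto[OF f] filterlim_compose[OF X_left Z(1)] t)
  qed (use B in \<open>auto intro!: bdd_cyl_X_measurable bdd_cyl_Y_measurable f t Z\<close>)
qed

text \<open>The difference quotient is the expected average of the drift over a short interval
  ending at \<open>t\<close>; along each path this average tends to the drift at the left limit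
  \<open>Y t\<close>. The left derivative is the one that a first-touching argument can use.\<close>

lemma dyn_left_derivative:
  assumes d: "dyn f l" and t: "0 < t"
  shows "((\<lambda>r. expectation (\<lambda>\<omega>. f (X r \<omega>))) has_real_derivative
     expectation (\<lambda>\<omega>. 1/2 * l (Y t \<omega>) + jump N f (Y t \<omega>))) (at_left t)"
  unfolding DERIV_left_iff
proof (rule tendsto_at_leftI_seq[OF t])
  fix Z assume Z: "Z \<longlonglongrightarrow> t" "\<And>n. 0 \<le> Z n" "\<And>n. Z n < t" "filterlim Z (at_left t) sequentially"
  define g where "g x = 1/2 * l x + jump N f x" for x
  have cg: "bdd_cyl N g" unfolding g_def by (rule dyn_bdd_cyl(2)[OF d])
  obtain B where B: "\<And>x. \<bar>g x\<bar> \<le> B" using bdd_cyl_bounded[OF cg] by blast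
  let ?I = "\<lambda>n \<omega>. integral {Z n..t} (\<lambda>r. g (X r \<omega>)) / (t - Z n)"
  have le: "Z n \<le> t" for n using Z(3)[of n] by simp
  have I: "integrable M (?I n)" for n
    using dyn_increment(1)[OF d Z(2) le] unfolding g_def by simp
  have "(\<lambda>n. expectation (?I n)) \<longlonglongrightarrow> expectation (\<lambda>\<omega>. g (Y t \<omega>))"
  proof (rule integral_dominated_convergence[where w = "\<lambda>_. B"])
    show "(\<lambda>\<omega>. g (Y t \<omega>)) \<in> borel_measurable M" by (rule bdd_cyl_Y_measurable[OF cg t])
    show "?I n \<in> borel_measurable M" for n using I by (rule borel_measurable_integrable)
    show "AE \<omega> in M. (\<lambda>n. ?I n \<omega>) \<longlonglongrightarrow> g (Y t \<omega>)"
      by (intro AE_I2 left_average_tendsto[OF _ path_integrable[OF cg] t] Z bdd_cyl_tendsto[OF cg] X_left t) auto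
    show "AE \<omega> in M. norm (?I n \<omega>) \<le> B" for n
    proof (rule AE_I2)
      fix \<omega> assume "\<omega> \<in> space M"
      from path_integral_bound[OF cg this Z(2) le B, of n]
      show "norm (?I n \<omega>) \<le> B" using Z(3)[of n] by (simp add: divide_le_eq mult.commute)
    qed
  qed auto
  moreover have "(\<lambda>n. expectation (?I n)) = (\<lambda>n. (expectation (\<lambda>\<omega>. f (X t \<omega>)) - expectation (\<lambda>\<omega>. f (X (Z n) \<omega>))) / (t - Z n))"
    unfolding dyn_increment(2)[OF d Z(2) le] g_def by simp
  ultimately show "(\<lambda>n. (expectation (\<lambda>\<omega>. f (X t \<omega>)) - expectation (\<lambda>\<omega>. f (X (Z n) \<omega>))) / (t - Z n))
     \<longlonglongrightarrow> expectation (\<lambda>\<omega>. 1/2 * l (Y t \<omega>) + jump N f (Y t \<omega>))"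
    by (simp only: g_def)
qed

text \<open>A left derivative forces left continuity of the expectation, so \<open>X t\<close> and
  \<open>Y t\<close> give the same value on functionals with a dynamics. This compensates for
  possible jumps at the fixed time \<open>t\<close>.\<close>

lemma dyn_left_eq:
  assumes d: "dyn f l" and t: "0 < t"
  shows "expectation (\<lambda>\<omega>. f (Y t \<omega>)) = expectation (\<lambda>\<omega>. f (X t \<omega>))"
proof -
  obtain Z where Z: "Z \<longlonglongrightarrow> t" "\<And>n. Z n < t" "\<And>n. 0 \<le> Z n" "filterlim Z (at_left t) sequentially"
    using left_sequence[OF t] by blast
  let ?m = "\<lambda>r. expectation (\<lambda>\<omega>. f (X r \<omega>))"
  have "(?m \<longlongrightarrow> ?m t) (at_left t)"
    using DERIV_continuous[OF dyn_left_derivative[OF assms]] by (simp add: continuous_within)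
  then have "(\<lambda>n. ?m (Z n)) \<longlonglongrightarrow> ?m t" using Z(4) by (rule filterlim_compose)
  then show ?thesis
    using bdd_cyl_left_limit[OF dyn_bdd_cyl(1)[OF d] t Z(4,3)] by (rule LIMSEQ_unique[symmetric])
qed

end

section \<open>Empirical means and their squares\<close>

definition emp_mean :: "nat \<Rightarrow> (real \<Rightarrow> real) \<Rightarrow> (nat \<Rightarrow> real) \<Rightarrow> real" where
  "emp_mean N f x = (\<Sum>i<N. f (x i)) / real N"

context particle_system
begin

lemma dyn_coord:
  assumes "C2b f f1 f2" "i < N"
  shows "dyn (\<lambda>x. f (x i)) (\<lambda>x. f2 (x i))"
proof -
  let ?h = "(\<lambda>k. if k = i then f else (\<lambda>_. 1))"
  let ?h2 = "(\<lambda>k. if k = i then f2 else (\<lambda>_. 0))"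
  have "dyn (tensor N ?h) (\<lambda>x. \<Sum>k<N. tensor N (?h(k := ?h2 k)) x)"
    by (rule dyn_tensor[where ?h1.0 = "\<lambda>k. if k = i then f1 else (\<lambda>_. 0)"]) (auto intro: assms C2b_const)
  moreover have "tensor N ?h = (\<lambda>x. f (x i))"
  proof
    fix x
    have "tensor N ?h x = (\<Prod>k<N. if k = i then f (x i) else 1)"
      unfolding tensor_def by (intro prod.cong) auto
    then show "tensor N ?h x = f (x i)" using assms(2) by simp
  qed
  moreover have "(\<lambda>x. \<Sum>k<N. tensor N (?h(k := ?h2 k)) x) = (\<lambda>x. f2 (x i))"
  proof
    fix x
    have "tensor N (?h(k := ?h2 k)) x = (if k = i then f2 (x i) else 0)" if "k < N" for k
      using that by (auto simp: tensor_upd intro!: prod.neutral)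
    then have "(\<Sum>k<N. tensor N (?h(k := ?h2 k)) x) = (\<Sum>k<N. if k = i then f2 (x i) else 0)"
      by (intro sum.cong) auto
    then show "(\<Sum>k<N. tensor N (?h(k := ?h2 k)) x) = f2 (x i)" using assms(2) by simp
  qed
  ultimately show ?thesis by simp
qed

lemma dyn_coord2:
  assumes "C2b f f1 f2" "i < N" "j < N" "i \<noteq> j"
  shows "dyn (\<lambda>x. f (x i) * f (x j)) (\<lambda>x. f2 (x i) * f (x j) + f (x i) * f2 (x j))"
proof -
  let ?h = "(\<lambda>k. if k = i \<or> k = j then f else (\<lambda>_. 1))"
  let ?h2 = "(\<lambda>k. if k = i \<or> k = j then f2 else (\<lambda>_. 0))"
  have prod1: "(\<Prod>k\<in>{..<N} - {i}. (if k = i \<or> k = j then f else (\<lambda>_. 1)) (x k)) = f (x j)" if "i < N" "j < N" "i \<noteq> j" for i j and x :: "nat \<Rightarrow> real"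
  proof -
    have "(\<Prod>k\<in>{..<N} - {i}. (if k = i \<or> k = j then f else (\<lambda>_. 1)) (x k)) = (\<Prod>k\<in>{..<N} - {i}. if k = j then f (x j) else 1)"
      by (intro prod.cong) auto
    also have "\<dots> = f (x j)" using that by (subst prod.delta) auto
    finally show ?thesis .
  qed
  have "dyn (tensor N ?h) (\<lambda>x. \<Sum>k<N. tensor N (?h(k := ?h2 k)) x)"
    by (rule dyn_tensor[where ?h1.0 = "\<lambda>k. if k = i \<or> k = j then f1 else (\<lambda>_. 0)"]) (auto intro: assms C2b_const)
  moreover have "tensor N ?h = (\<lambda>x. f (x i) * f (x j))"
  proof
    fix x
    have "tensor N ?h x = tensor N (?h(i := f)) x" by (rule arg_cong[where f = "\<lambda>h. tensor N h x"]) auto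
    then show "tensor N ?h x = f (x i) * f (x j)"
      unfolding tensor_upd[OF assms(2)] prod1[OF assms(2-4)] .
  qed
  moreover have "(\<lambda>x. \<Sum>k<N. tensor N (?h(k := ?h2 k)) x) = (\<lambda>x. f2 (x i) * f (x j) + f (x i) * f2 (x j))"
  proof
    fix x
    have ji: "(\<Prod>k\<in>{..<N} - {j}. ?h k (x k)) = f (x i)"
    proof -
      have "(\<Prod>k\<in>{..<N} - {j}. ?h k (x k)) = (\<Prod>k\<in>{..<N} - {j}. (if k = j \<or> k = i then f else (\<lambda>_. 1)) (x k))"
        by (intro prod.cong) auto
      also have "\<dots> = f (x i)" by (rule prod1) (use assms in auto)
      finally show ?thesis .
    qed
    have "tensor N (?h(k := ?h2 k)) x = (if k = i then f2 (x i) * f (x j) else 0) + (if k = j then f (x i) * f2 (x j) else 0)" if "k < N" for k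
    proof -
      consider "k = i" | "k = j" "k \<noteq> i" | "k \<noteq> i" "k \<noteq> j" by blast
      then show ?thesis
      proof cases
        case 1
        then show ?thesis using assms prod1[of i j x] by (simp add: tensor_upd)
      next
        case 2
        then show ?thesis using assms ji by (simp add: tensor_upd)
      next
        case 3
        then show ?thesis using that by (simp add: tensor_upd)
      qed
    qed
    then have "(\<Sum>k<N. tensor N (?h(k := ?h2 k)) x) = (\<Sum>k<N. (if k = i then f2 (x i) * f (x j) else 0) + (if k = j then f (x i) * f2 (x j) else 0))"
      by (intro sum.cong) auto
    then show "(\<Sum>k<N. tensor N (?h(k := ?h2 k)) x) = f2 (x i) * f (x j) + f (x i) * f2 (x j)"
      using assms by (simp add: sum.distrib)
  qed
  ultimately show ?thesis by simp
qed

lemma dyn_emp_mean: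
  assumes "C2b f f1 f2"
  shows "dyn (emp_mean N f) (emp_mean N f2)"
proof -
  have "dyn (\<lambda>x. 1 / real N * (\<Sum>i<N. f (x i))) (\<lambda>x. 1 / real N * (\<Sum>i<N. f2 (x i)))"
    by (intro dyn_cmult dyn_sum dyn_coord[OF assms]) auto
  then show ?thesis by (simp add: emp_mean_def[abs_def])
qed

text \<open>In the double sum the Laplacian acts on the two factors separately, except on the
  diagonal, where the product rule leaves an extra \<open>2 * f1 ^ 2\<close>. There are only
  \<open>N\<close> diagonal terms among \<open>N ^ 2\<close>, so the Brownian noise is of order
  \<open>1 / N\<close>.\<close>

lemma dyn_emp_mean_square:
  assumes f: "C2b f f1 f2"
  shows "dyn (\<lambda>x. emp_mean N f x ^ 2) (\<lambda>x. 2 * emp_mean N f x * emp_mean N f2 x + 2 / real N * emp_mean N (\<lambda>y. f1 y ^ 2) x)"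
proof -
  let ?F = "\<lambda>i j x. f (x i) * f (x j)"
  let ?L = "\<lambda>i j x. f2 (x i) * f (x j) + f (x i) * f2 (x j) + (if i = j then 2 * f1 (x i) ^ 2 else 0)"
  have d: "dyn (?F i j) (?L i j)" if "i < N" "j < N" for i j
  proof (cases "i = j")
    case True
    have "dyn (?F i i) (\<lambda>x. f2 (x i) * f (x i) + 2 * f1 (x i) * f1 (x i) + f (x i) * f2 (x i))"
      using dyn_coord[OF C2b_mult[OF f f] that(1)] .
    also have "(\<lambda>x. f2 (x i) * f (x i) + 2 * f1 (x i) * f1 (x i) + f (x i) * f2 (x i)) = ?L i i"
      by (auto simp: power2_eq_square)
    finally show ?thesis using True by simp
  next
    case False
    then show ?thesis using dyn_coord2[OF f that False] by simp
  qed
  have "dyn (\<lambda>x. 1 / real N ^ 2 * (\<Sum>i<N. \<Sum>j<N. ?F i j x)) (\<lambda>x. 1 / real N ^ 2 * (\<Sum>i<N. \<Sum>j<N. ?L i j x))"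
    by (intro dyn_cmult dyn_sum d) auto
  moreover have "1 / real N ^ 2 * (\<Sum>i<N. \<Sum>j<N. ?F i j x) = emp_mean N f x ^ 2" for x
    by (simp add: emp_mean_def power2_eq_square sum_product)
  moreover have "1 / real N ^ 2 * (\<Sum>i<N. \<Sum>j<N. ?L i j x) = 2 * emp_mean N f x * emp_mean N f2 x + 2 / real N * emp_mean N (\<lambda>y. f1 y ^ 2) x" for x
  proof -
    have e: "(\<Sum>i<N. \<Sum>j<N. ?L i j x) = (\<Sum>i<N. f2 (x i)) * (\<Sum>i<N. f (x i)) + (\<Sum>i<N. f (x i)) * (\<Sum>i<N. f2 (x i))
       + 2 * (\<Sum>i<N. f1 (x i) ^ 2)"
      unfolding sum_distrib_left[of 2] sum_product by (simp add: sum.distrib)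
    show ?thesis
      unfolding e emp_mean_def by (simp add: power2_eq_square add_divide_distrib distrib_left)
  qed
  ultimately show ?thesis by simp
qed

end

section \<open>A comparison principle for the heat equation\<close>

lemma second_derivative_at_max:
  fixes f :: "real \<Rightarrow> real"
  assumes f: "\<And>x. (f has_real_derivative f1 x) (at x)" and f1: "(f1 has_real_derivative d) (at x0)"
    and max: "\<And>x. f x \<le> f x0"
  shows "d \<le> 0"
proof (rule ccontr)
  assume "\<not> d \<le> 0"
  have f10: "f1 x0 = 0"
    by (rule DERIV_local_max[OF f, where d = 1]) (use max in auto)
  obtain e where e: "e > 0" "\<And>h. h > 0 \<Longrightarrow> h < e \<Longrightarrow> f1 x0 < f1 (x0 + h)"
    using DERIV_pos_inc_right[OF f1] \<open>\<not> d \<le> 0\<close> by force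
  have "f x0 < f (x0 + e / 2)"
  proof (rule DERIV_pos_imp_increasing_open[where f = f])
    show "\<exists>y. (f has_real_derivative y) (at x) \<and> y > 0" if "x0 < x" "x < x0 + e / 2" for x
      using f[of x] e(2)[of "x - x0"] that f10 by auto
    show "continuous_on {x0..x0 + e / 2} f"
      by (rule DERIV_continuous_on) (rule has_field_derivative_at_within[OF f])
  qed (use e in auto)
  then show False using max[of "x0 + e / 2"] by simp
qed

lemma left_derivative_at_first_zero:
  fixes g :: "real \<Rightarrow> real"
  assumes "(g has_real_derivative d) (at_left t)" "a < t" "\<And>s. a \<le> s \<Longrightarrow> s < t \<Longrightarrow> g s \<le> g t"
  shows "0 \<le> d"
proof (rule tendsto_lowerbound)
  show "((\<lambda>r. (g t - g r) / (t - r)) \<longlongrightarrow> d) (at_left t)"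
    using assms(1) by (simp add: DERIV_left_iff)
  show "\<forall>\<^sub>F r in at_left t. 0 \<le> (g t - g r) / (t - r)"
    unfolding eventually_at_left[OF \<open>a < t\<close>]
    by (rule exI[of _ a]) (use assms(2,3) in \<open>simp add: less_imp_le\<close>)
qed auto

text \<open>The points with \<open>z \<ge> 0\<close> lie in a box by \<open>far\<close> and form a
  compact set; take one with the least time. There \<open>z\<close> vanishes and has a spatial
  maximum, and it was negative before, so its second derivative is at most 0 and its left time
  derivative at least 0, against the strict inequality. Accordingly the inequality is asked only at
  zeros of \<open>z\<close>, and time differentiability only from the left.\<close>

lemma parabolic_maximum_principle:
  fixes z zt zx zxx :: "real \<Rightarrow> real \<Rightarrow> real"
  assumes cont: "continuous_on ({0..T} \<times> UNIV) (\<lambda>(t, x). z t x)"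
    and far: "\<And>t x. 0 \<le> t \<Longrightarrow> t \<le> T \<Longrightarrow> R < \<bar>x\<bar> \<Longrightarrow> z t x < 0"
    and init: "\<And>x. z 0 x < 0"
    and zx: "\<And>t x. 0 < t \<Longrightarrow> t \<le> T \<Longrightarrow> (z t has_real_derivative zx t x) (at x)"
    and zxx: "\<And>t x. 0 < t \<Longrightarrow> t \<le> T \<Longrightarrow> (zx t has_real_derivative zxx t x) (at x)"
    and zt: "\<And>t x. 0 < t \<Longrightarrow> t \<le> T \<Longrightarrow> ((\<lambda>s. z s x) has_real_derivative zt t x) (at_left t)"
    and ineq: "\<And>t x. 0 < t \<Longrightarrow> t \<le> T \<Longrightarrow> z t x = 0 \<Longrightarrow> zt t x < 1/2 * zxx t x"
    and "0 \<le> t1" "t1 \<le> T"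
  shows "z t1 x1 < 0"
proof (rule ccontr)
  assume neg: "\<not> z t1 x1 < 0"
  define K where "K = {p \<in> {0..T} \<times> {-R..R}. 0 \<le> (\<lambda>(t, x). z t x) p}"
  have "continuous_on ({0..T} \<times> {-R..R}) (\<lambda>(t, x). z t x)"
    by (rule continuous_on_subset[OF cont]) auto
  then have "closed K"
    unfolding K_def by (intro continuous_on_closed_Collect_le closed_Times continuous_on_const) auto
  moreover have "bounded K"
    by (rule bounded_subset[of "{0..T} \<times> {-R..R}"]) (auto simp: K_def intro!: bounded_Times)
  ultimately have "compact K" by (simp add: compact_eq_bounded_closed)
  moreover have "\<bar>x1\<bar> \<le> R" using far[of t1 x1] neg assms by force
  then have "(t1, x1) \<in> K" using neg assms by (auto simp: K_def)
  ultimately obtain p0 where "p0 \<in> K" "\<forall>p\<in>K. fst p0 \<le> fst p"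
    using continuous_attains_inf[of K fst] continuous_on_fst[OF continuous_on_id] by blast
  moreover obtain t0 x0 where "p0 = (t0, x0)" by (cases p0)
  ultimately have p: "(t0, x0) \<in> K" "\<And>t x. (t, x) \<in> K \<Longrightarrow> t0 \<le> t" by auto
  have t0: "0 \<le> t0" "t0 \<le> T" and z0: "0 \<le> z t0 x0" using p(1) by (auto simp: K_def)
  have pos: "0 < t0" using init[of x0] z0 t0 by (cases "t0 = 0") auto
  have before: "z t x < 0" if "0 \<le> t" "t < t0" for t x
  proof (rule ccontr)
    assume c: "\<not> z t x < 0"
    then have "\<bar>x\<bar> \<le> R" using far[of t x] that t0 by force
    then have "(t, x) \<in> K" using c that t0 by (auto simp: K_def)
    then show False using p(2) that by force
  qed
  \<comment> \<open>Negativity before \<open>t0\<close> passes to time \<open>t0\<close> by left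
    continuity, which the left derivative provides; this makes the touching point a spatial
    maximum.\<close>
  have le0: "z t0 x \<le> 0" for x
  proof (rule tendsto_upperbound)
    show "((\<lambda>s. z s x) \<longlongrightarrow> z t0 x) (at_left t0)"
      using DERIV_continuous[OF zt[OF pos t0(2), of x]] by (simp add: continuous_within)
    show "\<forall>\<^sub>F s in at_left t0. z s x \<le> 0"
      unfolding eventually_at_left[OF pos]
      by (rule exI[of _ 0]) (use before pos in \<open>auto intro: less_imp_le\<close>)
  qed auto
  then have zz: "z t0 x0 = 0" using z0 by (simp add: order_antisym)
  have "zxx t0 x0 \<le> 0"
    by (rule second_derivative_at_max[OF zx[OF pos t0(2)] zxx[OF pos t0(2)]]) (use le0 zz in auto)
  moreover have "0 \<le> zt t0 x0"
    by (rule left_derivative_at_first_zero[OF zt[OF pos t0(2)] pos])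
      (use before zz in \<open>auto intro: less_imp_le\<close>)
  ultimately show False using ineq[OF pos t0(2) zz] by simp
qed

text \<open>The Gaussian is left unnormalised: it only serves as an upper barrier, and without the factor
  \<open>1 / sqrt (2 pi)\<close> its mass on \<open>[- sqrt s, sqrt s]\<close> is at least \<open>1\<close>.\<close>

definition heat_kernel :: "real \<Rightarrow> real \<Rightarrow> real" where
  "heat_kernel s y = exp (- (y ^ 2) / (2 * s)) / sqrt s"

lemma heat_kernel_dx:
  assumes "s > 0"
  shows "(heat_kernel s has_real_derivative (- y / s) * heat_kernel s y) (at y)"
    "((\<lambda>y. (- y / s) * heat_kernel s y) has_real_derivative (y ^ 2 / s ^ 2 - 1 / s) * heat_kernel s y) (at y)"
proof -
  have e: "((\<lambda>y. - (y ^ 2) / (2 * s)) has_real_derivative - y / s) (at y)" for y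
  proof -
    have "((\<lambda>y. - (y ^ 2) / (2 * s)) has_real_derivative - (2 * y) / (2 * s)) (at y)"
      by (intro DERIV_cdivide DERIV_minus) (use DERIV_pow[of 2 y] in simp)
    then show ?thesis by simp
  qed
  show 1: "(heat_kernel s has_real_derivative (- y / s) * heat_kernel s y) (at y)" for y
  proof -
    have "((\<lambda>y. exp (- (y ^ 2) / (2 * s)) / sqrt s) has_real_derivative exp (- (y ^ 2) / (2 * s)) * (- y / s) / sqrt s) (at y)"
      by (intro DERIV_cdivide DERIV_chain2[OF DERIV_exp e])
    then show ?thesis by (simp add: heat_kernel_def[abs_def] mult.commute)
  qed
  have "((\<lambda>y. - y / s) has_real_derivative - 1 / s) (at y)"
    by (intro DERIV_cdivide DERIV_minus DERIV_ident)
  from DERIV_mult[OF this 1[of y]]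
  show "((\<lambda>y. (- y / s) * heat_kernel s y) has_real_derivative (y ^ 2 / s ^ 2 - 1 / s) * heat_kernel s y) (at y)"
    by (simp add: algebra_simps power2_eq_square)
qed

lemma heat_kernel_ds:
  assumes "s > 0"
  shows "((\<lambda>s. heat_kernel s y) has_real_derivative 1/2 * ((y ^ 2 / s ^ 2 - 1 / s) * heat_kernel s y)) (at s)"
proof -
  have "((\<lambda>s. (- (y ^ 2) / 2) * inverse s) has_real_derivative (- (y ^ 2) / 2) * (- (inverse s * inverse s))) (at s)"
    using assms DERIV_inverse[of s] by (intro DERIV_cmult) (simp add: power2_eq_square)
  moreover have "(- (y ^ 2) / 2) * (- (inverse s * inverse s)) = y ^ 2 / (2 * s ^ 2)"
    using assms by (simp add: field_simps power2_eq_square)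
  moreover have "(\<lambda>s. (- (y ^ 2) / 2) * inverse s) = (\<lambda>s. - (y ^ 2) / (2 * s))"
    by (simp add: inverse_eq_divide)
  ultimately have "((\<lambda>s. - (y ^ 2) / (2 * s)) has_real_derivative y ^ 2 / (2 * s ^ 2)) (at s)"
    by (simp only:)
  then have e: "((\<lambda>s. exp (- (y ^ 2) / (2 * s))) has_real_derivative exp (- (y ^ 2) / (2 * s)) * (y ^ 2 / (2 * s ^ 2))) (at s)"
    by (rule DERIV_chain2[OF DERIV_exp])
  have II: "inverse (sqrt s) * inverse (sqrt s) = 1 / s"
    using assms by (simp flip: inverse_mult_distrib add: inverse_eq_divide)
  have "((\<lambda>s. inverse (sqrt s)) has_real_derivative - (inverse (sqrt s) * (inverse (sqrt s) / 2) * inverse (sqrt s))) (at s)"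
    by (rule DERIV_inverse'[OF DERIV_real_sqrt]) (use assms in auto)
  moreover have "a * (a / 2) * a = (a * a) * (a / 2)" for a :: real by simp
  ultimately have r: "((\<lambda>s. inverse (sqrt s)) has_real_derivative - (1 / s * (inverse (sqrt s) / 2))) (at s)"
    by (simp only: II)
  have alg: "E * (y ^ 2 / (2 * s ^ 2)) * I + - (1 / s * (I / 2)) * E = 1/2 * ((y ^ 2 / s ^ 2 - 1 / s) * (E * I))" for E I
    using assms by (simp add: field_simps power2_eq_square)
  show ?thesis
    using DERIV_mult[OF e r] unfolding alg heat_kernel_def divide_inverse[of _ "sqrt _"] .
qed

lemma heat_kernel_nonneg: "s > 0 \<Longrightarrow> 0 \<le> heat_kernel s y"
  by (simp add: heat_kernel_def)

lemma continuous_on_heat_kernel [continuous_intros]: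
  assumes "continuous_on A f" "continuous_on A g" "\<And>a. a \<in> A \<Longrightarrow> f a > 0"
  shows "continuous_on A (\<lambda>a. heat_kernel (f a) (g a))"
  unfolding heat_kernel_def using assms
  by (intro continuous_intros) (auto dest: assms(3))

lemma heat_kernel_ge: 
  assumes "s > 0" "\<bar>y\<bar> \<le> sqrt s"
  shows "1 / (2 * sqrt s) \<le> heat_kernel s y"
proof -
  have "y ^ 2 \<le> s" using power_mono[OF assms(2) abs_ge_zero, of 2] assms(1) by simp
  then have "- (1/2) \<le> - (y ^ 2) / (2 * s)" using assms by (simp add: field_simps)
  then have "1 + - (1/2) \<le> exp (- (y ^ 2) / (2 * s))"
    using exp_ge_add_one_self[of "- (y ^ 2) / (2 * s)"] by linarith
  then have "(1/2) / sqrt s \<le> exp (- (y ^ 2) / (2 * s)) / sqrt s"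
    using assms by (intro divide_right_mono) auto
  then show ?thesis by (simp add: heat_kernel_def)
qed

text \<open>An envelope of all kernels with time between \<open>T\<close> and \<open>T + 1\<close>:
  the largest time in the exponent, the smallest in the prefactor. It frees the final bound from the
  regularising time shift \<open>e\<close>.\<close>

definition heat_majorant :: "real \<Rightarrow> real \<Rightarrow> real" where
  "heat_majorant T y = exp (- (y ^ 2) / (2 * (T + 1))) / sqrt T"

lemma heat_kernel_le_heat_majorant:
  assumes "0 < T" "0 \<le> e" "e \<le> 1" shows "heat_kernel (T + e) y \<le> heat_majorant T y"
proof -
  have "y ^ 2 / (2 * (T + 1)) \<le> y ^ 2 / (2 * (T + e))"
    using assms by (intro divide_left_mono) auto
  then show ?thesis
    unfolding heat_kernel_def heat_majorant_def using assms by (intro frac_le) auto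
qed

lemma heat_majorant_integrable:
  assumes "0 < T" shows "integrable lborel (\<lambda>y. heat_majorant T (x - y))"
proof -
  have "heat_majorant T (x - y) = (sqrt (2 * pi * (T + 1)) / sqrt T) * normal_density x (sqrt (T + 1)) y" for y
    using assms by (simp add: heat_majorant_def normal_density_def power2_commute)
  then show ?thesis by (simp only:) (intro integrable_mult_right integrable_normal_density, use assms in auto)
qed

text \<open>Shifting time by \<open>e > 0\<close> keeps the kernel smooth down to
  \<open>t = 0\<close>, and truncating to \<open>[-r, r]\<close> allows differentiation under an
  integral over a compact interval. Both regularisations are admissible because the potential is
  used only as a barrier.\<close>

lemma heat_potential:
  fixes g :: "real \<Rightarrow> real" and r e :: real
  assumes g: "continuous_on UNIV g" and e: "0 < e"
  defines "w \<equiv> \<lambda>t x. integral {-r..r} (\<lambda>y. heat_kernel (t + e) (x - y) * g y)"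
  shows "continuous_on ({0..T} \<times> UNIV) (\<lambda>(t, x). w t x)"
    and "0 \<le> t \<Longrightarrow> (w t has_real_derivative integral {-r..r} (\<lambda>y. (- (x - y) / (t + e)) * heat_kernel (t + e) (x - y) * g y)) (at x)"
    and "0 \<le> t \<Longrightarrow> ((\<lambda>x. integral {-r..r} (\<lambda>y. (- (x - y) / (t + e)) * heat_kernel (t + e) (x - y) * g y)) has_real_derivative
       integral {-r..r} (\<lambda>y. (((x - y) ^ 2 / (t + e) ^ 2 - 1 / (t + e)) * heat_kernel (t + e) (x - y)) * g y)) (at x)"
    and "0 < t \<Longrightarrow> ((\<lambda>t. w t x) has_real_derivative
       1/2 * integral {-r..r} (\<lambda>y. (((x - y) ^ 2 / (t + e) ^ 2 - 1 / (t + e)) * heat_kernel (t + e) (x - y)) * g y)) (at t)"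
proof -
  have gc [continuous_intros]: "continuous_on A (\<lambda>p. g (f p))" if "continuous_on A f" for A :: "'z::topological_space set" and f
    by (rule continuous_on_compose2[OF g that]) auto
  show "continuous_on ({0..T} \<times> UNIV) (\<lambda>(t, x). w t x)"
  proof -
    have "continuous_on (({0..T} \<times> UNIV) \<times> cbox (-r) r) (\<lambda>(p, y). heat_kernel (fst p + e) (snd p - y) * g y)"
      unfolding split_beta by (intro continuous_intros) (use e in auto)
    from integral_continuous_on_param[OF this] show ?thesis
      by (simp add: w_def split_beta)
  qed
  assume t: "0 \<le> t"
  have te: "t + e > 0" using t e by simp
  have dxy: "((\<lambda>x. x - y) has_real_derivative 1) (at x within A)" for x y :: real and A
    by (auto intro!: derivative_eq_intros)
  show "(w t has_real_derivative integral {-r..r} (\<lambda>y. (- (x - y) / (t + e)) * heat_kernel (t + e) (x - y) * g y)) (at x)"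
    unfolding w_def box_real(2)[symmetric]
  proof (rule leibniz_rule_field_derivative[where U = UNIV])
    show "((\<lambda>x. heat_kernel (t + e) (x - y) * g y) has_real_derivative (- (x - y) / (t + e)) * heat_kernel (t + e) (x - y) * g y) (at x)" for x y
      using DERIV_cmult_right[OF DERIV_chain2[OF heat_kernel_dx(1)[OF te] dxy[of y x UNIV]], of "g y"] by (simp only: mult_1_right)
    show "(\<lambda>y. heat_kernel (t + e) (x - y) * g y) integrable_on cbox (-r) r" for x
      by (intro integrable_continuous continuous_intros) (use te in auto)
    show "continuous_on (UNIV \<times> cbox (-r) r) (\<lambda>(x, y). (- (x - y) / (t + e)) * heat_kernel (t + e) (x - y) * g y)"
      unfolding split_beta by (intro continuous_intros) (use te in auto)
  qed auto
  show "((\<lambda>x. integral {-r..r} (\<lambda>y. (- (x - y) / (t + e)) * heat_kernel (t + e) (x - y) * g y)) has_real_derivative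
       integral {-r..r} (\<lambda>y. (((x - y) ^ 2 / (t + e) ^ 2 - 1 / (t + e)) * heat_kernel (t + e) (x - y)) * g y)) (at x)"
    unfolding box_real(2)[symmetric]
  proof (rule leibniz_rule_field_derivative[where U = UNIV])
    show "((\<lambda>x. (- (x - y) / (t + e)) * heat_kernel (t + e) (x - y) * g y) has_real_derivative
      (((x - y) ^ 2 / (t + e) ^ 2 - 1 / (t + e)) * heat_kernel (t + e) (x - y)) * g y) (at x)" for x y
      using DERIV_cmult_right[OF DERIV_chain2[OF heat_kernel_dx(2)[OF te] dxy[of y x UNIV]], of "g y"] by (simp only: mult_1_right)
    show "(\<lambda>y. (- (x - y) / (t + e)) * heat_kernel (t + e) (x - y) * g y) integrable_on cbox (-r) r" for x
      by (intro integrable_continuous continuous_intros) (use te in auto)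
    show "continuous_on (UNIV \<times> cbox (-r) r) (\<lambda>(x, y). (((x - y) ^ 2 / (t + e) ^ 2 - 1 / (t + e)) * heat_kernel (t + e) (x - y)) * g y)"
      unfolding split_beta by (intro continuous_intros) (use te in auto)
  qed auto
next
  assume t: "0 < t"
  have gc [continuous_intros]: "continuous_on A (\<lambda>p. g (f p))" if "continuous_on A f" for A :: "'z::topological_space set" and f
    by (rule continuous_on_compose2[OF g that]) auto
  have "((\<lambda>t. w t x) has_real_derivative
       integral {-r..r} (\<lambda>y. 1/2 * (((x - y) ^ 2 / (t + e) ^ 2 - 1 / (t + e)) * heat_kernel (t + e) (x - y)) * g y)) (at t within {0<..})"
    unfolding w_def box_real(2)[symmetric]
  proof (rule leibniz_rule_field_derivative[where U = "{0<..}"])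
    show "((\<lambda>t. heat_kernel (t + e) (x - y) * g y) has_real_derivative
      1/2 * (((x - y) ^ 2 / (t + e) ^ 2 - 1 / (t + e)) * heat_kernel (t + e) (x - y)) * g y) (at t within {0<..})" if "t \<in> {0<..}" for t y
    proof -
      have s: "t + e > 0" using that e by simp
      have "((\<lambda>t. t + e) has_real_derivative 1) (at t)" by (auto intro!: derivative_eq_intros)
      from DERIV_cmult_right[OF DERIV_chain2[OF heat_kernel_ds[OF s, of "x - y"] this], where c = "g y"]
      have "((\<lambda>t. heat_kernel (t + e) (x - y) * g y) has_real_derivative
        1/2 * (((x - y) ^ 2 / (t + e) ^ 2 - 1 / (t + e)) * heat_kernel (t + e) (x - y)) * g y) (at t)"
        by (simp only: mult_1_right)
      then show ?thesis by (rule has_field_derivative_at_within)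
    qed
    show "(\<lambda>y. heat_kernel (t + e) (x - y) * g y) integrable_on cbox (-r) r" if "t \<in> {0<..}" for t
      by (intro integrable_continuous continuous_intros) (use that e in auto)
    show "continuous_on ({0<..} \<times> cbox (-r) r) (\<lambda>(t, y). 1/2 * (((x - y) ^ 2 / (t + e) ^ 2 - 1 / (t + e)) * heat_kernel (t + e) (x - y)) * g y)"
      unfolding split_beta by (intro continuous_intros) (use e in auto)
  qed (use t in auto)
  moreover have "at t within {0<..} = at t" using t by (intro at_within_open) auto
  ultimately show "((\<lambda>t. w t x) has_real_derivative
       1/2 * integral {-r..r} (\<lambda>y. (((x - y) ^ 2 / (t + e) ^ 2 - 1 / (t + e)) * heat_kernel (t + e) (x - y)) * g y)) (at t)"
    by (simp only: mult.assoc[of "1/2"] Henstock_Kurzweil_Integration.integral_mult_right)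
qed

text \<open>With \<open>e = h ^ 2\<close> the kernel is at least \<open>1 / (2 * h)\<close> on a
  window of length \<open>2 * h\<close>, so the window carries mass at least 1, and on it
  \<open>g\<close> exceeds \<open>g x - \<epsilon>\<close> by uniform continuity. Since
  \<open>h \<le> 1\<close>, enlarging the interval by 1 keeps the window inside.\<close>

lemma heat_potential_initial:
  fixes g :: "real \<Rightarrow> real"
  assumes g: "continuous_on UNIV g" and g0: "\<And>x. 0 \<le> g x" and eps: "0 < \<epsilon>"
  obtains e where "0 < e" "e \<le> 1"
    "\<And>x. \<bar>x\<bar> \<le> r \<Longrightarrow> g x \<le> integral {-(r + 1)..r + 1} (\<lambda>y. heat_kernel e (x - y) * g y) + \<epsilon>"
proof -
  have "uniformly_continuous_on {-(r + 1)..r + 1} g"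
    by (rule compact_uniformly_continuous[OF continuous_on_subset[OF g]]) auto
  then obtain d where d: "d > 0" "\<And>x y. x \<in> {-(r + 1)..r + 1} \<Longrightarrow> y \<in> {-(r + 1)..r + 1} \<Longrightarrow> dist y x < d \<Longrightarrow> dist (g y) (g x) < \<epsilon>"
    unfolding uniformly_continuous_on_def using eps by meson
  define h where "h = min 1 (d / 2)"
  have h: "0 < h" "h \<le> 1" "h < d" using d by (auto simp: h_def)
  define e where "e = h ^ 2"
  have e: "0 < e" "e \<le> 1" "sqrt e = h" using h by (auto simp: e_def power_le_one)
  show thesis
  proof (rule that[OF e(1,2)])
    fix x assume x: "\<bar>x\<bar> \<le> r"
    let ?k = "\<lambda>y. heat_kernel e (x - y) * g y"
    have kc: "continuous_on A ?k" for A
      using e by (intro continuous_intros continuous_on_subset[OF g]) auto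
    have ki: "?k integrable_on {a..b}" for a b by (rule integrable_continuous_real[OF kc])
    have k0: "0 \<le> ?k y" for y by (intro mult_nonneg_nonneg heat_kernel_nonneg e g0)
    have sub: "{x - h..x + h} \<subseteq> {-(r + 1)..r + 1}" using x h by auto
    have "g x - \<epsilon> \<le> integral {-(r + 1)..r + 1} ?k"
    proof (cases "0 \<le> g x - \<epsilon>")
      case True
      have "g x - \<epsilon> = integral {x - h..x + h} (\<lambda>y. 1 / (2 * h) * (g x - \<epsilon>))"
        using h by simp
      also have "\<dots> \<le> integral {x - h..x + h} ?k"
      proof (rule integral_le[OF integrable_on_const ki])
        fix y assume y: "y \<in> {x - h..x + h}"
        have "1 / (2 * h) \<le> heat_kernel e (x - y)"
          using heat_kernel_ge[OF e(1), of "x - y"] y e(3) by auto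
        moreover have "dist (g x) (g y) < \<epsilon>"
          using d(2)[of y x] y sub h x by (auto simp: dist_real_def)
        then have "g x - \<epsilon> \<le> g y" by (auto simp: dist_real_def)
        ultimately show "1 / (2 * h) * (g x - \<epsilon>) \<le> ?k y"
          using True e by (intro mult_mono heat_kernel_nonneg) auto
      qed auto
      also have "\<dots> \<le> integral {-(r + 1)..r + 1} ?k"
        by (rule integral_subset_le[OF sub ki ki]) (use k0 in auto)
      finally show ?thesis .
    next
      case False
      moreover have "0 \<le> integral {-(r + 1)..r + 1} ?k"
        by (rule integral_nonneg[OF ki]) (use k0 in auto)
      ultimately show ?thesis by linarith
    qed
    then show "g x \<le> integral {-(r + 1)..r + 1} ?k + \<epsilon>" by linarith
  qed
qed

lemma heat_potential_le:
  fixes g :: "real \<Rightarrow> real"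
  assumes g: "continuous_on UNIV g" and g0: "\<And>x. 0 \<le> g x" "\<And>x. g x \<le> K" and "0 < T" "0 \<le> e" "e \<le> 1"
  shows "integral {-r..r} (\<lambda>y. heat_kernel (T + e) (x - y) * g y) \<le> (\<integral>y. heat_majorant T (x - y) * g y \<partial>lborel)"
proof -
  have gm [measurable]: "g \<in> borel_measurable borel" by (rule borel_measurable_continuous_onI[OF g])
  have [measurable]: "(\<lambda>y. heat_majorant T (x - y)) \<in> borel_measurable borel"
    unfolding heat_majorant_def by measurable
  have ga0: "0 \<le> heat_majorant T y" for y using assms by (simp add: heat_majorant_def)
  have i: "integrable lborel (\<lambda>y. heat_majorant T (x - y) * g y)"
  proof (rule Bochner_Integration.integrable_bound)
    show "integrable lborel (\<lambda>y. K * heat_majorant T (x - y))"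
      by (intro integrable_mult_right heat_majorant_integrable assms)
    show "AE y in lborel. norm (heat_majorant T (x - y) * g y) \<le> norm (K * heat_majorant T (x - y))"
    proof (rule AE_I2)
      fix y
      have "heat_majorant T (x - y) * g y \<le> K * heat_majorant T (x - y)"
        using mult_left_mono[OF g0(2)[of y] ga0[of "x - y"]] by (simp add: mult.commute)
      then show "norm (heat_majorant T (x - y) * g y) \<le> norm (K * heat_majorant T (x - y))"
        using ga0[of "x - y"] g0(1)[of y] order_trans[OF g0(1)[of y] g0(2)[of y]] by (simp add: abs_mult)
    qed
  qed simp
  have si: "set_integrable lborel {-r..r} (\<lambda>y. heat_majorant T (x - y) * g y)"
    unfolding set_integrable_def by (rule integrable_mult_indicator[OF _ i]) simp
  have "integral {-r..r} (\<lambda>y. heat_kernel (T + e) (x - y) * g y) \<le> integral {-r..r} (\<lambda>y. heat_majorant T (x - y) * g y)"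
  proof (rule integral_le)
    show "(\<lambda>y. heat_kernel (T + e) (x - y) * g y) integrable_on {-r..r}"
      using assms by (intro integrable_continuous_real continuous_intros continuous_on_subset[OF g]) auto
    show "(\<lambda>y. heat_majorant T (x - y) * g y) integrable_on {-r..r}"
      by (rule set_borel_integral_eq_integral(1)[OF si])
    show "heat_kernel (T + e) (x - y) * g y \<le> heat_majorant T (x - y) * g y" for y
      by (intro mult_right_mono heat_kernel_le_heat_majorant assms)
  qed
  also have "\<dots> = (LINT y:{-r..r}|lborel. heat_majorant T (x - y) * g y)"
    by (rule set_borel_integral_eq_integral(2)[OF si, symmetric])
  also have "\<dots> \<le> (\<integral>y. heat_majorant T (x - y) * g y \<partial>lborel)"
    unfolding set_lebesgue_integral_def
    by (rule integral_mono[OF si[unfolded set_integrable_def] i])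
      (auto simp: indicator_def intro!: mult_nonneg_nonneg ga0 g0)
  finally show ?thesis .
qed

text \<open>A Gronwall argument run through a barrier: \<open>exp (L * t)\<close> absorbs the linear
  term, a heat potential the initial values, and explicit functions of time the two sources. The
  decaying source costs only its total mass \<open>D / c\<close> however large \<open>D\<close> is
  compared with \<open>A\<close>; this is how the poor mode bounds at small times become
  harmless.\<close>

theorem heat_comparison:
  fixes b bt bx bxx :: "real \<Rightarrow> real \<Rightarrow> real"
  assumes T: "0 < T" and L: "0 \<le> L" and A: "0 \<le> A" and D: "0 \<le> D" and c: "0 < c"
    and cont: "continuous_on ({0..T} \<times> UNIV) (\<lambda>(t, x). b t x)"
    and bnd: "\<And>t x. 0 \<le> t \<Longrightarrow> t \<le> T \<Longrightarrow> 0 \<le> b t x \<and> b t x \<le> K"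
    and bx: "\<And>t x. 0 < t \<Longrightarrow> t \<le> T \<Longrightarrow> (b t has_real_derivative bx t x) (at x)"
    and bxx: "\<And>t x. 0 < t \<Longrightarrow> t \<le> T \<Longrightarrow> (bx t has_real_derivative bxx t x) (at x)"
    and bt: "\<And>t x. 0 < t \<Longrightarrow> t \<le> T \<Longrightarrow> ((\<lambda>s. b s x) has_real_derivative bt t x) (at_left t)"
    and ineq: "\<And>t x. 0 < t \<Longrightarrow> t \<le> T \<Longrightarrow> bt t x \<le> 1/2 * bxx t x + L * b t x + A + D * exp (- c * t)"
  shows "b T x \<le> exp (L * T) * ((\<integral>y. heat_majorant T (x - y) * b 0 y \<partial>lborel) + A * T + D / c)"
proof -
  define I where "I = (\<integral>y. heat_majorant T (x - y) * b 0 y \<partial>lborel) + A * T + D / c"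
  have g: "continuous_on UNIV (b 0)"
  proof -
    have "continuous_on UNIV ((\<lambda>(t, x). b t x) \<circ> (\<lambda>x. (0, x)))"
      by (intro continuous_on_compose continuous_on_subset[OF cont] continuous_intros) (use T in auto)
    then show ?thesis by (simp add: o_def)
  qed
  have g0: "0 \<le> b 0 x" "b 0 x \<le> K" for x using bnd[of 0 x] T by auto
  have key: "b T x \<le> exp (L * T) * (I + \<epsilon> * (2 + x ^ 2 + 2 * T))" if eps: "0 < \<epsilon>" for \<epsilon>
  proof -
    \<comment> \<open>Beyond \<open>r\<close> the quadratic part of the barrier alone exceeds
      \<open>K\<close>, because \<open>K / \<epsilon> < r \<le> r ^ 2\<close>; the summand 1 secures
      the second inequality.\<close>
    define r where "r = max 0 (K / \<epsilon>) + 1"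
    have r1: "1 \<le> r" by (simp add: r_def)
    have Kr: "K < \<epsilon> * x ^ 2" if "r < \<bar>x\<bar>" for x
    proof -
      have "K / \<epsilon> < r" by (simp add: r_def)
      then have "K < \<epsilon> * r" using eps by (simp add: field_simps)
      also have "r \<le> x ^ 2"
      proof -
        have "r \<le> r ^ 2" using r1 by (simp add: power2_eq_square)
        also have "\<dots> \<le> \<bar>x\<bar> ^ 2" using that r1 by (intro power_mono) auto
        finally show ?thesis by simp
      qed
      finally show ?thesis using eps by simp
    qed
    obtain e where e: "0 < e" "e \<le> 1"
      and ini: "\<And>x. \<bar>x\<bar> \<le> r \<Longrightarrow> b 0 x \<le> integral {-(r + 1)..r + 1} (\<lambda>y. heat_kernel e (x - y) * b 0 y) + \<epsilon>"
      using heat_potential_initial[OF g g0(1) eps, of r] by blast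
    define w where "w t x = integral {-(r + 1)..r + 1} (\<lambda>y. heat_kernel (t + e) (x - y) * b 0 y)" for t x
    define wx where "wx t x = integral {-(r + 1)..r + 1} (\<lambda>y. (- (x - y) / (t + e)) * heat_kernel (t + e) (x - y) * b 0 y)" for t x
    define wxx where "wxx t x = integral {-(r + 1)..r + 1} (\<lambda>y. (((x - y) ^ 2 / (t + e) ^ 2 - 1 / (t + e)) * heat_kernel (t + e) (x - y)) * b 0 y)" for t x
    note hp = heat_potential[OF g e(1), where r = "r + 1", folded w_def wx_def wxx_def]
    have w0: "0 \<le> w t x" if "0 \<le> t" for t x
      unfolding w_def
      by (intro integral_nonneg integrable_continuous_real continuous_intros continuous_on_subset[OF g] mult_nonneg_nonneg heat_kernel_nonneg g0)
        (use that e in auto)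
    \<comment> \<open>The first \<open>\<epsilon>\<close> pays for the error of the potential at
      time 0. The term \<open>\<epsilon> * (1 + x ^ 2 + 2 * t)\<close> handles large
      \<open>x\<close>: its time derivative \<open>2 * \<epsilon>\<close> is twice half its second
      space derivative, which creates the strict surplus. The last two summands have the sources as
      time derivatives.\<close>
    define P where "P t x = w t x + \<epsilon> + \<epsilon> * (1 + x ^ 2 + 2 * t) + A * t + D / c * (1 - exp (- c * t))" for t x
    define z where "z t x = b t x - exp (L * t) * P t x" for t x
    have e1: "1 \<le> exp (L * t)" if "0 \<le> t" for t using that L by simp
    have q0: "0 \<le> A * t" "0 \<le> D / c * (1 - exp (- c * t))" if "0 \<le> t" for t
      using that A D c by auto
    have Plow: "\<epsilon> * x ^ 2 < P t x" if "0 \<le> t" for t x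
    proof -
      have "\<epsilon> * (1 + x ^ 2 + 2 * t) = \<epsilon> + \<epsilon> * x ^ 2 + \<epsilon> * 2 * t" by (simp add: algebra_simps)
      moreover have "0 \<le> \<epsilon> * 2 * t" using eps that by simp
      ultimately show ?thesis unfolding P_def using w0[OF that, of x] q0[OF that] eps by linarith
    qed
    have P0: "0 \<le> P t x" if "0 \<le> t" for t x
      using Plow[OF that, of x] eps by (smt (verit) mult_nonneg_nonneg zero_le_power2)
    have eP: "P t x \<le> exp (L * t) * P t x" if "0 \<le> t" for t x
      using mult_right_mono[OF e1[OF that] P0[OF that]] by simp
    have "z T x < 0"
    proof (rule parabolic_maximum_principle[where z = z and R = r and T = T
          and zt = "\<lambda>t x. bt t x - (exp (L * t) * L * P t x + (1/2 * wxx t x + 2 * \<epsilon> + A + D * exp (- c * t)) * exp (L * t))"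
          and zx = "\<lambda>t x. bx t x - exp (L * t) * (wx t x + 2 * \<epsilon> * x)"
          and zxx = "\<lambda>t x. bxx t x - exp (L * t) * (wxx t x + 2 * \<epsilon>)"])
      have "continuous_on ({0..T} \<times> UNIV) (\<lambda>p. (\<lambda>(t, x). b t x) p - exp (L * fst p) * ((\<lambda>(t, x). w t x) p + \<epsilon> + \<epsilon> * (1 + (snd p) ^ 2 + 2 * fst p) + A * fst p + D / c * (1 - exp (- c * fst p))))"
        by (intro continuous_intros cont hp(1))
      then show "continuous_on ({0..T} \<times> UNIV) (\<lambda>(t, x). z t x)"
        by (simp add: z_def P_def split_beta)
    next
      fix t x assume t: "0 \<le> t" "t \<le> T" and x: "r < \<bar>x\<bar>"
      have "b t x \<le> K" using bnd[OF t] by simp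
      also have "K < \<epsilon> * x ^ 2" by (rule Kr[OF x])
      also have "\<dots> < P t x" by (rule Plow[OF t(1)])
      also have "\<dots> \<le> exp (L * t) * P t x" by (rule eP[OF t(1)])
      finally show "z t x < 0" by (simp add: z_def)
    next
      fix x
      show "z 0 x < 0"
      proof (cases "\<bar>x\<bar> \<le> r")
        case True
        have "0 < \<epsilon> * (1 + x ^ 2)" using eps by (intro mult_pos_pos) (auto intro: add_pos_nonneg)
        then show ?thesis using ini[OF True] by (simp add: z_def P_def w_def)
      next
        case False
        then show ?thesis using Kr[of x] Plow[of 0 x] g0(2)[of x] by (simp add: z_def)
      qed
    next
      fix t x assume t: "0 < t" "t \<le> T"
      have "((\<lambda>x. P t x) has_real_derivative wx t x + 2 * \<epsilon> * x) (at x)"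
        unfolding P_def using t by (auto intro!: derivative_eq_intros hp(2))
      from DERIV_diff[OF bx[OF t] DERIV_cmult[OF this]]
      show "(z t has_real_derivative bx t x - exp (L * t) * (wx t x + 2 * \<epsilon> * x)) (at x)"
        unfolding z_def .
    next
      fix t x assume t: "0 < t" "t \<le> T"
      have "((\<lambda>x. wx t x + 2 * \<epsilon> * x) has_real_derivative wxx t x + 2 * \<epsilon>) (at x)"
        using t by (auto intro!: derivative_eq_intros hp(3))
      from DERIV_diff[OF bxx[OF t] DERIV_cmult[OF this]]
      show "((\<lambda>x. bx t x - exp (L * t) * (wx t x + 2 * \<epsilon> * x)) has_real_derivative bxx t x - exp (L * t) * (wxx t x + 2 * \<epsilon>)) (at x)" .
    next
      fix t x assume t: "0 < t" "t \<le> T"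
      have ex: "((\<lambda>t. exp (- c * t)) has_real_derivative exp (- c * t) * (- c)) (at t)"
        by (auto intro!: derivative_eq_intros)
      have "((\<lambda>t. P t x) has_real_derivative 1/2 * wxx t x + 0 + \<epsilon> * (0 + 2 * 1) + A * 1 + D / c * (0 - exp (- c * t) * (- c))) (at t)"
        unfolding P_def
        by (intro DERIV_add DERIV_cmult DERIV_const DERIV_diff DERIV_ident ex hp(4) t)
      then have dP: "((\<lambda>t. P t x) has_real_derivative 1/2 * wxx t x + 2 * \<epsilon> + A + D * exp (- c * t)) (at t)"
        using c by (simp add: mult.commute)
      have dE: "((\<lambda>t. exp (L * t)) has_real_derivative exp (L * t) * L) (at t)"
        by (auto intro!: derivative_eq_intros)
      from DERIV_diff[OF bt[OF t] has_field_derivative_at_within[OF DERIV_mult[OF dE dP]]]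
      show "((\<lambda>s. z s x) has_real_derivative bt t x - (exp (L * t) * L * P t x + (1/2 * wxx t x + 2 * \<epsilon> + A + D * exp (- c * t)) * exp (L * t))) (at_left t)"
        unfolding z_def .
    next
      fix t x assume t: "0 < t" "t \<le> T" and "z t x = 0"
      then have bz: "b t x = exp (L * t) * P t x" by (simp add: z_def)
      let ?E = "exp (L * t)"
      have "0 \<le> A + D * exp (- c * t)" using A D by simp
      from mult_right_mono[OF e1 this, of t] t have s: "A + D * exp (- c * t) \<le> ?E * (A + D * exp (- c * t))" by simp
      have "bt t x \<le> 1/2 * bxx t x + L * (?E * P t x) + (A + D * exp (- c * t))"
        using ineq[OF t, of x] unfolding bz by linarith
      \<comment> \<open>This is the surplus \<open>2 * \<epsilon> - \<epsilon>\<close> of the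
        quadratic part of the barrier; it turns the differential inequality into the strict one
        required.\<close>
      moreover have "0 < ?E * \<epsilon>" using eps by simp
      moreover have "?E * L * P t x + (1/2 * wxx t x + 2 * \<epsilon> + A + D * exp (- c * t)) * ?E
         = L * (?E * P t x) + 1/2 * (?E * (wxx t x + 2 * \<epsilon>)) + ?E * \<epsilon> + ?E * (A + D * exp (- c * t))"
        by (simp add: algebra_simps)
      ultimately show "bt t x - (?E * L * P t x + (1/2 * wxx t x + 2 * \<epsilon> + A + D * exp (- c * t)) * ?E)
         < 1/2 * (bxx t x - ?E * (wxx t x + 2 * \<epsilon>))"
        using s by (simp only: right_diff_distrib)
    qed (use T in auto)
    then have "b T x \<le> exp (L * T) * P T x" by (simp add: z_def)
    also have "P T x \<le> I + \<epsilon> * (2 + x ^ 2 + 2 * T)"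
    proof -
      have "w T x \<le> (\<integral>y. heat_majorant T (x - y) * b 0 y \<partial>lborel)"
        unfolding w_def by (rule heat_potential_le[OF g g0 T]) (use e in auto)
      moreover have "D / c * (1 - exp (- c * T)) \<le> D / c"
        using mult_left_mono[of "1 - exp (- c * T)" 1 "D / c"] D c by simp
      moreover have "\<epsilon> + \<epsilon> * (1 + x ^ 2 + 2 * T) = \<epsilon> * (2 + x ^ 2 + 2 * T)" by (simp add: algebra_simps)
      ultimately show ?thesis unfolding P_def I_def by linarith
    qed
    finally show ?thesis by (simp add: mult_left_mono)
  qed
  have "((\<lambda>\<epsilon>. exp (L * T) * (I + \<epsilon> * (2 + x ^ 2 + 2 * T))) \<longlongrightarrow> exp (L * T) * (I + 0 * (2 + x ^ 2 + 2 * T))) (at_right 0)"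
    by (intro tendsto_intros)
  then have "b T x \<le> exp (L * T) * (I + 0 * (2 + x ^ 2 + 2 * T))"
    by (rule tendsto_lowerbound) (use key in \<open>auto simp: eventually_at_right_less eventually_at_filter\<close>)
  then show ?thesis by (simp add: I_def)
qed

section \<open>Decay of Fourier modes\<close>

text \<open>The mean value theorem asks for two-sided derivatives. Instead the maximum principle is
  applied with a dummy space variable to \<open>m t - m 0 - e * (1 + 2 * t) - e * x ^ 2\<close>,
  where \<open>e * (1 + 2 * T)\<close> equals the prescribed error.\<close>

lemma nonincreasing_if_left_derivative:
  fixes m :: "real \<Rightarrow> real"
  assumes T: "0 \<le> T" and cont: "continuous_on {0..T} m"
    and d: "\<And>t. 0 < t \<Longrightarrow> t \<le> T \<Longrightarrow> (m has_real_derivative m' t) (at_left t)"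
    and le: "\<And>t. 0 < t \<Longrightarrow> t \<le> T \<Longrightarrow> m' t \<le> 0"
  shows "m T \<le> m 0"
proof (rule field_le_epsilon)
  fix e0 :: real assume "0 < e0"
  define e where "e = e0 / (1 + 2 * T)"
  have e: "0 < e" using \<open>0 < e0\<close> T by (simp add: e_def)
  have "compact (m ` {0..T})" by (intro compact_continuous_image cont) auto
  then obtain B where B: "\<And>t. 0 \<le> t \<Longrightarrow> t \<le> T \<Longrightarrow> \<bar>m t\<bar> \<le> B"
    using compact_imp_bounded[of "m ` {0..T}"] unfolding bounded_iff by (metis atLeastAtMost_iff imageI real_norm_def)
  define R where "R = 1 + 2 * B / e"
  have B0: "0 \<le> B" using B[of 0] T by linarith
  let ?z = "\<lambda>t x. m t - m 0 - e * (1 + 2 * t) - e * x ^ 2"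
  have "?z T 0 < 0"
  proof (rule parabolic_maximum_principle[where z = ?z and T = T and R = R
        and zt = "\<lambda>t x. m' t - 2 * e" and zx = "\<lambda>t x. - 2 * e * x" and zxx = "\<lambda>t x. - 2 * e"])
    have "continuous_on ({0..T} \<times> UNIV) (\<lambda>p. m (fst p))"
      by (rule continuous_on_compose2[OF cont]) (auto intro: continuous_intros)
    then show "continuous_on ({0..T} \<times> UNIV) (\<lambda>(t, x). ?z t x)"
      unfolding split_beta by (intro continuous_intros)
  next
    fix t x assume t: "0 \<le> t" "t \<le> T" and x: "R < \<bar>x\<bar>"
    have R1: "1 \<le> R" using B0 e by (simp add: R_def)
    have "2 * B < e * R" using e by (simp add: R_def distrib_left)
    also have "R \<le> R ^ 2" using R1 by (simp add: power2_eq_square)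
    also have "R ^ 2 \<le> \<bar>x\<bar> ^ 2" using x R1 by (intro power_mono) auto
    finally have "2 * B < e * x ^ 2" using e by simp
    moreover have "m t - m 0 \<le> 2 * B" using B[OF t] B[of 0] T by linarith
    moreover have "0 \<le> e * (1 + 2 * t)" using e t by simp
    ultimately show "?z t x < 0" by linarith
  next
    fix x
    have "0 \<le> e * x ^ 2" using e by simp
    then have "- e < e * x ^ 2" using e by linarith
    then show "?z 0 x < 0" by simp
  next
    fix t x assume t: "0 < t" "t \<le> T"
    show "(?z t has_real_derivative - 2 * e * x) (at x)"
      by (auto intro!: derivative_eq_intros)
    show "((\<lambda>x. - 2 * e * x) has_real_derivative - 2 * e) (at x)"
      by (auto intro!: derivative_eq_intros)
    have "((\<lambda>t. e * (1 + 2 * t)) has_real_derivative 2 * e) (at_left t)"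
      by (auto intro!: derivative_eq_intros)
    from DERIV_diff[OF DERIV_diff[OF DERIV_diff[OF d[OF t] DERIV_const[of "m 0"]] this] DERIV_const[of "e * x ^ 2"]]
    show "((\<lambda>s. ?z s x) has_real_derivative m' t - 2 * e) (at_left t)" by simp
    show "m' t - 2 * e < 1/2 * (- 2 * e)" using le[OF t] e by simp
  qed (use T in auto)
  moreover have "e * (1 + 2 * T) = e0" using T by (simp add: e_def)
  ultimately show "m T \<le> m 0 + e0" by simp
qed

section \<open>Jump estimates for empirical means\<close>

lemma emp_mean_theta:
  assumes "i < N" "j < N" "i \<noteq> j"
  shows "emp_mean N f (theta i j x) - emp_mean N f x = (2 * f (max (x i) (x j)) - f (x i) - f (x j)) / real N"
proof -
  have fin: "finite ({..<N} - {i})" "j \<in> {..<N} - {i}" using assms by auto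
  have split: "(\<Sum>k<N. g k) = g i + g j + (\<Sum>k\<in>{..<N} - {i} - {j}. g k)" for g :: "nat \<Rightarrow> real"
    using assms sum.remove[of "{..<N}" i g] sum.remove[OF fin, of g] by simp
  have "(\<Sum>k\<in>{..<N} - {i} - {j}. f (theta i j x k)) = (\<Sum>k\<in>{..<N} - {i} - {j}. f (x k))"
    by (intro sum.cong) (auto simp: theta_def)
  then have "(\<Sum>k<N. f (theta i j x k)) - (\<Sum>k<N. f (x k)) = 2 * f (max (x i) (x j)) - f (x i) - f (x j)"
    unfolding split by (simp add: theta_def max.commute)
  then show ?thesis unfolding emp_mean_def by (simp flip: diff_divide_distrib)
qed

lemma jump_le:
  assumes "2 \<le> N" and "\<And>i j. i < N \<Longrightarrow> j < N \<Longrightarrow> i \<noteq> j \<Longrightarrow> f (theta i j x) - f x \<le> c i j"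
  shows "jump N f x \<le> 1 / (2 * (real N - 1)) * (\<Sum>i<N. \<Sum>j\<in>{..<N} - {i}. c i j)"
  unfolding jump_def using assms by (intro mult_left_mono sum_mono) auto

text \<open>There are \<open>N * (N - 1)\<close> ordered pairs, each weighted by
  \<open>1 / (2 * (N - 1))\<close>. Changes of size \<open>c / N\<close> per jump therefore add up
  to a bound that does not grow with \<open>N\<close>.\<close>

lemma jump_le_const:
  assumes "2 \<le> N" and "\<And>i j. i < N \<Longrightarrow> j < N \<Longrightarrow> i \<noteq> j \<Longrightarrow> f (theta i j x) - f x \<le> c / real N"
  shows "jump N f x \<le> c / 2"
proof -
  have "jump N f x \<le> 1 / (2 * (real N - 1)) * (\<Sum>i<N. \<Sum>j\<in>{..<N} - {i}. c / real N)"
    by (rule jump_le) (use assms in auto)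
  also have "\<dots> = 1 / (2 * (real N - 1)) * (real N * (real N - 1) * (c / real N))"
    using assms(1) by (simp add: of_nat_diff)
  also have "\<dots> = c / 2" using assms(1) by (simp add: field_simps)
  finally show ?thesis .
qed

text \<open>The value of \<open>f\<close> at the maximum is one of \<open>f (x i)\<close>,
  \<open>f (x j)\<close>, so a jump adds at most their sum over \<open>N\<close>. Each index occurs
  in \<open>2 * (N - 1)\<close> ordered pairs, which cancels the prefactor and leaves growth rate
  1.\<close>

lemma jump_emp_mean_le_nonneg:
  assumes "2 \<le> N" and f0: "\<And>y. 0 \<le> f y"
  shows "jump N (emp_mean N f) x \<le> emp_mean N f x"
proof -
  have "jump N (emp_mean N f) x \<le> 1 / (2 * (real N - 1)) * (\<Sum>i<N. \<Sum>j\<in>{..<N} - {i}. (f (x i) + f (x j)) / real N)"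
  proof (rule jump_le[OF assms(1)])
    fix i j assume "i < N" "j < N" "i \<noteq> j"
    then show "emp_mean N f (theta i j x) - emp_mean N f x \<le> (f (x i) + f (x j)) / real N"
      unfolding emp_mean_theta[OF \<open>i < N\<close> \<open>j < N\<close> \<open>i \<noteq> j\<close>] using f0[of "x i"] f0[of "x j"]
      by (intro divide_right_mono) (auto simp: max_def)
  qed
  also have "(\<Sum>i<N. \<Sum>j\<in>{..<N} - {i}. (f (x i) + f (x j)) / real N) = (\<Sum>i<N. (\<Sum>j<N. (f (x i) + f (x j)) / real N) - 2 * f (x i) / real N)"
    by (intro sum.cong refl) (simp add: sum_diff1)
  also have "\<dots> = 2 * (real N - 1) * emp_mean N f x"
  proof -
    define t where "t = (\<Sum>i<N. f (x i))"
    have "(\<Sum>i<N. (\<Sum>j<N. (f (x i) + f (x j)) / real N) - 2 * f (x i) / real N)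
        = (\<Sum>i<N. (real N * f (x i) + t) / real N - 2 * f (x i) / real N)"
      by (intro sum.cong refl) (simp only: sum_divide_distrib[symmetric] sum.distrib t_def, simp)
    also have "\<dots> = (real N * t + real N * t) / real N - 2 * t / real N"
      by (simp only: sum_subtractf sum_divide_distrib[symmetric] sum.distrib sum_distrib_left[symmetric] t_def, simp)
    also have "\<dots> = 2 * (real N - 1) * (t / real N)" using assms(1) by (simp add: field_simps)
    finally show ?thesis by (simp only: emp_mean_def t_def)
  qed
  also have "1 / (2 * (real N - 1)) * (2 * (real N - 1) * emp_mean N f x) = emp_mean N f x"
    using assms(1) by simp
  finally show ?thesis .
qed

lemma emp_mean_mono: "(\<And>y. f y \<le> g y) \<Longrightarrow> emp_mean N f x \<le> emp_mean N g x"
  unfolding emp_mean_def by (intro divide_right_mono sum_mono) auto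

lemma emp_mean_const: "0 < N \<Longrightarrow> emp_mean N (\<lambda>_. c) x = c"
  by (simp add: emp_mean_def)

lemma emp_mean_add: "emp_mean N (\<lambda>y. f y + g y) x = emp_mean N f x + emp_mean N g x"
  by (simp add: emp_mean_def sum.distrib add_divide_distrib)

lemma emp_mean_cmult: "emp_mean N (\<lambda>y. c * f y) x = c * emp_mean N f x"
  by (simp add: emp_mean_def sum_distrib_left)

lemma emp_mean_sum: "emp_mean N (\<lambda>y. \<Sum>a\<in>A. f a y) x = (\<Sum>a\<in>A. emp_mean N (f a) x)"
  unfolding emp_mean_def by (subst sum.swap) (simp add: sum_divide_distrib)

lemma emp_mean_abs_le:
  assumes "0 < N" "\<And>y. \<bar>f y\<bar> \<le> c" shows "\<bar>emp_mean N f x\<bar> \<le> c"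
proof -
  have "emp_mean N f x \<le> emp_mean N (\<lambda>_. c) x" "emp_mean N (\<lambda>_. - c) x \<le> emp_mean N f x"
    using assms(2) by (intro emp_mean_mono; simp add: abs_le_iff minus_le_iff)+
  then show ?thesis using assms(1) by (simp add: emp_mean_const abs_le_iff)
qed

lemma bdd_cyl_emp_mean: "continuous_on UNIV f \<Longrightarrow> bounded (range f) \<Longrightarrow> bdd_cyl N (emp_mean N f)"
proof -
  assume f: "continuous_on UNIV f" "bounded (range f)"
  have "bdd_cyl N (\<lambda>x. 1 / real N * (\<Sum>i<N. f (x i)))"
    by (intro bdd_cyl_cmult bdd_cyl_sum bdd_cyl_coord1 f) auto
  then show ?thesis by (simp add: emp_mean_def[abs_def])
qed

context particle_system
begin

definition cos_mode :: "real \<Rightarrow> real \<Rightarrow> real \<Rightarrow> real" where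
  "cos_mode t a x = expectation (\<lambda>\<omega>. emp_mean N (\<lambda>y. cos (a * (x - y))) (X t \<omega>))"

lemma C2b_cos: "C2b (\<lambda>y. cos (a * (x - y))) (\<lambda>y. a * sin (a * (x - y))) (\<lambda>y. - (a ^ 2) * cos (a * (x - y)))"
proof -
  have "C2b cos (\<lambda>x. - sin x) (\<lambda>x. - cos x)"
    unfolding C2b_def
    by (auto intro!: derivative_eq_intros continuous_intros exI[of _ 1] simp: abs_le_iff minus_le_iff)
  from C2b_affine[OF this, of "-a" "a * x"] show ?thesis
    by (simp add: right_diff_distrib)
qed

text \<open>The mode satisfies \<open>m' = - (a ^ 2 / 2) * m + j\<close> with
  \<open>j \<le> 1\<close>. The constant \<open>2 / a ^ 2\<close> is the equilibrium for
  \<open>j = 1\<close>, so the distance from it, multiplied by the integrating factor, is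
  nonincreasing.\<close>

lemma cos_mode_decay:
  assumes a: "0 < a" and t: "0 \<le> t"
  shows "cos_mode t a x \<le> exp (- (a ^ 2 / 2) * t) + 2 / a ^ 2"
proof -
  let ?f = "\<lambda>y. cos (a * (x - y))"
  have d: "dyn (emp_mean N ?f) (emp_mean N (\<lambda>y. - (a ^ 2) * ?f y))" by (rule dyn_emp_mean[OF C2b_cos])
  note cbd = dyn_bdd_cyl[OF d]
  obtain B where B: "\<And>x. \<bar>1/2 * emp_mean N (\<lambda>y. - (a ^ 2) * ?f y) x + jump N (emp_mean N ?f) x\<bar> \<le> B"
    using bdd_cyl_bounded[OF cbd(2)] by blast
  let ?m = "\<lambda>t. cos_mode t a x"
  let ?v = "\<lambda>t. exp (a ^ 2 / 2 * t) * (?m t - 2 / a ^ 2)"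
  let ?j = "\<lambda>t. expectation (\<lambda>\<omega>. jump N (emp_mean N ?f) (Y t \<omega>))"
  have N0: "0 < N" using N2 by simp
  have "continuous_on {0..} ?m"
  proof (rule continuous_on_subset[where s = "{0..}"])
    have "B-lipschitz_on {0..} ?m"
    proof (rule lipschitz_onI)
      show "dist (?m s) (?m r) \<le> B * dist s r" if "s \<in> {0..}" "r \<in> {0..}" for s r
        using dyn_lipschitz[OF d B, of r s] that by (simp add: cos_mode_def dist_real_def)
      show "0 \<le> B" using B[of "\<lambda>_. 0"] by linarith
    qed
    then show "continuous_on {0..} ?m" by (rule lipschitz_on_continuous_on)
  qed simp
  then have cm: "continuous_on {0..t} ?m" by (rule continuous_on_subset) auto
  have jl: "jump N (emp_mean N ?f) z \<le> 1" for z
  proof -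
    have "jump N (emp_mean N ?f) z \<le> 2 / 2"
    proof (rule jump_le_const[OF N2])
      fix i j assume "i < N" "j < N" "i \<noteq> j"
      then show "emp_mean N ?f (theta i j z) - emp_mean N ?f z \<le> 2 / real N"
        unfolding emp_mean_theta[OF \<open>i < N\<close> \<open>j < N\<close> \<open>i \<noteq> j\<close>]
      proof (intro divide_right_mono)
        \<comment> \<open>One of the two old values cancels against the doubled new one, so the jump
          changes the sum by a difference of just two cosines.\<close>
        have "cos b - cos c \<le> 2" for b c :: real
          using cos_le_one[of b] cos_ge_minus_one[of c] by linarith
        then show "2 * ?f (max (z i) (z j)) - ?f (z i) - ?f (z j) \<le> 2" by (simp add: max_def)
      qed simp
    qed
    then show ?thesis by simp
  qed
  have cj: "bdd_cyl N (jump N (emp_mean N ?f))" using d by (simp add: dyn_def)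
  have "?v t \<le> ?v 0"
  proof (rule nonincreasing_if_left_derivative[OF t, where m = ?v
        and m' = "\<lambda>t. exp (a ^ 2 / 2 * t) * (?j t - 1)"])
    show "continuous_on {0..t} ?v" by (intro continuous_intros cm)
  next
    fix s assume s: "0 < s" "s \<le> t"
    have "expectation (\<lambda>\<omega>. 1/2 * emp_mean N (\<lambda>y. - (a ^ 2) * ?f y) (Y s \<omega>) + jump N (emp_mean N ?f) (Y s \<omega>))
       = expectation (\<lambda>\<omega>. (- (a ^ 2) / 2) * emp_mean N ?f (Y s \<omega>) + jump N (emp_mean N ?f) (Y s \<omega>))"
      unfolding emp_mean_cmult by simp
    also have "\<dots> = (- (a ^ 2) / 2) * expectation (\<lambda>\<omega>. emp_mean N ?f (Y s \<omega>)) + ?j s"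
      by (subst Bochner_Integration.integral_add[OF integrable_mult_right[OF bdd_cyl_Y_integrable[OF cbd(1) s(1)]] bdd_cyl_Y_integrable[OF cj s(1)]])
        simp
    also have "\<dots> = - (a ^ 2) / 2 * ?m s + ?j s"
      unfolding dyn_left_eq[OF d s(1)] cos_mode_def by simp
    finally have dm: "(?m has_real_derivative - (a ^ 2) / 2 * ?m s + ?j s) (at_left s)"
      using dyn_left_derivative[OF d s(1)] unfolding cos_mode_def[abs_def] by simp
    have de: "((\<lambda>t. exp (a ^ 2 / 2 * t)) has_real_derivative exp (a ^ 2 / 2 * s) * (a ^ 2 / 2)) (at_left s)"
      by (auto intro!: derivative_eq_intros)
    have "exp (a ^ 2 / 2 * s) * (a ^ 2 / 2) * (?m s - 2 / a ^ 2) + (- (a ^ 2) / 2 * ?m s + ?j s - 0) * exp (a ^ 2 / 2 * s)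
      = exp (a ^ 2 / 2 * s) * (?j s - 1)"
      using a by (simp add: field_simps)
    then show "(?v has_real_derivative exp (a ^ 2 / 2 * s) * (?j s - 1)) (at_left s)"
      using DERIV_mult[OF de DERIV_diff[OF dm DERIV_const[of "2 / a ^ 2"]]] by simp
    have "?j s \<le> expectation (\<lambda>\<omega>. 1)"
      by (intro integral_mono bdd_cyl_Y_integrable[OF cj s(1)]) (auto intro: jl)
    then have "?j s \<le> 1" by (simp add: prob_space)
    then show "exp (a ^ 2 / 2 * s) * (?j s - 1) \<le> 0"
      by (simp add: mult_le_0_iff)
  qed
  moreover have "?m 0 \<le> 1"
  proof -
    have "\<bar>emp_mean N ?f z\<bar> \<le> 1" for z by (rule emp_mean_abs_le[OF N0]) auto
    then have "\<bar>?m 0\<bar> \<le> 1" unfolding cos_mode_def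
      by (intro expectation_abs_bound bdd_cyl_X_integrable[OF cbd(1)]) auto
    then show ?thesis by simp
  qed
  moreover have "0 \<le> 2 / a ^ 2" by simp
  moreover have "?v 0 = ?m 0 - 2 / a ^ 2" by simp
  ultimately have "?v t \<le> 1" by linarith
  then have "exp (- (a ^ 2 / 2 * t)) * ?v t \<le> exp (- (a ^ 2 / 2 * t)) * 1"
    by (intro mult_left_mono) auto
  moreover have "exp (- (a ^ 2 / 2 * t)) * ?v t = ?m t - 2 / a ^ 2"
    by (simp add: mult.assoc[symmetric] exp_minus)
  ultimately have "?m t - 2 / a ^ 2 \<le> exp (- (a ^ 2 / 2 * t))" by linarith
  then show ?thesis by simp
qed

text \<open>The differences of frequencies in the square of a cosine sum can be negative, and
  evenness of the cosine covers them. Among all frequencies of modulus at least \<open>l\<close> the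
  bound at \<open>l\<close> itself is the weakest.\<close>

lemma cos_mode_decay':
  assumes l: "0 < l" "l \<le> \<bar>a\<bar>" and t: "0 < t"
  shows "expectation (\<lambda>\<omega>. emp_mean N (\<lambda>y. cos (a * (x - y))) (Y t \<omega>)) \<le> exp (- (l ^ 2 / 2) * t) + 2 / l ^ 2"
proof -
  have e: "(\<lambda>y. cos (a * (x - y))) = (\<lambda>y. cos (\<bar>a\<bar> * (x - y)))"
  proof
    fix y have "cos (- (a * (x - y))) = cos (a * (x - y))" by simp
    then show "cos (a * (x - y)) = cos (\<bar>a\<bar> * (x - y))" by (cases "0 \<le> a") auto
  qed
  have "expectation (\<lambda>\<omega>. emp_mean N (\<lambda>y. cos (a * (x - y))) (Y t \<omega>)) = cos_mode t \<bar>a\<bar> x"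
    unfolding cos_mode_def dyn_left_eq[OF dyn_emp_mean[OF C2b_cos] t] e by simp
  also have "\<dots> \<le> exp (- (\<bar>a\<bar> ^ 2 / 2) * t) + 2 / \<bar>a\<bar> ^ 2"
    by (rule cos_mode_decay) (use l t in auto)
  also have "\<dots> \<le> exp (- (l ^ 2 / 2) * t) + 2 / l ^ 2"
  proof -
    have "l ^ 2 \<le> \<bar>a\<bar> ^ 2" using l by (intro power_mono) auto
    then show ?thesis using t l by (intro add_mono divide_left_mono) (auto simp: mult_right_mono)
  qed
  finally show ?thesis .
qed

text \<open>By the product formula the square contains the frequencies \<open>(i + j) * l\<close>
  and \<open>(i - j) * l\<close>. All of them have modulus at least \<open>l\<close> and are damped,
  except the \<open>n\<close> diagonal differences, whose cosine is 1; with weight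
  \<open>1 / (2 * n ^ 2)\<close> these contribute \<open>1 / (2 * n)\<close>.\<close>

lemma cos_square_bound:
  assumes l: "0 < l" and n: "0 < n" and t: "0 < t"
  shows "expectation (\<lambda>\<omega>. emp_mean N (\<lambda>y. ((\<Sum>i=1..n. cos (real i * l * (x - y))) / real n) ^ 2) (Y t \<omega>))
    \<le> 1 / (2 * real n) + (exp (- (l ^ 2 / 2) * t) + 2 / l ^ 2)"
proof -
  let ?f = "\<lambda>a y. cos (a * (x - y))"
  let ?c = "\<lambda>a. expectation (\<lambda>\<omega>. emp_mean N (?f a) (Y t \<omega>))"
  define \<beta> where "\<beta> = exp (- (l ^ 2 / 2) * t) + 2 / l ^ 2"
  have b0: "0 \<le> \<beta>" by (simp add: \<beta>_def)
  have int: "integrable M (\<lambda>\<omega>. emp_mean N (?f a) (Y t \<omega>))" for a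
    by (rule bdd_cyl_Y_integrable[OF dyn_bdd_cyl(1)[OF dyn_emp_mean[OF C2b_cos]] t])
  let ?a = "\<lambda>i j. (real i - real j) * l" and ?b = "\<lambda>i j. (real i + real j) * l"
  have sq: "((\<Sum>i=1..n. cos (real i * l * (x - y))) / real n) ^ 2
     = 1 / real n ^ 2 * (\<Sum>i=1..n. \<Sum>j=1..n. 1/2 * (?f (?a i j) y + ?f (?b i j) y))" for y
  proof -
    have "(\<Sum>i=1..n. cos (real i * l * (x - y))) ^ 2 = (\<Sum>i=1..n. \<Sum>j=1..n. cos (real i * l * (x - y)) * cos (real j * l * (x - y)))"
      by (simp add: power2_eq_square sum_product)
    also have "\<dots> = (\<Sum>i=1..n. \<Sum>j=1..n. 1/2 * (?f (?a i j) y + ?f (?b i j) y))"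
      by (intro sum.cong refl) (simp add: cos_times_cos algebra_simps)
    finally show ?thesis by (simp add: power_divide)
  qed
  have "expectation (\<lambda>\<omega>. emp_mean N (\<lambda>y. ((\<Sum>i=1..n. cos (real i * l * (x - y))) / real n) ^ 2) (Y t \<omega>))
      = 1 / real n ^ 2 * (\<Sum>i=1..n. \<Sum>j=1..n. 1/2 * (?c (?a i j) + ?c (?b i j)))"
    unfolding sq emp_mean_cmult emp_mean_sum emp_mean_add
    by (simp add: int Bochner_Integration.integral_sum Bochner_Integration.integral_add del: sum_divide_distrib)
  also have "\<dots> \<le> 1 / real n ^ 2 * (\<Sum>i=1..n. \<Sum>j=1..n. \<beta> + (if i = j then 1/2 else 0))"
  proof (intro mult_left_mono sum_mono)
    fix i j assume ij: "i \<in> {1..n}" "j \<in> {1..n}"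
    have "?c (?b i j) \<le> \<beta>"
      unfolding \<beta>_def
    proof (rule cos_mode_decay'[OF l _ t])
      show "l \<le> \<bar>?b i j\<bar>" using ij l mult_right_mono[of 1 "real i + real j" l] by (simp add: abs_mult)
    qed
    moreover have "?c (?a i j) \<le> \<beta>" if "i \<noteq> j"
      unfolding \<beta>_def
    proof (rule cos_mode_decay'[OF l _ t])
      have "1 \<le> \<bar>real i - real j\<bar>" using that by linarith
      then show "l \<le> \<bar>?a i j\<bar>" using l mult_right_mono[of 1 "\<bar>real i - real j\<bar>" l] by (simp add: abs_mult)
    qed
    moreover have "?c (?a i j) = 1" if "i = j"
      using that N2 by (simp add: emp_mean_const prob_space)
    ultimately show "1/2 * (?c (?a i j) + ?c (?b i j)) \<le> \<beta> + (if i = j then 1/2 else 0)"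
      using b0 by (cases "i = j") auto
  qed simp
  also have "\<dots> = 1 / real n ^ 2 * (real n * (real n * \<beta>) + real n / 2)"
    by (simp add: sum.distrib distrib_left)
  also have "\<dots> = 1 / (2 * real n) + \<beta>"
  proof -
    have "1 / real n ^ 2 * (real n * (real n * b) + real n / 2) = 1 / (2 * real n) + b" for b :: real
    proof -
      have "1 / (c * c) * (c * (c * b) + c / 2) = 1 / (2 * c) + b" if "0 < c" for c :: real
        using that by (simp add: field_simps)
      from this[of "real n"] show ?thesis using n by (simp only: power2_eq_square of_nat_0_less_iff)
    qed
    then show ?thesis .
  qed
  finally show ?thesis by (simp add: \<beta>_def)
qed

end

section \<open>The smoothed empirical distribution function\<close>

text \<open>The kernel is chosen because its derivative is \<open>logistic * (1 - logistic)\<close>,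
  exactly the weight by which smoothing fails to commute with the reaction. It also has exponential
  tails and satisfies \<open>logistic_d2 \<le> logistic\<close>, which drives the tail
  estimate.\<close>

definition logistic :: "real \<Rightarrow> real" where "logistic z = 1 / (1 + exp (- z))"
definition logistic_d1 :: "real \<Rightarrow> real" where "logistic_d1 z = logistic z * (1 - logistic z)"
definition logistic_d2 :: "real \<Rightarrow> real" where "logistic_d2 z = logistic z * (1 - logistic z) * (1 - 2 * logistic z)"

lemma logistic_bounds: "0 < logistic z" "logistic z < 1"
proof -
  have "0 < exp (- z)" by simp
  then show "0 < logistic z" "logistic z < 1" unfolding logistic_def by (auto simp: divide_less_eq add_pos_pos)
qed

lemma logistic_minus: "1 - logistic z = logistic (- z)"
proof -
  have "0 < exp z" by simp
  then have "1 + exp z \<noteq> 0" "exp z \<noteq> 0" by linarith+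
  then show ?thesis unfolding logistic_def by (simp add: exp_minus field_simps)
qed

lemma logistic_le_exp: "logistic z \<le> exp z"
proof -
  have "logistic z \<le> 1 / exp (- z)" unfolding logistic_def by (intro divide_left_mono) (auto intro!: mult_pos_pos add_pos_pos)
  then show ?thesis by (simp add: exp_minus inverse_eq_divide)
qed

lemma logistic_mono: "y \<le> z \<Longrightarrow> logistic y \<le> logistic z"
  unfolding logistic_def by (intro divide_left_mono) (auto intro!: mult_pos_pos add_pos_pos)

lemma logistic_deriv: "(logistic has_real_derivative logistic_d1 z) (at z)" "(logistic_d1 has_real_derivative logistic_d2 z) (at z)"
proof -
  show 1: "(logistic has_real_derivative logistic_d1 z) (at z)" for z
  proof -
    have p: "1 + exp (- z) \<noteq> 0" using exp_gt_zero[of "- z"] by linarith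
    have e: "((\<lambda>z. 1 + exp (- z)) has_real_derivative - exp (- z)) (at z)"
      by (auto intro!: derivative_eq_intros)
    have "((\<lambda>z. inverse (1 + exp (- z))) has_real_derivative - (inverse (1 + exp (- z)) * (- exp (- z)) * inverse (1 + exp (- z)))) (at z)"
      by (rule DERIV_inverse'[OF e p])
    moreover have "- (inverse (1 + q) * (- q) * inverse (1 + q)) = 1 / (1 + q) * (1 - 1 / (1 + q))" if "1 + q \<noteq> 0" for q :: real
      using that by (simp add: field_simps)
    ultimately show ?thesis
      unfolding logistic_def[abs_def] logistic_d1_def using p by (simp add: inverse_eq_divide)
  qed
  have "((\<lambda>z. logistic z * (1 - logistic z)) has_real_derivative logistic_d1 z * (1 - logistic z) + (0 - logistic_d1 z) * logistic z) (at z)"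
    by (intro DERIV_mult DERIV_diff DERIV_const 1)
  moreover have "logistic_d1 z * (1 - logistic z) + (0 - logistic_d1 z) * logistic z = logistic_d2 z"
    by (simp add: logistic_d1_def logistic_d2_def algebra_simps)
  ultimately show "(logistic_d1 has_real_derivative logistic_d2 z) (at z)" by (simp add: logistic_d1_def[abs_def])
qed

lemma logistic_d1_bounds: "0 < logistic_d1 z" "logistic_d1 z \<le> 1 / 4"
proof -
  show "0 < logistic_d1 z" unfolding logistic_d1_def using logistic_bounds[of z] by simp
  have "0 \<le> (logistic z - 1/2) ^ 2" by simp
  then show "logistic_d1 z \<le> 1 / 4" unfolding logistic_d1_def power2_eq_square by (simp add: algebra_simps)
qed

lemma logistic_d2_abs_le: "\<bar>logistic_d2 z\<bar> \<le> 1"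
proof -
  have "\<bar>logistic_d1 z\<bar> * \<bar>1 - 2 * logistic z\<bar> \<le> 1 * 1"
    using logistic_d1_bounds[of z] logistic_bounds[of z] by (intro mult_mono) auto
  then show ?thesis by (simp add: logistic_d2_def logistic_d1_def abs_mult)
qed

lemma logistic_d1_le_exp: "logistic_d1 z \<le> exp (- \<bar>z\<bar>)"
proof -
  have "logistic_d1 z \<le> logistic z" "logistic_d1 z \<le> logistic (- z)"
    using logistic_bounds[of z] unfolding logistic_d1_def logistic_minus[symmetric]
    by (auto simp: mult_le_cancel_left1 mult_le_cancel_right1)
  then show ?thesis using logistic_le_exp[of z] logistic_le_exp[of "- z"] by (cases "0 \<le> z") auto
qed

lemma logistic_cont: "continuous_on UNIV logistic" "continuous_on UNIV logistic_d1" "continuous_on UNIV logistic_d2"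
proof -
  show a: "continuous_on UNIV logistic" "continuous_on UNIV logistic_d1"
    using logistic_deriv by (auto simp: continuous_on_eq_continuous_at intro: DERIV_isCont)
  show "continuous_on UNIV logistic_d2"
    unfolding logistic_d2_def[abs_def] by (intro continuous_intros a)
qed

lemma C2b_logistic: "C2b logistic logistic_d1 logistic_d2"
  unfolding C2b_def
proof (intro conjI allI logistic_deriv logistic_cont exI[of _ 1])
  show "\<bar>logistic x\<bar> \<le> 1" for x using logistic_bounds[of x] by simp
  show "\<bar>logistic_d1 x\<bar> \<le> 1" for x using logistic_d1_bounds[of x] by simp
qed (rule logistic_d2_abs_le)

text \<open>A smoothed indicator of \<open>y \<le> x\<close>, where \<open>y\<close> is the position
  of a particle. The companions are derivatives in \<open>x\<close>; in \<open>y\<close> the first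
  changes sign and the second does not, so the Laplacian acting on the particles becomes a second
  derivative in \<open>x\<close>.\<close>

definition smooth_step :: "real \<Rightarrow> real \<Rightarrow> real \<Rightarrow> real" where "smooth_step k x y = logistic ((x - y) / k)"
definition smooth_step_d1 :: "real \<Rightarrow> real \<Rightarrow> real \<Rightarrow> real" where "smooth_step_d1 k x y = logistic_d1 ((x - y) / k) / k"
definition smooth_step_d2 :: "real \<Rightarrow> real \<Rightarrow> real \<Rightarrow> real" where "smooth_step_d2 k x y = logistic_d2 ((x - y) / k) / k ^ 2"

lemma C2b_smooth_step:
  assumes "0 < k"
  shows "C2b (smooth_step k x) (\<lambda>y. - smooth_step_d1 k x y) (smooth_step_d2 k x)"
proof -
  have "- 1 / k * y + x / k = (x - y) / k" for y by (simp add: diff_divide_distrib)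
  then show ?thesis
    using C2b_affine[OF C2b_logistic, of "- 1 / k" "x / k"]
    by (simp add: smooth_step_def[abs_def] smooth_step_d1_def smooth_step_d2_def[abs_def] power_divide)
qed

lemma smooth_step_bounds: "0 < smooth_step k x y" "smooth_step k x y < 1"
  by (simp_all add: smooth_step_def logistic_bounds)

lemma smooth_step_d1_bound: "0 < k \<Longrightarrow> \<bar>smooth_step_d1 k x y\<bar> \<le> 1 / k"
  using logistic_d1_bounds[of "(x - y) / k"] by (simp add: smooth_step_d1_def divide_right_mono)

lemma smooth_step_d2_bound: "0 < k \<Longrightarrow> \<bar>smooth_step_d2 k x y\<bar> \<le> 1 / k ^ 2"
  using logistic_d2_abs_le[of "(x - y) / k"] by (simp add: smooth_step_d2_def divide_right_mono)

lemma smooth_step_dx: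
  assumes "0 < k"
  shows "((\<lambda>x. smooth_step k x y) has_real_derivative smooth_step_d1 k x y) (at x)"
    "((\<lambda>x. smooth_step_d1 k x y) has_real_derivative smooth_step_d2 k x y) (at x)"
proof -
  have l: "((\<lambda>x. (x - y) / k) has_real_derivative 1 / k) (at x)" for x
    by (intro DERIV_cdivide) (auto intro!: derivative_eq_intros)
  show "((\<lambda>x. smooth_step k x y) has_real_derivative smooth_step_d1 k x y) (at x)"
    using DERIV_chain2[OF logistic_deriv(1) l] by (simp add: smooth_step_def smooth_step_d1_def)
  show "((\<lambda>x. smooth_step_d1 k x y) has_real_derivative smooth_step_d2 k x y) (at x)"
    using DERIV_cdivide[OF DERIV_chain2[OF logistic_deriv(2) l], of k] by (simp add: smooth_step_d1_def smooth_step_d2_def power2_eq_square)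
qed

lemma emp_mean_dx:
  assumes "\<And>i. ((\<lambda>x. f x (z i)) has_real_derivative f' (z i)) (at x)"
  shows "((\<lambda>x. emp_mean N (f x) z) has_real_derivative emp_mean N f' z) (at x)"
  unfolding emp_mean_def by (intro DERIV_cdivide DERIV_sum assms)

lemma smooth_step_antimono: "0 < k \<Longrightarrow> y \<le> z \<Longrightarrow> smooth_step k x z \<le> smooth_step k x y"
  unfolding smooth_step_def by (intro logistic_mono divide_right_mono) auto

lemma smooth_step_max: "0 < k \<Longrightarrow> smooth_step k x (max y z) = min (smooth_step k x y) (smooth_step k x z)"
  using smooth_step_antimono[of k y z x] smooth_step_antimono[of k z y x] by (cases "y \<le> z") (auto simp: max_def min_def)

text \<open>The commutator between smoothing and the quadratic reaction term is controlled by the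
  fraction of particles in a window of width \<open>k\<close> around \<open>x\<close>.\<close>

lemma jump_emp_mean_smooth_step:
  fixes x k :: real and z :: "nat \<Rightarrow> real"
  assumes N: "2 \<le> N" and k: "0 < k"
  defines "F \<equiv> emp_mean N (smooth_step k x) z" and "P \<equiv> emp_mean N (\<lambda>y. smooth_step k x y * (1 - smooth_step k x y)) z"
  shows "\<bar>jump N (emp_mean N (smooth_step k x)) z - (F ^ 2 - F)\<bar> \<le> 2 * P + 1 / (real N - 1)"
proof -
  let ?p = "\<lambda>i. smooth_step k x (z i)"
  let ?n = "real N"
  define Q where "Q = (\<Sum>i<N. \<Sum>j<N. min (?p i) (?p j))"
  define t where "t = (\<Sum>i<N. ?p i)"
  have n: "0 < ?n" "1 < ?n" using N by auto
  have F: "F = t / ?n" by (simp add: F_def emp_mean_def t_def)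
  have "jump N (emp_mean N (smooth_step k x)) z = 1 / (2 * (?n - 1)) * (\<Sum>i<N. \<Sum>j\<in>{..<N} - {i}. (2 * min (?p i) (?p j) - ?p i - ?p j) / ?n)"
    unfolding jump_def
    by (intro arg_cong[where f = "\<lambda>s. 1 / (2 * (?n - 1)) * s"] sum.cong refl) (auto simp: emp_mean_theta smooth_step_max[OF k])
  \<comment> \<open>The diagonal may be added, since its summands \<open>2 * min p p - p - p\<close>
    vanish.\<close>
  also have "(\<Sum>i<N. \<Sum>j\<in>{..<N} - {i}. (2 * min (?p i) (?p j) - ?p i - ?p j) / ?n) = (\<Sum>i<N. \<Sum>j<N. (2 * min (?p i) (?p j) - ?p i - ?p j) / ?n)"
    by (intro sum.cong refl sum.mono_neutral_left) auto
  also have "\<dots> = (2 * Q - 2 * (?n * t)) / ?n"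
  proof -
    have "(\<Sum>i<N. \<Sum>j<N. 2 * min (?p i) (?p j) - ?p i - ?p j) = 2 * Q - ?n * t - ?n * t"
      unfolding Q_def t_def
      by (simp add: sum_subtractf sum_distrib_left)
    then show ?thesis by (simp add: sum_divide_distrib[symmetric])
  qed
  also have "1 / (2 * (?n - 1)) * ((2 * Q - 2 * (?n * t)) / ?n) = (Q - ?n * t) / ?n ^ 2 * (?n / (?n - 1))"
    using n by (simp add: field_simps power2_eq_square)
  finally have J: "jump N (emp_mean N (smooth_step k x)) z = (Q / ?n ^ 2 - F) * (?n / (?n - 1))"
    using n by (simp add: F diff_divide_distrib power2_eq_square)
  have Q0: "0 \<le> Q" unfolding Q_def using smooth_step_bounds by (intro sum_nonneg) (auto simp: less_imp_le)
  have Qt: "Q \<le> ?n * t"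
  proof -
    have "Q \<le> (\<Sum>i<N. \<Sum>j<N. ?p j)" unfolding Q_def by (intro sum_mono) auto
    then show ?thesis by (simp add: t_def)
  qed
  have t1: "0 \<le> t" "t \<le> ?n"
  proof -
    show "0 \<le> t" unfolding t_def using smooth_step_bounds by (intro sum_nonneg) (auto simp: less_imp_le)
    have "t \<le> (\<Sum>i<N. 1)" unfolding t_def using smooth_step_bounds by (intro sum_mono) (auto simp: less_imp_le)
    then show "t \<le> ?n" by simp
  qed
  \<comment> \<open>For values 0 and 1 the minimum is the product. In general, if
    \<open>a \<le> b\<close>, the defect is \<open>a - a * b = a * (1 - b)\<close>, which is at most
    \<open>a * (1 - a)\<close>; summing gives the window functional.\<close>
  have V: "0 \<le> Q - t ^ 2" "Q - t ^ 2 \<le> ?n * (\<Sum>i<N. ?p i * (1 - ?p i)) + ?n * (\<Sum>i<N. ?p i * (1 - ?p i))"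
  proof -
    have e: "Q - t ^ 2 = (\<Sum>i<N. \<Sum>j<N. min (?p i) (?p j) - ?p i * ?p j)"
      by (simp add: Q_def t_def power2_eq_square sum_product sum_subtractf)
    have b: "0 \<le> min a b - a * b \<and> min a b - a * b \<le> a * (1 - a) + b * (1 - b)" if "0 < a" "a < 1" "0 < b" "b < 1" for a b :: real
    proof -
      have m: "a * b \<le> a" "a * b \<le> b" "0 \<le> a * (1 - a)" "0 \<le> b * (1 - b)" using that by (auto simp: mult_le_cancel_left1 mult_le_cancel_right1)
      have "a - a * b \<le> a * (1 - a)" if "b \<ge> a" using that \<open>0 < a\<close> mult_left_mono[of a b a] by (simp add: algebra_simps)
      moreover have "b - a * b \<le> b * (1 - b)" if "a \<ge> b" using that \<open>0 < b\<close> mult_left_mono[of b a b] by (simp add: algebra_simps)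
      ultimately show ?thesis using m by (cases "a \<le> b") (auto simp: min_def)
    qed
    show "0 \<le> Q - t ^ 2" unfolding e by (intro sum_nonneg b[THEN conjunct1] smooth_step_bounds)
    have "Q - t ^ 2 \<le> (\<Sum>i<N. \<Sum>j<N. ?p i * (1 - ?p i) + ?p j * (1 - ?p j))"
      unfolding e by (intro sum_mono b[THEN conjunct2] smooth_step_bounds)
    then show "Q - t ^ 2 \<le> ?n * (\<Sum>i<N. ?p i * (1 - ?p i)) + ?n * (\<Sum>i<N. ?p i * (1 - ?p i))"
      by (simp add: sum.distrib sum_distrib_left)
  qed
  have VP: "0 \<le> Q / ?n ^ 2 - F ^ 2" "Q / ?n ^ 2 - F ^ 2 \<le> 2 * P"
  proof -
    have e: "Q / ?n ^ 2 - F ^ 2 = (Q - t ^ 2) / ?n ^ 2" by (simp add: F power_divide diff_divide_distrib)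
    show "0 \<le> Q / ?n ^ 2 - F ^ 2" unfolding e using V(1) by simp
    have "(Q - t ^ 2) / ?n ^ 2 \<le> (?n * (\<Sum>i<N. ?p i * (1 - ?p i)) + ?n * (\<Sum>i<N. ?p i * (1 - ?p i))) / ?n ^ 2"
      by (intro divide_right_mono V) auto
    also have "\<dots> = 2 * P" using n by (simp add: P_def emp_mean_def power2_eq_square)
    finally show "Q / ?n ^ 2 - F ^ 2 \<le> 2 * P" unfolding e .
  qed
  define R where "R = Q / ?n ^ 2 - F"
  have R: "R \<le> 0" "- 1 \<le> R"
  proof -
    have "Q / ?n ^ 2 \<le> ?n * t / ?n ^ 2" by (intro divide_right_mono Qt) auto
    then show "R \<le> 0" using n by (simp add: R_def F power2_eq_square)
    have "F \<le> 1" using t1 n by (simp add: F)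
    moreover have "0 \<le> Q / ?n ^ 2" using Q0 by simp
    ultimately show "- 1 \<le> R" by (simp add: R_def)
  qed
  \<comment> \<open>Partners are chosen among \<open>N - 1\<close> particles, whereas the quadratic
    term averages over all \<open>N ^ 2\<close> pairs. As \<open>R\<close> lies between -1 and 0,
    exchanging the normalisations costs at most \<open>1 / (N - 1)\<close>.\<close>
  have "R * (?n / (?n - 1)) = R + R * (1 / (?n - 1))"
    using n by (simp add: field_simps)
  moreover have "\<bar>R * (1 / (?n - 1))\<bar> \<le> 1 / (?n - 1)"
  proof -
    have "\<bar>R\<bar> * (1 / (?n - 1)) \<le> 1 * (1 / (?n - 1))" using R n by (intro mult_right_mono) auto
    then show ?thesis using n by (simp add: abs_mult)
  qed
  ultimately have "\<bar>jump N (emp_mean N (smooth_step k x)) z - R\<bar> \<le> 1 / (?n - 1)" unfolding J R_def[symmetric] by simp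
  then show ?thesis using VP unfolding R_def by linarith
qed

text \<open>Expanding the square leaves, beside the chain rule term, the squared increment of one
  jump. It is at most \<open>1 / N ^ 2\<close>, and the \<open>N * (N - 1)\<close> pairs with their
  rates add up to \<open>1 / (2 * N)\<close>.\<close>

lemma jump_square:
  assumes N: "2 \<le> N" and k: "0 < k"
  shows "jump N (\<lambda>z. emp_mean N (smooth_step k x) z ^ 2) z \<le> 2 * emp_mean N (smooth_step k x) z * jump N (emp_mean N (smooth_step k x)) z + 1 / (2 * real N)"
proof -
  let ?F = "emp_mean N (smooth_step k x)"
  let ?d = "\<lambda>i j. ?F (theta i j z) - ?F z"
  have n: "0 < real N" "1 < real N" using N by auto
  have dd: "?d i j ^ 2 \<le> 1 / real N ^ 2" if "i < N" "j < N" "i \<noteq> j" for i j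
  proof -
    have "\<bar>2 * smooth_step k x (max (z i) (z j)) - smooth_step k x (z i) - smooth_step k x (z j)\<bar> \<le> 1"
      using smooth_step_bounds[of k x "z i"] smooth_step_bounds[of k x "z j"] unfolding smooth_step_max[OF k] by (auto simp: min_def)
    then have "(2 * smooth_step k x (max (z i) (z j)) - smooth_step k x (z i) - smooth_step k x (z j)) ^ 2 \<le> 1"
      by (simp add: abs_square_le_1)
    then show ?thesis unfolding emp_mean_theta[OF that] power_divide by (intro divide_right_mono) auto
  qed
  have "jump N (\<lambda>z. ?F z ^ 2) z \<le> 1 / (2 * (real N - 1)) * (\<Sum>i<N. \<Sum>j\<in>{..<N} - {i}. 2 * ?F z * ?d i j + 1 / real N ^ 2)"
  proof (rule jump_le[OF N])
    fix i j assume ij: "i < N" "j < N" "i \<noteq> j"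
    have "?F (theta i j z) ^ 2 - ?F z ^ 2 = 2 * ?F z * ?d i j + ?d i j ^ 2"
      by (simp add: power2_eq_square algebra_simps)
    then show "?F (theta i j z) ^ 2 - ?F z ^ 2 \<le> 2 * ?F z * ?d i j + 1 / real N ^ 2"
      using dd[OF ij] by linarith
  qed
  also have "\<dots> = 2 * ?F z * jump N ?F z + 1 / (2 * (real N - 1)) * (real N * (real N - 1) * (1 / real N ^ 2))"
  proof -
    have "(\<Sum>i<N. \<Sum>j\<in>{..<N} - {i}. 2 * ?F z * ?d i j + c)
      = 2 * ?F z * (\<Sum>i<N. \<Sum>j\<in>{..<N} - {i}. ?d i j) + real N * (real N - 1) * c" for c
      unfolding sum_distrib_left using N by (simp add: sum.distrib of_nat_diff)
    then show ?thesis unfolding jump_def by (simp only: distrib_left mult.left_commute)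
  qed
  also have "1 / (2 * (real N - 1)) * (real N * (real N - 1) * (1 / real N ^ 2)) = 1 / (2 * real N)"
    using n by (simp add: power2_eq_square field_simps)
  finally show ?thesis .
qed

text \<open>If the distance of \<open>x\<close> and \<open>y\<close> is at most
  \<open>1 / (n * l)\<close>, all phases are at most 1, every cosine is at least
  \<open>cos 1 \<ge> 1 / 2\<close>, and the squared average reaches \<open>1 / 4\<close>, the
  maximum of \<open>p * (1 - p)\<close>. At larger distances the exponential tail of the logistic
  function takes over.\<close>

lemma logistic_d1_le_cos_square:
  assumes k: "0 < k" and l: "0 < l" and n: "0 < n"
  shows "smooth_step k x y * (1 - smooth_step k x y) \<le> ((\<Sum>i=1..n. cos (real i * l * (x - y))) / real n) ^ 2 + exp (- (1 / (real n * l * k)))"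
proof (cases "real n * l * \<bar>x - y\<bar> \<le> 1")
  case True
  have cos1: "1 / 2 \<le> cos (1::real)"
  proof -
    have "1 \<le> pi / 3" using pi_gt3 by simp
    then have "cos (pi / 3) \<le> cos 1" by (intro cos_monotone_0_pi_le) auto
    then show ?thesis by (simp add: cos_60)
  qed
  have "1 / 2 \<le> cos (real i * l * (x - y))" if "i \<in> {1..n}" for i
  proof -
    have "\<bar>real i * l * (x - y)\<bar> = real i * l * \<bar>x - y\<bar>" using l by (simp add: abs_mult)
    also have "\<dots> \<le> real n * l * \<bar>x - y\<bar>" using that l by (intro mult_right_mono) auto
    finally have a: "\<bar>real i * l * (x - y)\<bar> \<le> 1" using True by simp
    then have "cos 1 \<le> cos \<bar>real i * l * (x - y)\<bar>"
      using pi_gt3 by (intro cos_monotone_0_pi_le) auto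
    then show ?thesis using cos1 by (simp add: abs_if split: if_splits)
  qed
  then have "(\<Sum>i=1..n. 1 / 2) \<le> (\<Sum>i=1..n. cos (real i * l * (x - y)))" by (intro sum_mono) auto
  then have "1 / 2 \<le> (\<Sum>i=1..n. cos (real i * l * (x - y))) / real n"
    using n by (simp add: field_simps)
  moreover have quarter: "(1 / 2) ^ 2 = (1 / 4 :: real)" by (simp add: power2_eq_square)
  ultimately have "(1 / 2) ^ 2 \<le> ((\<Sum>i=1..n. cos (real i * l * (x - y))) / real n) ^ 2"
    by (intro power_mono) auto
  then show ?thesis
    using logistic_d1_bounds(2)[of "(x - y) / k", unfolded logistic_d1_def, folded smooth_step_def]
      exp_ge_zero[of "- (1 / (real n * l * k))"]
      quarter by linarith
next
  case False
  have "1 / (real n * l * k) \<le> \<bar>(x - y) / k\<bar>"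
    using False k l n by (simp add: abs_divide field_simps)
  then have "exp (- \<bar>(x - y) / k\<bar>) \<le> exp (- (1 / (real n * l * k)))" by simp
  then have "smooth_step k x y * (1 - smooth_step k x y) \<le> exp (- (1 / (real n * l * k)))"
    using logistic_d1_le_exp[of "(x - y) / k"] unfolding smooth_step_def logistic_d1_def by linarith
  then show ?thesis by (simp add: add_increasing)
qed

lemma continuous_on_lipschitz2:
  fixes g :: "real \<Rightarrow> real \<Rightarrow> real"
  assumes "\<And>t s x y. 0 \<le> t \<Longrightarrow> 0 \<le> s \<Longrightarrow> \<bar>g t x - g s y\<bar> \<le> A * \<bar>t - s\<bar> + B * \<bar>x - y\<bar>"
  shows "continuous_on ({0..} \<times> UNIV) (\<lambda>(t, x). g t x)"
  unfolding continuous_on_def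
proof
  fix p :: "real \<times> real" assume p: "p \<in> {0..} \<times> UNIV"
  let ?F = "at p within {0..} \<times> UNIV"
  have "((\<lambda>q. \<bar>(\<lambda>(t, x). g t x) q - (\<lambda>(t, x). g t x) p\<bar>) \<longlongrightarrow> 0) ?F"
  proof (rule tendsto_sandwich[OF _ _ tendsto_const])
    show "\<forall>\<^sub>F q in ?F. \<bar>(\<lambda>(t, x). g t x) q - (\<lambda>(t, x). g t x) p\<bar> \<le> A * \<bar>fst q - fst p\<bar> + B * \<bar>snd q - snd p\<bar>"
      unfolding eventually_at_filter
      by (rule always_eventually) (use p in \<open>auto simp: split_beta intro!: assms\<close>)
    have "((\<lambda>q. A * \<bar>fst q - fst p\<bar> + B * \<bar>snd q - snd p\<bar>) \<longlongrightarrow> A * \<bar>fst p - fst p\<bar> + B * \<bar>snd p - snd p\<bar>) ?F"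
      by (intro tendsto_intros)
    then show "((\<lambda>q. A * \<bar>fst q - fst p\<bar> + B * \<bar>snd q - snd p\<bar>) \<longlongrightarrow> 0) ?F" by simp
  qed auto
  then show "((\<lambda>(t, x). g t x) \<longlongrightarrow> (\<lambda>(t, x). g t x) p) ?F"
    by (simp add: tendsto_rabs_zero_iff LIM_zero_cancel)
qed

lemma bdd_cyl_emp_mean_smooth_step:
  assumes "0 < k"
  shows "bdd_cyl N (emp_mean N (smooth_step k x))" "bdd_cyl N (emp_mean N (smooth_step_d1 k x))" "bdd_cyl N (emp_mean N (smooth_step_d2 k x))"
    "bdd_cyl N (emp_mean N (\<lambda>y. (- smooth_step_d1 k x y) ^ 2))" "bdd_cyl N (emp_mean N (\<lambda>y. smooth_step k x y * (1 - smooth_step k x y)))"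
proof -
  note C = C2bD[OF C2b_smooth_step[OF assms, of x]]
  have c1: "continuous_on UNIV (smooth_step_d1 k x)" "bounded (range (smooth_step_d1 k x))"
  proof -
    show "continuous_on UNIV (smooth_step_d1 k x)" using continuous_on_minus[OF C(4)] by simp
    show "bounded (range (smooth_step_d1 k x))" unfolding bounded_iff using smooth_step_d1_bound[OF assms, of x] by auto
  qed
  show "bdd_cyl N (emp_mean N (smooth_step k x))" "bdd_cyl N (emp_mean N (smooth_step_d1 k x))" "bdd_cyl N (emp_mean N (smooth_step_d2 k x))"
    by (intro bdd_cyl_emp_mean C c1)+
  show "bdd_cyl N (emp_mean N (\<lambda>y. (- smooth_step_d1 k x y) ^ 2))"
  proof (intro bdd_cyl_emp_mean continuous_intros c1)
    have "\<bar>smooth_step_d1 k x y\<bar> ^ 2 \<le> (1 / k) ^ 2" for y using smooth_step_d1_bound[OF assms] by (intro power_mono) auto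
    then show "bounded (range (\<lambda>y. (- smooth_step_d1 k x y) ^ 2))" unfolding bounded_iff by auto
  qed
  show "bdd_cyl N (emp_mean N (\<lambda>y. smooth_step k x y * (1 - smooth_step k x y)))"
  proof (intro bdd_cyl_emp_mean continuous_intros C)
    have "\<bar>smooth_step k x y * (1 - smooth_step k x y)\<bar> \<le> 1 * 1" for y
      unfolding abs_mult using smooth_step_bounds[of k x y] by (intro mult_mono) auto
    then show "bounded (range (\<lambda>y. smooth_step k x y * (1 - smooth_step k x y)))" unfolding bounded_iff by auto
  qed
qed

lemma emp_mean_smooth_step_bounds:
  assumes "0 < N" shows "0 \<le> emp_mean N (smooth_step k x) z" "emp_mean N (smooth_step k x) z \<le> 1"
proof -
  have "emp_mean N (\<lambda>_. 0) z \<le> emp_mean N (smooth_step k x) z" "emp_mean N (smooth_step k x) z \<le> emp_mean N (\<lambda>_. 1) z"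
    using smooth_step_bounds by (intro emp_mean_mono; simp add: less_imp_le)+
  then show "0 \<le> emp_mean N (smooth_step k x) z" "emp_mean N (smooth_step k x) z \<le> 1" using assms by (simp_all add: emp_mean_const)
qed

context particle_system
begin

lemma N0: "0 < N" using N2 by simp

lemma expectation_deriv:
  fixes f f' :: "real \<Rightarrow> 'a \<Rightarrow> real"
  assumes int: "\<And>x. integrable M (f x)"
    and der: "\<And>x \<omega>. ((\<lambda>x. f x \<omega>) has_real_derivative f' x \<omega>) (at x)"
    and bnd: "\<And>x \<omega>. \<bar>f' x \<omega>\<bar> \<le> B" and meas: "f' x0 \<in> borel_measurable M"
  shows "((\<lambda>x. expectation (f x)) has_real_derivative expectation (f' x0)) (at x0)"
  unfolding has_field_derivative_iff tendsto_at_iff_sequentially o_def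
proof (intro allI impI)
  fix Z assume Z: "\<forall>n. Z n \<in> UNIV - {x0}" "Z \<longlonglongrightarrow> x0"
  let ?q = "\<lambda>n \<omega>. (f (Z n) \<omega> - f x0 \<omega>) / (Z n - x0)"
  have "(\<lambda>n. expectation (?q n)) \<longlonglongrightarrow> expectation (f' x0)"
  proof (rule integral_dominated_convergence[where w = "\<lambda>_. B"])
    show "AE \<omega> in M. (\<lambda>n. ?q n \<omega>) \<longlonglongrightarrow> f' x0 \<omega>"
    proof (rule AE_I2)
      fix \<omega>
      from der[of \<omega> x0] show "(\<lambda>n. ?q n \<omega>) \<longlonglongrightarrow> f' x0 \<omega>"
        unfolding has_field_derivative_iff tendsto_at_iff_sequentially o_def using Z by blast
    qed
    show "AE \<omega> in M. norm (?q n \<omega>) \<le> B" for n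
    proof (rule AE_I2)
      fix \<omega>
      have "norm (f (Z n) \<omega> - f x0 \<omega>) \<le> B * norm (Z n - x0)"
        by (rule field_differentiable_bound[where S = UNIV and f' = "\<lambda>x. f' x \<omega>"]) (use der bnd in auto)
      moreover have "Z n \<noteq> x0" using Z by auto
      ultimately show "norm (?q n \<omega>) \<le> B" by (simp add: abs_divide divide_le_eq)
    qed
    show "?q n \<in> borel_measurable M" for n
      using borel_measurable_integrable[OF int] by measurable
  qed (use meas in auto)
  moreover have "(\<lambda>n. expectation (?q n)) = (\<lambda>n. (expectation (f (Z n)) - expectation (f x0)) / (Z n - x0))"
    by (simp add: Bochner_Integration.integral_diff[OF int int])
  ultimately show "(\<lambda>n. (expectation (f (Z n)) - expectation (f x0)) / (Z n - x0)) \<longlonglongrightarrow> expectation (f' x0)"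
    by (simp only:)
qed

section \<open>First and second moments of the smoothed distribution function\<close>

definition step_mean :: "real \<Rightarrow> real \<Rightarrow> real \<Rightarrow> real" where
  "step_mean k t x = expectation (\<lambda>\<omega>. emp_mean N (smooth_step k x) (X t \<omega>))"

definition step_sq_mean :: "real \<Rightarrow> real \<Rightarrow> real \<Rightarrow> real" where
  "step_sq_mean k t x = expectation (\<lambda>\<omega>. emp_mean N (smooth_step k x) (X t \<omega>) ^ 2)"

lemma bdd_cyl_power2: "bdd_cyl N f \<Longrightarrow> bdd_cyl N (\<lambda>z. f z ^ 2)"
  unfolding power2_eq_square by (rule bdd_cyl_mult)

lemma m_left:
  assumes "0 < k" "0 < t"
  shows "step_mean k t x = expectation (\<lambda>\<omega>. emp_mean N (smooth_step k x) (Y t \<omega>))"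
    "step_sq_mean k t x = expectation (\<lambda>\<omega>. emp_mean N (smooth_step k x) (Y t \<omega>) ^ 2)"
  unfolding step_mean_def step_sq_mean_def
  using dyn_left_eq[OF dyn_emp_mean[OF C2b_smooth_step[OF assms(1)]] assms(2)]
    dyn_left_eq[OF dyn_emp_mean_square[OF C2b_smooth_step[OF assms(1)]] assms(2)] by simp_all

text \<open>The moments are defined through \<open>X t\<close>, but their space derivatives are
  written at the left limit \<open>Y t\<close>, where the left time derivative lives. The
  differential inequality can then be proved pointwise under a single expectation.\<close>

lemma m_dx:
  assumes k: "0 < k" and t: "0 < t"
  shows "(step_mean k t has_real_derivative expectation (\<lambda>\<omega>. emp_mean N (smooth_step_d1 k x) (Y t \<omega>))) (at x)"
    "((\<lambda>x. expectation (\<lambda>\<omega>. emp_mean N (smooth_step_d1 k x) (Y t \<omega>))) has_real_derivative expectation (\<lambda>\<omega>. emp_mean N (smooth_step_d2 k x) (Y t \<omega>))) (at x)"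
    "(step_sq_mean k t has_real_derivative expectation (\<lambda>\<omega>. 2 * emp_mean N (smooth_step k x) (Y t \<omega>) * emp_mean N (smooth_step_d1 k x) (Y t \<omega>))) (at x)"
    "((\<lambda>x. expectation (\<lambda>\<omega>. 2 * emp_mean N (smooth_step k x) (Y t \<omega>) * emp_mean N (smooth_step_d1 k x) (Y t \<omega>))) has_real_derivative
      expectation (\<lambda>\<omega>. 2 * emp_mean N (smooth_step_d1 k x) (Y t \<omega>) ^ 2 + 2 * emp_mean N (smooth_step k x) (Y t \<omega>) * emp_mean N (smooth_step_d2 k x) (Y t \<omega>))) (at x)"
proof -
  note bdd_cyl = bdd_cyl_emp_mean_smooth_step[OF k]
  have d1: "((\<lambda>x. emp_mean N (smooth_step k x) z) has_real_derivative emp_mean N (smooth_step_d1 k v) z) (at v)" for v z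
    by (rule emp_mean_dx) (rule smooth_step_dx[OF k])
  have d2: "((\<lambda>x. emp_mean N (smooth_step_d1 k x) z) has_real_derivative emp_mean N (smooth_step_d2 k v) z) (at v)" for v z
    by (rule emp_mean_dx) (rule smooth_step_dx[OF k])
  have b0: "\<bar>emp_mean N (smooth_step k x) z\<bar> \<le> 1" for x z using emp_mean_smooth_step_bounds[OF N0, of k x z] by simp
  have b1: "\<bar>emp_mean N (smooth_step_d1 k x) z\<bar> \<le> 1 / k" for x z by (rule emp_mean_abs_le[OF N0]) (rule smooth_step_d1_bound[OF k])
  have b2: "\<bar>emp_mean N (smooth_step_d2 k x) z\<bar> \<le> 1 / k ^ 2" for x z by (rule emp_mean_abs_le[OF N0]) (rule smooth_step_d2_bound[OF k])
  have mm: "\<bar>a * b\<bar> \<le> A * B" if "\<bar>a\<bar> \<le> A" "\<bar>b\<bar> \<le> B" for a b A B :: real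
    unfolding abs_mult using that by (intro mult_mono) auto
  show "(step_mean k t has_real_derivative expectation (\<lambda>\<omega>. emp_mean N (smooth_step_d1 k x) (Y t \<omega>))) (at x)"
    unfolding m_left(1)[OF k t, abs_def]
    by (rule expectation_deriv[OF _ d1 b1]) (intro bdd_cyl_Y_integrable bdd_cyl_Y_measurable bdd_cyl t)+
  show "((\<lambda>x. expectation (\<lambda>\<omega>. emp_mean N (smooth_step_d1 k x) (Y t \<omega>))) has_real_derivative expectation (\<lambda>\<omega>. emp_mean N (smooth_step_d2 k x) (Y t \<omega>))) (at x)"
    by (rule expectation_deriv[OF _ d2 b2]) (intro bdd_cyl_Y_integrable bdd_cyl_Y_measurable bdd_cyl t)+
  have c2: "bdd_cyl N (\<lambda>z. 2 * emp_mean N (smooth_step k x) z * emp_mean N (smooth_step_d1 k x) z)" for x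
    by (intro bdd_cyl_mult bdd_cyl_cmult bdd_cyl)
  show "(step_sq_mean k t has_real_derivative expectation (\<lambda>\<omega>. 2 * emp_mean N (smooth_step k x) (Y t \<omega>) * emp_mean N (smooth_step_d1 k x) (Y t \<omega>))) (at x)"
    unfolding m_left(2)[OF k t, abs_def]
  proof (rule expectation_deriv[where B = "2 * 1 * (1 / k)"])
    show "((\<lambda>x. emp_mean N (smooth_step k x) (Y t \<omega>) ^ 2) has_real_derivative 2 * emp_mean N (smooth_step k x) (Y t \<omega>) * emp_mean N (smooth_step_d1 k x) (Y t \<omega>)) (at x)" for x \<omega>
      using DERIV_power[OF d1, where n = 2] by (simp add: mult_ac)
    show "\<bar>2 * emp_mean N (smooth_step k x) (Y t \<omega>) * emp_mean N (smooth_step_d1 k x) (Y t \<omega>)\<bar> \<le> 2 * 1 * (1 / k)" for x \<omega>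
      by (intro mm b0 b1) auto
    show "integrable M (\<lambda>\<omega>. emp_mean N (smooth_step k x) (Y t \<omega>) ^ 2)" for x
      by (rule bdd_cyl_Y_integrable[OF bdd_cyl_power2[OF bdd_cyl(1)] t])
    show "(\<lambda>\<omega>. 2 * emp_mean N (smooth_step k x) (Y t \<omega>) * emp_mean N (smooth_step_d1 k x) (Y t \<omega>)) \<in> borel_measurable M"
      by (rule bdd_cyl_Y_measurable[OF c2 t])
  qed
  show "((\<lambda>x. expectation (\<lambda>\<omega>. 2 * emp_mean N (smooth_step k x) (Y t \<omega>) * emp_mean N (smooth_step_d1 k x) (Y t \<omega>))) has_real_derivative
      expectation (\<lambda>\<omega>. 2 * emp_mean N (smooth_step_d1 k x) (Y t \<omega>) ^ 2 + 2 * emp_mean N (smooth_step k x) (Y t \<omega>) * emp_mean N (smooth_step_d2 k x) (Y t \<omega>))) (at x)"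
  proof (rule expectation_deriv[where B = "2 * (1 / k * (1 / k)) + 2 * 1 * (1 / k ^ 2)"])
    show "((\<lambda>x. 2 * emp_mean N (smooth_step k x) (Y t \<omega>) * emp_mean N (smooth_step_d1 k x) (Y t \<omega>)) has_real_derivative
        2 * emp_mean N (smooth_step_d1 k x) (Y t \<omega>) ^ 2 + 2 * emp_mean N (smooth_step k x) (Y t \<omega>) * emp_mean N (smooth_step_d2 k x) (Y t \<omega>)) (at x)" for x \<omega>
      using DERIV_mult[OF DERIV_cmult[OF d1, where c = 2] d2] by (simp add: power2_eq_square mult_ac)
    show "\<bar>2 * emp_mean N (smooth_step_d1 k x) (Y t \<omega>) ^ 2 + 2 * emp_mean N (smooth_step k x) (Y t \<omega>) * emp_mean N (smooth_step_d2 k x) (Y t \<omega>)\<bar> \<le> 2 * (1 / k * (1 / k)) + 2 * 1 * (1 / k ^ 2)" for x \<omega>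
      unfolding power2_eq_square[of "emp_mean N _ _"]
      by (rule order_trans[OF abs_triangle_ineq add_mono]) (intro mm b0 b1 b2; simp)+
    show "integrable M (\<lambda>\<omega>. 2 * emp_mean N (smooth_step k x) (Y t \<omega>) * emp_mean N (smooth_step_d1 k x) (Y t \<omega>))" for x
      by (rule bdd_cyl_Y_integrable[OF c2 t])
    have "bdd_cyl N (\<lambda>z. 2 * emp_mean N (smooth_step_d1 k x) z ^ 2 + 2 * emp_mean N (smooth_step k x) z * emp_mean N (smooth_step_d2 k x) z)"
      by (intro bdd_cyl_add bdd_cyl_mult bdd_cyl_cmult bdd_cyl_power2 bdd_cyl)
    then show "(\<lambda>\<omega>. 2 * emp_mean N (smooth_step_d1 k x) (Y t \<omega>) ^ 2 + 2 * emp_mean N (smooth_step k x) (Y t \<omega>) * emp_mean N (smooth_step_d2 k x) (Y t \<omega>)) \<in> borel_measurable M"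
      by (rule bdd_cyl_Y_measurable[OF _ t])
  qed
qed

text \<open>Only joint continuity and the limit at time 0 are drawn from this, for fixed
  \<open>N\<close> and \<open>k\<close>, so a constant that grows with \<open>N\<close> does no
  harm.\<close>

lemma m_lipschitz:
  assumes k: "0 < k"
  obtains A where "\<And>t s x y. 0 \<le> t \<Longrightarrow> 0 \<le> s \<Longrightarrow> \<bar>step_mean k t x - step_mean k s y\<bar> \<le> A * \<bar>t - s\<bar> + 2 / k * \<bar>x - y\<bar>"
    "\<And>t s x y. 0 \<le> t \<Longrightarrow> 0 \<le> s \<Longrightarrow> \<bar>step_sq_mean k t x - step_sq_mean k s y\<bar> \<le> A * \<bar>t - s\<bar> + 2 / k * \<bar>x - y\<bar>"
proof -
  have n1: "1 \<le> real N" using N2 by simp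
  have b0: "\<bar>emp_mean N (smooth_step k x) z\<bar> \<le> 1" for x z using emp_mean_smooth_step_bounds[OF N0, of k x z] by simp
  have b1: "\<bar>emp_mean N (\<lambda>y. (- smooth_step_d1 k x y) ^ 2) z\<bar> \<le> (1 / k) ^ 2" for x z
  proof (rule emp_mean_abs_le[OF N0])
    show "\<bar>(- smooth_step_d1 k x y) ^ 2\<bar> \<le> (1 / k) ^ 2" for y
      using power_mono[OF smooth_step_d1_bound[OF k, of x y] abs_ge_zero, of 2] by simp
  qed
  have b2: "\<bar>emp_mean N (smooth_step_d2 k x) z\<bar> \<le> 1 / k ^ 2" for x z by (rule emp_mean_abs_le[OF N0]) (rule smooth_step_d2_bound[OF k])
  define A where "A = 2 / k ^ 2 + real N"
  have A1: "\<bar>1/2 * emp_mean N (smooth_step_d2 k x) z + jump N (emp_mean N (smooth_step k x)) z\<bar> \<le> A" for x z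
  proof -
    have "\<bar>jump N (emp_mean N (smooth_step k x)) z\<bar> \<le> real N * 1" by (rule jump_bound[OF b0 N2])
    moreover have "0 \<le> 1 / k ^ 2" by simp
    moreover have "2 / k ^ 2 = 2 * (1 / k ^ 2)" by simp
    ultimately show ?thesis using b2[of x z] unfolding A_def by linarith
  qed
  have A2: "\<bar>1/2 * (2 * emp_mean N (smooth_step k x) z * emp_mean N (smooth_step_d2 k x) z + 2 / real N * emp_mean N (\<lambda>y. (- smooth_step_d1 k x y) ^ 2) z)
     + jump N (\<lambda>z. emp_mean N (smooth_step k x) z ^ 2) z\<bar> \<le> A" for x z
  proof -
    have "\<bar>emp_mean N (smooth_step k x) z ^ 2\<bar> \<le> 1" for z using power_le_one[of "\<bar>emp_mean N (smooth_step k x) z\<bar>" 2] b0 by simp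
    then have "\<bar>jump N (\<lambda>z. emp_mean N (smooth_step k x) z ^ 2) z\<bar> \<le> real N * 1" by (rule jump_bound[OF _ N2])
    moreover have "\<bar>emp_mean N (smooth_step k x) z * emp_mean N (smooth_step_d2 k x) z\<bar> \<le> 1 * (1 / k ^ 2)"
      unfolding abs_mult using b0 b2 by (intro mult_mono) auto
    moreover have "\<bar>1 / real N * emp_mean N (\<lambda>y. (- smooth_step_d1 k x y) ^ 2) z\<bar> \<le> 1 * (1 / k) ^ 2"
      unfolding abs_mult using b1 n1 by (intro mult_mono) auto
    moreover have "1/2 * (2 * emp_mean N (smooth_step k x) z * emp_mean N (smooth_step_d2 k x) z + 2 / real N * emp_mean N (\<lambda>y. (- smooth_step_d1 k x y) ^ 2) z)
      = emp_mean N (smooth_step k x) z * emp_mean N (smooth_step_d2 k x) z + 1 / real N * emp_mean N (\<lambda>y. (- smooth_step_d1 k x y) ^ 2) z" by simp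
    moreover have "2 / k ^ 2 = 1 / k ^ 2 + (1 / k) ^ 2" by (simp add: power_divide)
    ultimately show ?thesis unfolding A_def by linarith
  qed
  have sx: "\<bar>emp_mean N (smooth_step k x) z - emp_mean N (smooth_step k y) z\<bar> \<le> 1 / k * \<bar>x - y\<bar>" for x y z
  proof -
    have "norm (emp_mean N (smooth_step k x) z - emp_mean N (smooth_step k y) z) \<le> 1 / k * norm (x - y)"
    proof (rule field_differentiable_bound[where S = UNIV])
      show "((\<lambda>x. emp_mean N (smooth_step k x) z) has_real_derivative emp_mean N (smooth_step_d1 k x) z) (at x within UNIV)" for x
        by (rule emp_mean_dx) (rule smooth_step_dx[OF k])
      show "norm (emp_mean N (smooth_step_d1 k x) z) \<le> 1 / k" for x
        unfolding real_norm_def by (rule emp_mean_abs_le[OF N0]) (rule smooth_step_d1_bound[OF k])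
    qed auto
    then show ?thesis by simp
  qed
  have sx2: "\<bar>emp_mean N (smooth_step k x) z ^ 2 - emp_mean N (smooth_step k y) z ^ 2\<bar> \<le> 2 / k * \<bar>x - y\<bar>" for x y z
  proof -
    have "emp_mean N (smooth_step k x) z ^ 2 - emp_mean N (smooth_step k y) z ^ 2 = (emp_mean N (smooth_step k x) z + emp_mean N (smooth_step k y) z) * (emp_mean N (smooth_step k x) z - emp_mean N (smooth_step k y) z)"
      by (simp add: power2_eq_square algebra_simps)
    moreover have "\<bar>emp_mean N (smooth_step k x) z + emp_mean N (smooth_step k y) z\<bar> * \<bar>emp_mean N (smooth_step k x) z - emp_mean N (smooth_step k y) z\<bar> \<le> 2 * (1 / k * \<bar>x - y\<bar>)"
      using b0[of x z] b0[of y z] by (intro mult_mono sx) auto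
    ultimately show ?thesis by (simp add: abs_mult)
  qed
  have i1: "integrable M (\<lambda>\<omega>. emp_mean N (smooth_step k x) (X t \<omega>))" if "0 \<le> t" for x t
    by (intro bdd_cyl_X_integrable bdd_cyl_emp_mean_smooth_step k that)
  have i2: "integrable M (\<lambda>\<omega>. emp_mean N (smooth_step k x) (X t \<omega>) ^ 2)" if "0 \<le> t" for x t
    by (intro bdd_cyl_X_integrable bdd_cyl_power2 bdd_cyl_emp_mean_smooth_step k that)
  show thesis
  proof (rule that[of A])
    fix t s x y :: real assume t: "0 \<le> t" and s: "0 \<le> s"
    have "\<bar>step_mean k s x - step_mean k s y\<bar> \<le> 2 / k * \<bar>x - y\<bar>"
    proof -
      have "\<bar>step_mean k s x - step_mean k s y\<bar> \<le> 1 / k * \<bar>x - y\<bar>"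
        unfolding step_mean_def Bochner_Integration.integral_diff[OF i1[OF s] i1[OF s], symmetric]
        by (intro expectation_abs_bound Bochner_Integration.integrable_diff i1 s sx)
      also have "\<dots> \<le> 2 / k * \<bar>x - y\<bar>" using k by (intro mult_right_mono divide_right_mono) auto
      finally show ?thesis .
    qed
    moreover have "\<bar>step_mean k t x - step_mean k s x\<bar> \<le> A * \<bar>t - s\<bar>"
      unfolding step_mean_def by (rule dyn_lipschitz[OF dyn_emp_mean[OF C2b_smooth_step[OF k]] A1 s t])
    ultimately show "\<bar>step_mean k t x - step_mean k s y\<bar> \<le> A * \<bar>t - s\<bar> + 2 / k * \<bar>x - y\<bar>" by linarith
    have "\<bar>step_sq_mean k s x - step_sq_mean k s y\<bar> \<le> 2 / k * \<bar>x - y\<bar>"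
      unfolding step_sq_mean_def Bochner_Integration.integral_diff[OF i2[OF s] i2[OF s], symmetric]
      by (intro expectation_abs_bound Bochner_Integration.integrable_diff i2 s sx2)
    moreover have "\<bar>step_sq_mean k t x - step_sq_mean k s x\<bar> \<le> A * \<bar>t - s\<bar>"
      unfolding step_sq_mean_def by (rule dyn_lipschitz[OF dyn_emp_mean_square[OF C2b_smooth_step[OF k]] A2 s t])
    ultimately show "\<bar>step_sq_mean k t x - step_sq_mean k s y\<bar> \<le> A * \<bar>t - s\<bar> + 2 / k * \<bar>x - y\<bar>" by linarith
  qed
qed

text \<open>The trigonometric majorant is fixed by \<open>n\<close> and \<open>l\<close>, chosen
  large; afterwards \<open>k\<close> can be taken small to remove the third term. The last term is
  not small near time 0, but its integral over time is.\<close>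

lemma window_bound:
  assumes k: "0 < k" and l: "0 < l" and n: "0 < n" and t: "0 < t"
  shows "expectation (\<lambda>\<omega>. emp_mean N (\<lambda>y. smooth_step k x y * (1 - smooth_step k x y)) (Y t \<omega>))
    \<le> 1 / (2 * real n) + 2 / l ^ 2 + exp (- (1 / (real n * l * k))) + exp (- (l ^ 2 / 2) * t)"
proof -
  let ?g = "\<lambda>y. ((\<Sum>i=1..n. cos (real i * l * (x - y))) / real n) ^ 2"
  let ?e = "exp (- (1 / (real n * l * k)))"
  have cg: "bdd_cyl N (emp_mean N ?g)"
  proof (intro bdd_cyl_emp_mean)
    show "continuous_on UNIV ?g" unfolding divide_inverse by (intro continuous_intros)
    have "\<bar>(\<Sum>i=1..n. cos (real i * l * (x - y))) / real n\<bar> \<le> 1" for y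
    proof -
      have "\<bar>\<Sum>i=1..n. cos (real i * l * (x - y))\<bar> \<le> (\<Sum>i=1..n. 1)"
        by (intro sum_abs[THEN order_trans] sum_mono) auto
      then show ?thesis using n by (simp add: abs_divide divide_le_eq)
    qed
    then have "\<bar>?g y\<bar> \<le> 1" for y by (simp add: abs_square_le_1)
    then show "bounded (range ?g)" by (intro boundedI[of _ 1]) (simp only: real_norm_def image_iff, blast)
  qed
  have "expectation (\<lambda>\<omega>. emp_mean N (\<lambda>y. smooth_step k x y * (1 - smooth_step k x y)) (Y t \<omega>)) \<le> expectation (\<lambda>\<omega>. emp_mean N ?g (Y t \<omega>) + ?e)"
  proof (rule integral_mono)
    show "integrable M (\<lambda>\<omega>. emp_mean N (\<lambda>y. smooth_step k x y * (1 - smooth_step k x y)) (Y t \<omega>))"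
      by (intro bdd_cyl_Y_integrable bdd_cyl_emp_mean_smooth_step k t)
    show "integrable M (\<lambda>\<omega>. emp_mean N ?g (Y t \<omega>) + ?e)"
      by (intro Bochner_Integration.integrable_add bdd_cyl_Y_integrable[OF cg t]) simp
    have "emp_mean N (\<lambda>y. smooth_step k x y * (1 - smooth_step k x y)) z \<le> emp_mean N (\<lambda>y. ?g y + ?e) z" for z
      by (rule emp_mean_mono) (rule logistic_d1_le_cos_square[OF k l n])
    then show "emp_mean N (\<lambda>y. smooth_step k x y * (1 - smooth_step k x y)) (Y t \<omega>) \<le> emp_mean N ?g (Y t \<omega>) + ?e" for \<omega>
      unfolding emp_mean_add emp_mean_const[OF N0] .
  qed
  also have "\<dots> = expectation (\<lambda>\<omega>. emp_mean N ?g (Y t \<omega>)) + ?e"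
    by (subst Bochner_Integration.integral_add[OF bdd_cyl_Y_integrable[OF cg t]]) (auto simp: prob_space)
  also have "\<dots> \<le> 1 / (2 * real n) + (exp (- (l ^ 2 / 2) * t) + 2 / l ^ 2) + ?e"
    by (intro add_right_mono cos_square_bound l n t)
  finally show ?thesis by simp
qed


text \<open>The expanded square, so that derivatives follow term by term from those of the moments.
  The function \<open>u\<close> is an argument because at time 0 it is replaced by the initial
  profile, constant in time.\<close>

definition sq_dev :: "real \<Rightarrow> (real \<Rightarrow> real \<Rightarrow> real) \<Rightarrow> real \<Rightarrow> real \<Rightarrow> real" where
  "sq_dev k u t x = step_sq_mean k t x - 2 * (u t x * step_mean k t x) + u t x ^ 2"

lemma sq_dev_eq:
  assumes "0 < k" "0 \<le> t"
  shows "sq_dev k u t x = expectation (\<lambda>\<omega>. (emp_mean N (smooth_step k x) (X t \<omega>) - u t x) ^ 2)"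
proof -
  have i: "integrable M (\<lambda>\<omega>. emp_mean N (smooth_step k x) (X t \<omega>))" "integrable M (\<lambda>\<omega>. emp_mean N (smooth_step k x) (X t \<omega>) ^ 2)"
    by (intro bdd_cyl_X_integrable bdd_cyl_power2 bdd_cyl_emp_mean_smooth_step assms)+
  have "expectation (\<lambda>\<omega>. (emp_mean N (smooth_step k x) (X t \<omega>) - u t x) ^ 2)
     = expectation (\<lambda>\<omega>. emp_mean N (smooth_step k x) (X t \<omega>) ^ 2 - 2 * u t x * emp_mean N (smooth_step k x) (X t \<omega>) + u t x ^ 2)"
    by (intro Bochner_Integration.integral_cong) (auto simp: power2_eq_square algebra_simps)
  also have "\<dots> = sq_dev k u t x"
    unfolding sq_dev_def step_mean_def step_sq_mean_def using i by (simp add: prob_space)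
  finally show ?thesis by simp
qed

lemma sq_dev_bounds:
  assumes k: "0 < k" and t: "0 \<le> t" and ub: "\<bar>u t x\<bar> \<le> C"
  shows "0 \<le> sq_dev k u t x" "sq_dev k u t x \<le> (1 + C) ^ 2"
proof -
  have i: "integrable M (\<lambda>\<omega>. (emp_mean N (smooth_step k x) (X t \<omega>) - u t x) ^ 2)"
    by (intro bdd_cyl_X_integrable[where f = "\<lambda>z. (emp_mean N (smooth_step k x) z - u t x) ^ 2"] bdd_cyl_power2 bdd_cyl_diff bdd_cyl_emp_mean_smooth_step bdd_cyl_const k t)
  have "(emp_mean N (smooth_step k x) z - u t x) ^ 2 \<le> (1 + C) ^ 2" for z
  proof -
    have "\<bar>emp_mean N (smooth_step k x) z - u t x\<bar> \<le> 1 + C"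
      using emp_mean_smooth_step_bounds[OF N0, of k x z] ub by linarith
    from power_mono[OF this abs_ge_zero, of 2] show ?thesis by simp
  qed
  then have "\<bar>sq_dev k u t x\<bar> \<le> (1 + C) ^ 2"
    unfolding sq_dev_eq[OF k t] by (intro expectation_abs_bound i) auto
  then show "sq_dev k u t x \<le> (1 + C) ^ 2" by simp
  show "0 \<le> sq_dev k u t x"
    unfolding sq_dev_eq[OF k t] by (intro Bochner_Integration.integral_nonneg) auto
qed

text \<open>The diffusion terms reproduce half the second space derivative of
  \<open>E (F - v) ^ 2\<close> up to the nonnegative \<open>E (F1 - vx) ^ 2\<close>, which is
  discarded. What remains is the reaction, the commutator error, and the Brownian and jump noise of
  order \<open>1 / N\<close>. For fixed \<open>t\<close> and \<open>x\<close> the solution enters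
  only as numbers.\<close>

lemma second_moment_inequality:
  fixes v vt vx vxx C k x t :: real
  assumes k: "0 < k" and t: "0 < t" and v: "\<bar>v\<bar> \<le> C" and eq: "vt = 1/2 * vxx + v ^ 2 - v"
  defines "F \<equiv> emp_mean N (smooth_step k x)" and "F1 \<equiv> emp_mean N (smooth_step_d1 k x)" and "F2 \<equiv> emp_mean N (smooth_step_d2 k x)"
    and "P \<equiv> emp_mean N (\<lambda>y. smooth_step k x y * (1 - smooth_step k x y))" and "W \<equiv> emp_mean N (\<lambda>y. (- smooth_step_d1 k x y) ^ 2)"
  defines "E \<equiv> \<lambda>f. expectation (\<lambda>\<omega>. f (Y t \<omega>))"
  shows "E (\<lambda>z. 1/2 * (2 * F z * F2 z + 2 / real N * W z) + jump N (\<lambda>z. F z ^ 2) z)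
     - 2 * (vt * E F + v * E (\<lambda>z. 1/2 * F2 z + jump N F z)) + 2 * v * vt
    \<le> 1/2 * (E (\<lambda>z. 2 * F1 z ^ 2 + 2 * F z * F2 z) - 2 * (vxx * E F + 2 * (vx * E F1) + v * E F2) + 2 * (vx ^ 2 + v * vxx))
     + 2 * (1 + C) * (E (\<lambda>z. F z ^ 2) - 2 * (v * E F) + v ^ 2)
     + 1 / (real N * k ^ 2) + 1 / (2 * real N) + 2 * (1 + C) * (2 * E P + 1 / (real N - 1))"
proof -
  note bdd_cyl = bdd_cyl_emp_mean_smooth_step[OF k, of N x, folded F_def F1_def F2_def P_def W_def]
  have C0: "0 \<le> C" using v by linarith
  have n: "0 < real N" "1 < real N" using N2 by auto
  have d1: "dyn F F2" unfolding F_def F2_def by (rule dyn_emp_mean[OF C2b_smooth_step[OF k]])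
  have d2: "dyn (\<lambda>z. F z ^ 2) (\<lambda>z. 2 * F z * F2 z + 2 / real N * W z)"
    unfolding F_def F2_def W_def by (rule dyn_emp_mean_square[OF C2b_smooth_step[OF k]])
  have cj: "bdd_cyl N (jump N F)" "bdd_cyl N (jump N (\<lambda>z. F z ^ 2))" using d1 d2 by (simp_all add: dyn_def)
  have I: "integrable M (\<lambda>\<omega>. f (Y t \<omega>))" if "bdd_cyl N f" for f by (rule bdd_cyl_Y_integrable[OF that t])
  have Eadd: "E (\<lambda>z. f z + g z) = E f + E g" if "bdd_cyl N f" "bdd_cyl N g" for f g
    unfolding E_def by (rule Bochner_Integration.integral_add[OF I[OF that(1)] I[OF that(2)]])
  have Ecm: "E (\<lambda>z. c * f z) = c * E f" for c f unfolding E_def by simp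
  have Ec: "E (\<lambda>z. c) = c" for c unfolding E_def by (simp add: prob_space)
  have Emono: "E f \<le> E g" if "bdd_cyl N f" "bdd_cyl N g" "\<And>z. f z \<le> g z" for f g
    unfolding E_def by (rule integral_mono[OF I[OF that(1)] I[OF that(2)]]) (rule that(3))
  define r where "r = v ^ 2 - v"
  \<comment> \<open>The products \<open>F * F2\<close>, \<open>vxx * F\<close>,
    \<open>v * F2\<close> and \<open>v * vxx\<close> occur identically on both sides of the claim.
    They are dropped, and the remainder is compared configuration by configuration; the term with
    \<open>F1 ^ 2\<close> comes from the right-hand side.\<close>
  let ?L = "\<lambda>z. (1 / real N) * W z + (jump N (\<lambda>z. F z ^ 2) z + ((- 2 * v) * jump N F z + ((- 2 * r) * F z + (- 1) * F1 z ^ 2)))"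
  let ?R = "\<lambda>z. (- 2 * vx) * F1 z + (2 * (1 + C)) * F z ^ 2 + ((- 4 * (1 + C) * v) * F z + ((4 * (1 + C)) * P z +
     (vx ^ 2 - 2 * r * v + 2 * (1 + C) * v ^ 2 + 1 / (real N * k ^ 2) + 1 / (2 * real N) + 2 * (1 + C) / (real N - 1))))"
  have pt: "?L z \<le> ?R z" for z
  proof -
    define f where "f = F z"
    define j where "j = jump N F z"
    define d where "d = j - (f ^ 2 - f)"
    define q where "q = 2 * P z + 1 / (real N - 1)"
    have f: "0 \<le> f" "f \<le> 1" unfolding f_def F_def by (rule emp_mean_smooth_step_bounds[OF N0])+
    have d: "\<bar>d\<bar> \<le> q"
      using jump_emp_mean_smooth_step[OF N2 k, of x z] by (simp add: d_def j_def f_def F_def q_def P_def)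
    have W: "(1 / real N) * W z \<le> 1 / (real N * k ^ 2)"
    proof -
      have "\<bar>W z\<bar> \<le> (1 / k) ^ 2"
        unfolding W_def
      proof (rule emp_mean_abs_le[OF N0])
        show "\<bar>(- smooth_step_d1 k x y) ^ 2\<bar> \<le> (1 / k) ^ 2" for y
          using power_mono[OF smooth_step_d1_bound[OF k, of x y] abs_ge_zero, of 2] by simp
      qed
      then have "(1 / real N) * W z \<le> (1 / real N) * (1 / k) ^ 2" using n by (intro mult_left_mono) auto
      then show ?thesis by (simp add: power_divide)
    qed
    have J2: "jump N (\<lambda>z. F z ^ 2) z \<le> 2 * f * j + 1 / (2 * real N)"
      using jump_square[OF N2 k, of x z] by (simp add: f_def j_def F_def)
    have g: "\<bar>f - v\<bar> \<le> 1 + C" using f v by linarith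
    have q0: "0 \<le> q" using d by linarith
    \<comment> \<open>The identity \<open>(f ^ 2 - f) - (v ^ 2 - v) = (f - v) * (f + v - 1)\<close>
      yields a second factor \<open>f - v\<close>; the deviation \<open>d\<close> of the jump drift
      from \<open>f ^ 2 - f\<close> is kept apart.\<close>
    have "2 * f * j - 2 * v * j - 2 * r * (f - v) = 2 * (f - v) ^ 2 * (f + v - 1) + 2 * ((f - v) * d)"
      unfolding d_def r_def by (simp add: power2_eq_square algebra_simps)
    moreover have "(f - v) ^ 2 * (f + v - 1) \<le> (f - v) ^ 2 * (1 + C)"
      using f v by (intro mult_left_mono) auto
    moreover have "(f - v) * d \<le> (1 + C) * q"
    proof -
      have "\<bar>f - v\<bar> * \<bar>d\<bar> \<le> (1 + C) * q" using g d C0 by (intro mult_mono) auto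
      then show ?thesis by (metis abs_mult abs_le_D1)
    qed
    ultimately have m: "2 * f * j - 2 * v * j - 2 * r * (f - v) \<le> 2 * ((f - v) ^ 2 * (1 + C)) + 2 * ((1 + C) * q)"
      by linarith
    \<comment> \<open>The discarded square: second space differentiation of
      \<open>(f - v) ^ 2\<close> produces it in addition to \<open>(f - v)\<close> times the second
      derivatives.\<close>
    have s: "0 \<le> (F1 z - vx) ^ 2" by simp
    have e1: "(F1 z - vx) ^ 2 = F1 z ^ 2 - 2 * vx * F1 z + vx ^ 2" by (simp add: power2_eq_square algebra_simps)
    have e2: "2 * ((f - v) ^ 2 * (1 + C)) = (2 * (1 + C)) * f ^ 2 + (- 4 * (1 + C) * v) * f + 2 * (1 + C) * v ^ 2"
      by (simp add: power2_eq_square algebra_simps)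
    have e3: "2 * ((1 + C) * q) = (4 * (1 + C)) * P z + 2 * (1 + C) / (real N - 1)"
      unfolding q_def by (simp add: algebra_simps)
    have e4: "- 2 * r * (f - v) = (- 2 * r) * f + 2 * r * v" by (simp add: algebra_simps)
    have e5: "2 * f * j - 2 * v * j - 2 * r * (f - v) = 2 * f * j + (- 2 * v) * j + ((- 2 * r) * f + 2 * r * v)"
      using e4 by simp
    show ?thesis
      using W J2 m s unfolding e1 e2 e3 e5 f_def[symmetric] j_def[symmetric] by linarith
  qed
  have "E ?L \<le> E ?R"
    by (rule Emono[OF _ _ pt]) (intro bdd_cyl_add bdd_cyl_cmult bdd_cyl_power2 bdd_cyl cj bdd_cyl_const)+
  moreover have "E ?L = (1 / real N) * E W + (E (jump N (\<lambda>z. F z ^ 2)) + ((- 2 * v) * E (jump N F) + ((- 2 * r) * E F + (- 1) * E (\<lambda>z. F1 z ^ 2))))"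
    by (simp only: Eadd Ecm bdd_cyl_add bdd_cyl_cmult bdd_cyl_power2 bdd_cyl cj bdd_cyl_const)
  moreover have "E ?R = (- 2 * vx) * E F1 + (2 * (1 + C)) * E (\<lambda>z. F z ^ 2) + ((- 4 * (1 + C) * v) * E F + ((4 * (1 + C)) * E P +
     (vx ^ 2 - 2 * r * v + 2 * (1 + C) * v ^ 2 + 1 / (real N * k ^ 2) + 1 / (2 * real N) + 2 * (1 + C) / (real N - 1))))"
    by (simp only: Eadd Ecm Ec bdd_cyl_add bdd_cyl_cmult bdd_cyl_power2 bdd_cyl cj bdd_cyl_const)
  moreover have "E (\<lambda>z. 1/2 * (2 * F z * F2 z + 2 / real N * W z) + jump N (\<lambda>z. F z ^ 2) z)
     = E (\<lambda>z. F z * F2 z) + 1 / real N * E W + E (jump N (\<lambda>z. F z ^ 2))"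
  proof -
    have "(\<lambda>z. 1/2 * (2 * F z * F2 z + 2 / real N * W z) + jump N (\<lambda>z. F z ^ 2) z)
       = (\<lambda>z. F z * F2 z + 1 / real N * W z + jump N (\<lambda>z. F z ^ 2) z)" by auto
    then show ?thesis by (simp only: Eadd Ecm bdd_cyl_add bdd_cyl_cmult bdd_cyl_mult bdd_cyl cj)
  qed
  moreover have "E (\<lambda>z. 1/2 * F2 z + jump N F z) = 1/2 * E F2 + E (jump N F)"
    by (simp only: Eadd Ecm bdd_cyl_cmult bdd_cyl cj)
  moreover have "E (\<lambda>z. 2 * F1 z ^ 2 + 2 * F z * F2 z) = 2 * E (\<lambda>z. F1 z ^ 2) + 2 * E (\<lambda>z. F z * F2 z)"
    by (simp only: Eadd Ecm bdd_cyl_cmult bdd_cyl_mult bdd_cyl_power2 bdd_cyl mult.assoc)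
  moreover have "vt * E F = 1/2 * (vxx * E F) + r * E F" "2 * v * vt = v * vxx + 2 * r * v"
    unfolding eq r_def by (simp_all add: algebra_simps)
  ultimately show ?thesis by (simp add: algebra_simps add_divide_distrib)
qed

lemma has_real_derivative_left_shift:
  fixes f :: "real \<Rightarrow> real"
  assumes "(f has_real_derivative d) (at_left (c + t))"
  shows "((\<lambda>s. f (c + s)) has_real_derivative d) (at_left t)"
proof -
  have "(+) c ` {..<t} = {..<c + t}"
  proof (intro equalityI subsetI)
    fix y assume "y \<in> {..<c + t}"
    then show "y \<in> (+) c ` {..<t}" by (intro image_eqI[of _ _ "y - c"]) auto
  qed auto
  then have "(f \<circ> (+) c has_real_derivative d * 1) (at t within {..<t})"
    using assms by (intro DERIV_image_chain) (auto intro!: derivative_eq_intros)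
  then show ?thesis by (simp add: o_def)
qed

text \<open>The comparison starts at a positive time \<open>\<tau>\<close>, because the equation and
  the continuity of \<open>u\<close> are given only for positive times. \<open>A\<close> collects
  the errors that are constant in time; the decaying part of the window bound enters as the
  integrable source.\<close>

theorem second_moment_bound:
  fixes u ux uxx :: "real \<Rightarrow> real \<Rightarrow> real"
  assumes ub: "\<And>t x. 0 < t \<Longrightarrow> \<bar>u t x\<bar> \<le> C"
    and uc: "continuous_on ({0<..} \<times> UNIV) (\<lambda>(t, x). u t x)"
    and ux: "\<And>t x. 0 < t \<Longrightarrow> (u t has_real_derivative ux t x) (at x)"
    and uxx: "\<And>t x. 0 < t \<Longrightarrow> (ux t has_real_derivative uxx t x) (at x)"
    and ut: "\<And>t x. 0 < t \<Longrightarrow> ((\<lambda>s. u s x) has_real_derivative (1/2 * uxx t x + (u t x)^2 - u t x)) (at t)"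
    and k: "0 < k" and l: "0 < l" and n: "0 < n" and \<tau>: "0 < \<tau>" "\<tau> < T"
  defines "A \<equiv> 1 / (real N * k ^ 2) + 1 / (2 * real N) + 2 * (1 + C) / (real N - 1)
      + 4 * (1 + C) * (1 / (2 * real n) + 2 / l ^ 2 + exp (- (1 / (real n * l * k))))"
  shows "sq_dev k u T x \<le> exp (2 * (1 + C) * (T - \<tau>)) *
    ((\<integral>y. heat_majorant (T - \<tau>) (x - y) * sq_dev k u \<tau> y \<partial>lborel) + A * (T - \<tau>) + 4 * (1 + C) / (l ^ 2 / 2))"
proof -
  have C0: "0 \<le> C" using ub[of 1 0] by linarith
  have n': "1 < real N" using N2 by auto
  let ?E = "\<lambda>t f. expectation (\<lambda>\<omega>. f (Y t \<omega>))"
  let ?F = "\<lambda>x. emp_mean N (smooth_step k x)" and ?F1 = "\<lambda>x. emp_mean N (smooth_step_d1 k x)" and ?F2 = "\<lambda>x. emp_mean N (smooth_step_d2 k x)"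
  let ?W = "\<lambda>x. emp_mean N (\<lambda>y. (- smooth_step_d1 k x y) ^ 2)"
  define vt where "vt t x = 1/2 * uxx t x + (u t x)^2 - u t x" for t x
  define ax where "ax t x = ?E t (\<lambda>z. 2 * ?F x z * ?F1 x z) - 2 * (ux t x * ?E t (?F x) + u t x * ?E t (?F1 x)) + 2 * (u t x * ux t x)" for t x
  define axx where "axx t x = ?E t (\<lambda>z. 2 * ?F1 x z ^ 2 + 2 * ?F x z * ?F2 x z)
     - 2 * (uxx t x * ?E t (?F x) + 2 * (ux t x * ?E t (?F1 x)) + u t x * ?E t (?F2 x)) + 2 * (ux t x ^ 2 + u t x * uxx t x)" for t x
  define aleft where "aleft t x = ?E t (\<lambda>z. 1/2 * (2 * ?F x z * ?F2 x z + 2 / real N * ?W x z) + jump N (\<lambda>z. ?F x z ^ 2) z)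
     - 2 * (vt t x * ?E t (?F x) + u t x * ?E t (\<lambda>z. 1/2 * ?F2 x z + jump N (?F x) z)) + 2 * u t x * vt t x" for t x
  have dax: "(sq_dev k u t has_real_derivative ax t x) (at x)" if t: "0 < t" for t x
    unfolding sq_dev_def[abs_def] ax_def
    by (rule derivative_eq_intros m_dx[OF k t] ux[OF t] refl)+ (simp add: m_left[OF k t] algebra_simps)
  have daxx: "(ax t has_real_derivative axx t x) (at x)" if t: "0 < t" for t x
  proof -
    have mF: "((\<lambda>x. ?E t (?F x)) has_real_derivative ?E t (?F1 x)) (at x)"
      using m_dx(1)[OF k t] unfolding m_left(1)[OF k t, abs_def] .
    show ?thesis
      unfolding ax_def[abs_def] axx_def
      by (rule derivative_eq_intros m_dx[OF k t] mF ux[OF t] uxx[OF t] refl)+ (simp add: algebra_simps power2_eq_square)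
  qed
  have dat: "((\<lambda>s. sq_dev k u s x) has_real_derivative aleft t x) (at_left t)" if t: "0 < t" for t x
  proof -
    have a: "((\<lambda>s. u s x) has_real_derivative vt t x) (at_left t)"
      unfolding vt_def by (rule has_field_derivative_at_within[OF ut[OF t]])
    have b: "((\<lambda>s. step_mean k s x) has_real_derivative ?E t (\<lambda>z. 1/2 * ?F2 x z + jump N (?F x) z)) (at_left t)"
      unfolding step_mean_def by (rule dyn_left_derivative[OF dyn_emp_mean[OF C2b_smooth_step[OF k]] t])
    have c: "((\<lambda>s. step_sq_mean k s x) has_real_derivative ?E t (\<lambda>z. 1/2 * (2 * ?F x z * ?F2 x z + 2 / real N * ?W x z) + jump N (\<lambda>z. ?F x z ^ 2) z)) (at_left t)"
      unfolding step_sq_mean_def by (rule dyn_left_derivative[OF dyn_emp_mean_square[OF C2b_smooth_step[OF k]] t])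
    show ?thesis
      unfolding sq_dev_def[abs_def] aleft_def
      by (rule derivative_eq_intros a b c refl)+ (simp add: m_left[OF k t] algebra_simps)
  qed
  have ineq: "aleft t x \<le> 1/2 * axx t x + 2 * (1 + C) * sq_dev k u t x + A + 4 * (1 + C) * exp (- (l ^ 2 / 2) * t)" if t: "0 < t" for t x
  proof -
    let ?P = "?E t (emp_mean N (\<lambda>y. smooth_step k x y * (1 - smooth_step k x y)))"
    have "aleft t x \<le> 1/2 * axx t x + 2 * (1 + C) * (?E t (\<lambda>z. ?F x z ^ 2) - 2 * (u t x * ?E t (?F x)) + u t x ^ 2)
      + 1 / (real N * k ^ 2) + 1 / (2 * real N) + 2 * (1 + C) * (2 * ?P + 1 / (real N - 1))"
      unfolding aleft_def axx_def
      by (rule second_moment_inequality[OF k t ub[OF t] vt_def])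
    also have "?E t (\<lambda>z. ?F x z ^ 2) - 2 * (u t x * ?E t (?F x)) + u t x ^ 2 = sq_dev k u t x"
      by (simp add: sq_dev_def m_left[OF k t])
    finally have 1: "aleft t x \<le> 1/2 * axx t x + 2 * (1 + C) * sq_dev k u t x
      + 1 / (real N * k ^ 2) + 1 / (2 * real N) + 2 * (1 + C) * (2 * ?P + 1 / (real N - 1))" .
    have "2 * (1 + C) * (2 * ?P + 1 / (real N - 1)) = 4 * (1 + C) * ?P + 2 * (1 + C) / (real N - 1)"
      by (simp add: algebra_simps add_divide_distrib)
    moreover have "4 * (1 + C) * ?P \<le> 4 * (1 + C) * (1 / (2 * real n) + 2 / l ^ 2 + exp (- (1 / (real n * l * k))) + exp (- (l ^ 2 / 2) * t))"
      by (intro mult_left_mono window_bound k l n t) (use C0 in auto)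
    ultimately show ?thesis using 1 unfolding A_def distrib_left[of "4 * (1 + C)" _ "exp (- (l ^ 2 / 2) * t)"] by linarith
  qed
  have A0: "0 \<le> A" unfolding A_def using C0 n' k by (intro add_nonneg_nonneg mult_nonneg_nonneg) auto
  have pos: "0 \<le> sq_dev k u t x \<and> sq_dev k u t x \<le> (1 + C) ^ 2" if t: "0 < t" for t x
    using sq_dev_bounds[where u = u, OF k less_imp_le[OF t] ub[OF t]] by blast
  have cont: "continuous_on ({0..T - \<tau>} \<times> UNIV) (\<lambda>(t, x). sq_dev k u (\<tau> + t) x)"
  proof -
    obtain B where B: "\<And>t s x y. 0 \<le> t \<Longrightarrow> 0 \<le> s \<Longrightarrow> \<bar>step_mean k t x - step_mean k s y\<bar> \<le> B * \<bar>t - s\<bar> + 2 / k * \<bar>x - y\<bar>"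
      "\<And>t s x y. 0 \<le> t \<Longrightarrow> 0 \<le> s \<Longrightarrow> \<bar>step_sq_mean k t x - step_sq_mean k s y\<bar> \<le> B * \<bar>t - s\<bar> + 2 / k * \<bar>x - y\<bar>"
      using m_lipschitz[OF k] by blast
    have sub: "{0<..} \<times> UNIV \<subseteq> {0::real..} \<times> (UNIV :: real set)" by auto
    note c1 = continuous_on_subset[OF continuous_on_lipschitz2[OF B(1)] sub]
    note c2 = continuous_on_subset[OF continuous_on_lipschitz2[OF B(2)] sub]
    have "continuous_on ({0<..} \<times> UNIV) (\<lambda>p. (\<lambda>(t, x). step_sq_mean k t x) p - 2 * ((\<lambda>(t, x). u t x) p * (\<lambda>(t, x). step_mean k t x) p) + (\<lambda>(t, x). u t x) p ^ 2)"
      by (intro continuous_intros c1 c2 uc)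
    then have "continuous_on ({0<..} \<times> UNIV) (\<lambda>p. sq_dev k u (fst p) (snd p))"
      by (simp add: sq_dev_def split_beta)
    then have "continuous_on ({0..T - \<tau>} \<times> UNIV) (\<lambda>p. sq_dev k u (fst (\<tau> + fst p, snd p)) (snd (\<tau> + fst p, snd p)))"
      by (rule continuous_on_compose2) (use \<tau> in \<open>auto intro!: continuous_intros\<close>)
    then show ?thesis by (simp add: split_beta)
  qed
  have "sq_dev k u (\<tau> + (T - \<tau>)) x \<le> exp (2 * (1 + C) * (T - \<tau>)) *
    ((\<integral>y. heat_majorant (T - \<tau>) (x - y) * sq_dev k u (\<tau> + 0) y \<partial>lborel) + A * (T - \<tau>) + 4 * (1 + C) / (l ^ 2 / 2))"
  proof (rule heat_comparison[where b = "\<lambda>t x. sq_dev k u (\<tau> + t) x" and bt = "\<lambda>t x. aleft (\<tau> + t) x"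
        and bx = "\<lambda>t x. ax (\<tau> + t) x" and bxx = "\<lambda>t x. axx (\<tau> + t) x" and K = "(1 + C) ^ 2"])
    fix t x :: real assume t: "0 < t"
    then have s: "0 < \<tau> + t" using \<tau> by simp
    show "((\<lambda>x. sq_dev k u (\<tau> + t) x) has_real_derivative ax (\<tau> + t) x) (at x)" by (rule dax[OF s])
    show "((\<lambda>x. ax (\<tau> + t) x) has_real_derivative axx (\<tau> + t) x) (at x)" by (rule daxx[OF s])
    show "((\<lambda>s. sq_dev k u (\<tau> + s) x) has_real_derivative aleft (\<tau> + t) x) (at_left t)"
      by (rule has_real_derivative_left_shift[OF dat[OF s]])
    have "4 * (1 + C) * exp (- (l ^ 2 / 2) * (\<tau> + t)) \<le> 4 * (1 + C) * exp (- (l ^ 2 / 2) * t)"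
      using C0 \<tau> by (intro mult_left_mono) (auto simp: mult_left_mono)
    then show "aleft (\<tau> + t) x \<le> 1/2 * axx (\<tau> + t) x + 2 * (1 + C) * sq_dev k u (\<tau> + t) x + A + 4 * (1 + C) * exp (- (l ^ 2 / 2) * t)"
      using ineq[OF s, of x] by linarith
  next
    fix t x :: real assume "0 \<le> t"
    then show "0 \<le> sq_dev k u (\<tau> + t) x \<and> sq_dev k u (\<tau> + t) x \<le> (1 + C) ^ 2"
      using pos[of "\<tau> + t" x] \<tau> by simp
  qed (use \<tau> C0 A0 l cont in auto)
  then show ?thesis by simp
qed

end

section \<open>Passage to the limit\<close>

text \<open>Restricting to \<open>\<tau> \<le> T / 2\<close> changes the prefactor by at most
  \<open>sqrt 2\<close> and gives one integrable envelope for all small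
  \<open>\<tau>\<close>.\<close>

lemma heat_majorant_shift_le:
  assumes "0 < T" "0 \<le> \<tau>" "\<tau> \<le> T / 2"
  shows "heat_majorant (T - \<tau>) y \<le> sqrt 2 * heat_majorant T y"
proof -
  have "y ^ 2 / (2 * (T + 1)) \<le> y ^ 2 / (2 * (T - \<tau> + 1))"
    using assms by (intro divide_left_mono) auto
  then have "exp (- (y ^ 2) / (2 * (T - \<tau> + 1))) / sqrt (T - \<tau>) \<le> exp (- (y ^ 2) / (2 * (T + 1))) / sqrt (T / 2)"
    using assms by (intro frac_le) auto
  then show ?thesis by (simp add: heat_majorant_def real_sqrt_divide mult.commute)
qed

lemma heat_majorant_nonneg: "0 < T \<Longrightarrow> 0 \<le> heat_majorant T y"
  by (simp add: heat_majorant_def)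

lemma heat_majorant_measurable: "(\<lambda>y. heat_majorant T (x - y)) \<in> borel_measurable borel"
  unfolding heat_majorant_def by measurable

lemma heat_majorant_mult_integrable:
  assumes "0 < T" and [measurable]: "f \<in> borel_measurable borel" and "\<And>y. \<bar>f y\<bar> \<le> K"
  shows "integrable lborel (\<lambda>y. heat_majorant T (x - y) * f y)"
proof (rule Bochner_Integration.integrable_bound)
  show "integrable lborel (\<lambda>y. K * heat_majorant T (x - y))"
    by (intro integrable_mult_right heat_majorant_integrable assms)
  show "AE y in lborel. norm (heat_majorant T (x - y) * f y) \<le> norm (K * heat_majorant T (x - y))"
  proof (rule AE_I2)
    fix y
    have "heat_majorant T (x - y) * \<bar>f y\<bar> \<le> heat_majorant T (x - y) * \<bar>K\<bar>"
      using assms(3)[of y] by (intro mult_left_mono heat_majorant_nonneg assms) auto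
    then show "norm (heat_majorant T (x - y) * f y) \<le> norm (K * heat_majorant T (x - y))"
      using heat_majorant_nonneg[OF assms(1), of "x - y"] by (simp add: abs_mult mult.commute)
  qed
  show "(\<lambda>y. heat_majorant T (x - y) * f y) \<in> borel_measurable lborel"
    using heat_majorant_measurable[of T x] by measurable
qed

lemma emp_cdf_eq_emp_mean: "emp_cdf N z x = emp_mean N (\<lambda>v. if v \<le> x then 1 else 0) z"
proof -
  have "{i. i < N \<and> z i \<le> x} = {i \<in> {..<N}. z i \<le> x}" by auto
  then have "real (card {i. i < N \<and> z i \<le> x}) = (\<Sum>i<N. if z i \<le> x then 1 else 0)"
    by (simp add: sum.If_cases Int_def)
  then show ?thesis by (simp add: emp_cdf_def emp_mean_def)
qed

text \<open>At distance at least \<open>d\<close> from \<open>x\<close> the smooth step differs from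
  the indicator by at most \<open>exp (- (d / k))\<close>; a shift of the argument by
  \<open>d\<close> absorbs the transition zone.\<close>

lemma emp_mean_smooth_step_le_emp_cdf:
  assumes "0 < N" "0 < k" "0 \<le> d"
  shows "emp_mean N (smooth_step k x) z \<le> emp_cdf N z (x + d) + exp (- (d / k))"
    "emp_cdf N z (x - d) \<le> emp_mean N (smooth_step k x) z + exp (- (d / k))"
proof -
  have "emp_mean N (smooth_step k x) z \<le> emp_mean N (\<lambda>v. (if v \<le> x + d then 1 else 0) + exp (- (d / k))) z"
  proof (rule emp_mean_mono)
    fix v
    show "smooth_step k x v \<le> (if v \<le> x + d then 1 else 0) + exp (- (d / k))"
    proof (cases "v \<le> x + d")
      case True
      then show ?thesis using smooth_step_bounds(2)[of k x v] by (simp add: add_increasing2 less_imp_le)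
    next
      case False
      then have "(x - v) / k \<le> - d / k" using assms by (intro divide_right_mono) auto
      then have "exp ((x - v) / k) \<le> exp (- (d / k))" by simp
      from order_trans[OF logistic_le_exp this] show ?thesis using False by (simp add: smooth_step_def)
    qed
  qed
  then show "emp_mean N (smooth_step k x) z \<le> emp_cdf N z (x + d) + exp (- (d / k))"
    unfolding emp_cdf_eq_emp_mean emp_mean_add emp_mean_const[OF assms(1)] .
  have "emp_mean N (\<lambda>v. if v \<le> x - d then 1 else 0) z \<le> emp_mean N (\<lambda>v. smooth_step k x v + exp (- (d / k))) z"
  proof (rule emp_mean_mono)
    fix v
    show "(if v \<le> x - d then 1 else 0) \<le> smooth_step k x v + exp (- (d / k))"
    proof (cases "v \<le> x - d")
      case False
      then show ?thesis using smooth_step_bounds(1)[of k x v] by (simp add: add_nonneg_nonneg less_imp_le)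
    next
      case True
      then have "d / k \<le> (x - v) / k" using assms by (intro divide_right_mono) auto
      then have "exp (- ((x - v) / k)) \<le> exp (- (d / k))" by simp
      from order_trans[OF logistic_le_exp this] logistic_minus[of "(x - v) / k"]
      have "1 - logistic ((x - v) / k) \<le> exp (- (d / k))" by simp
      then show ?thesis using True by (simp add: smooth_step_def)
    qed
  qed
  then show "emp_cdf N z (x - d) \<le> emp_mean N (smooth_step k x) z + exp (- (d / k))"
    unfolding emp_cdf_eq_emp_mean emp_mean_add emp_mean_const[OF assms(1)] .
qed

lemma emp_cdf_mono: "x \<le> y \<Longrightarrow> emp_cdf N z x \<le> emp_cdf N z y"
  unfolding emp_cdf_def by (intro divide_right_mono of_nat_mono card_mono) auto

lemma emp_cdf_bounds: "0 \<le> emp_cdf N z x" "emp_cdf N z x \<le> 1"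
proof -
  show "0 \<le> emp_cdf N z x" by (simp add: emp_cdf_def)
  have "card {i. i < N \<and> z i \<le> x} \<le> card {..<N}" by (intro card_mono) auto
  then show "emp_cdf N z x \<le> 1" by (simp add: emp_cdf_def divide_le_eq)
qed

lemma emp_cdf_right_continuous: "(emp_cdf N z \<longlongrightarrow> emp_cdf N z x) (at_right x)"
proof -
  have "\<forall>i\<in>{..<N}. \<forall>\<^sub>F y in at_right x. (z i \<le> y) = (z i \<le> x)"
  proof
    fix i
    show "\<forall>\<^sub>F y in at_right x. (z i \<le> y) = (z i \<le> x)"
    proof (cases "z i \<le> x")
      case True
      then show ?thesis using eventually_at_right_less[of x] by (auto elim: eventually_mono)
    next
      case False
      then have "\<forall>\<^sub>F y in at_right x. y < z i" by (intro order_tendstoD(2)[OF tendsto_ident_at]) auto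
      then show ?thesis by eventually_elim (use False in auto)
    qed
  qed
  then have "\<forall>\<^sub>F y in at_right x. \<forall>i\<in>{..<N}. (z i \<le> y) = (z i \<le> x)"
    by (rule eventually_ball_finite[rotated]) simp
  then have "\<forall>\<^sub>F y in at_right x. emp_cdf N z y = emp_cdf N z x"
  proof eventually_elim
    case (elim y)
    then have "{i. i < N \<and> z i \<le> y} = {i. i < N \<and> z i \<le> x}" by auto
    then show ?case by (simp add: emp_cdf_def)
  qed
  then show ?thesis by (rule tendsto_eventually)
qed

lemma emp_cdf_measurable:
  assumes [measurable]: "\<And>i. i < N \<Longrightarrow> (\<lambda>\<omega>. Z \<omega> i) \<in> borel_measurable M"
  shows "(\<lambda>\<omega>. emp_cdf N (Z \<omega>) x) \<in> borel_measurable M"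
proof -
  have "(\<Sum>i<N. if Z \<omega> i \<le> x then 1 else 0) = (\<Sum>i<N. indicator {..x} (Z \<omega> i) :: real)" for \<omega>
    by (intro sum.cong) (auto simp: indicator_def)
  then show ?thesis unfolding emp_cdf_eq_emp_mean emp_mean_def by simp
qed

text \<open>By right continuity the supremum over \<open>x\<close> may be restricted to the rationals.\<close>

lemma emp_cdf_deviation_measurable:
  assumes meas: "\<And>i. i < N \<Longrightarrow> (\<lambda>\<omega>. Z \<omega> i) \<in> borel_measurable M"
    and v: "\<And>x. continuous (at_right x) v"
  shows "{\<omega> \<in> space M. \<exists>x. \<epsilon> < \<bar>emp_cdf N (Z \<omega>) x - v x\<bar>} \<in> sets M"
proof -
  have "(\<exists>x. \<epsilon> < \<bar>emp_cdf N z x - v x\<bar>) \<longleftrightarrow> (\<exists>q\<in>\<rat>. \<epsilon> < \<bar>emp_cdf N z q - v q\<bar>)" for z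
  proof
    assume "\<exists>x. \<epsilon> < \<bar>emp_cdf N z x - v x\<bar>"
    then obtain x where x: "\<epsilon> < \<bar>emp_cdf N z x - v x\<bar>" by blast
    have "((\<lambda>y. \<bar>emp_cdf N z y - v y\<bar>) \<longlongrightarrow> \<bar>emp_cdf N z x - v x\<bar>) (at_right x)"
      using v[of x] by (intro tendsto_intros emp_cdf_right_continuous) (simp add: continuous_within)
    then have "\<forall>\<^sub>F y in at_right x. \<epsilon> < \<bar>emp_cdf N z y - v y\<bar>" using x by (rule order_tendstoD)
    then obtain b where b: "x < b" "\<And>y. x < y \<Longrightarrow> y < b \<Longrightarrow> \<epsilon> < \<bar>emp_cdf N z y - v y\<bar>"
      using eventually_at_right[of x "x + 1"] by auto
    obtain q where "q \<in> \<rat>" "x < q" "q < b" using Rats_dense_in_real[OF b(1)] by blast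
    then show "\<exists>q\<in>\<rat>. \<epsilon> < \<bar>emp_cdf N z q - v q\<bar>" using b(2) by blast
  qed blast
  then have "{\<omega> \<in> space M. \<exists>x. \<epsilon> < \<bar>emp_cdf N (Z \<omega>) x - v x\<bar>}
    = (\<Union>q\<in>\<rat>. {\<omega> \<in> space M. \<epsilon> < \<bar>emp_cdf N (Z \<omega>) q - v q\<bar>})" by auto
  also have "\<dots> \<in> sets M"
  proof (intro sets.countable_UN'' countable_rat)
    fix q
    have [measurable]: "(\<lambda>\<omega>. emp_cdf N (Z \<omega>) q) \<in> borel_measurable M" by (rule emp_cdf_measurable[OF meas])
    show "{\<omega> \<in> space M. \<epsilon> < \<bar>emp_cdf N (Z \<omega>) q - v q\<bar>} \<in> sets M" by measurable
  qed
  finally show ?thesis .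
qed

lemma distribution_function_bounds:
  assumes "distribution_function v" shows "0 \<le> v x" "v x \<le> 1"
proof -
  have m: "mono v" and l: "(v \<longlongrightarrow> 0) at_bot" "(v \<longlongrightarrow> 1) at_top"
    using assms by (auto simp: distribution_function_def)
  show "0 \<le> v x"
    by (rule tendsto_upperbound[OF l(1)])
      (use eventually_mono[OF eventually_le_at_bot[of x], of "\<lambda>y. v y \<le> v x"] m in \<open>auto simp: mono_def\<close>)
  show "v x \<le> 1"
    by (rule tendsto_lowerbound[OF l(2)])
      (use eventually_mono[OF eventually_ge_at_top[of x], of "\<lambda>y. v x \<le> v y"] m in \<open>auto simp: mono_def\<close>)
qed

lemma mono_AE_isCont:
  fixes v :: "real \<Rightarrow> real"
  assumes "mono v" shows "AE y in lborel. isCont v y"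
proof -
  have "{y. \<not> isCont v y} \<in> null_sets lborel"
    by (intro countable_imp_null_set_lborel mono_ctble_discont assms)
  then show ?thesis by (rule AE_I') auto
qed

context particle_system
begin

text \<open>The rate \<open>3/2\<close> is the sum of \<open>1/2\<close> from diffusion, because
  \<open>f2 \<le> f\<close>, and 1 from the jumps. It does not depend on \<open>N\<close>, so
  initial tail mass grows by a bounded factor only.\<close>

lemma tail_growth:
  assumes f: "C2b f f1 f2" and f0: "\<And>y. 0 \<le> f y" and f2: "\<And>y. f2 y \<le> f y" and t: "0 \<le> t"
  shows "expectation (\<lambda>\<omega>. emp_mean N f (X t \<omega>)) \<le> exp (3/2 * t) * expectation (\<lambda>\<omega>. emp_mean N f (X 0 \<omega>))"
proof -
  have d: "dyn (emp_mean N f) (emp_mean N f2)" by (rule dyn_emp_mean[OF f])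
  note cbd = dyn_bdd_cyl[OF d]
  obtain B where B: "\<And>x. \<bar>1/2 * emp_mean N f2 x + jump N (emp_mean N f) x\<bar> \<le> B"
    using bdd_cyl_bounded[OF cbd(2)] by blast
  let ?m = "\<lambda>t. expectation (\<lambda>\<omega>. emp_mean N f (X t \<omega>))"
  let ?j = "\<lambda>t. expectation (\<lambda>\<omega>. 1/2 * emp_mean N f2 (Y t \<omega>) + jump N (emp_mean N f) (Y t \<omega>))"
  let ?v = "\<lambda>t. exp (- (3/2) * t) * ?m t"
  have "B-lipschitz_on {0..t} ?m"
  proof (rule lipschitz_onI)
    show "dist (?m s) (?m r) \<le> B * dist s r" if "s \<in> {0..t}" "r \<in> {0..t}" for s r
      using dyn_lipschitz[OF d B, of r s] that by (simp add: dist_real_def)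
    show "0 \<le> B" using B[of "\<lambda>_. 0"] by linarith
  qed
  then have cm: "continuous_on {0..t} ?m" by (rule lipschitz_on_continuous_on)
  have "?v t \<le> ?v 0"
  proof (rule nonincreasing_if_left_derivative[OF t, where m = ?v
        and m' = "\<lambda>t. exp (- (3/2) * t) * (?j t - 3/2 * ?m t)"])
    show "continuous_on {0..t} ?v" by (intro continuous_intros cm)
  next
    fix s assume s: "0 < s" "s \<le> t"
    have de: "((\<lambda>t. exp (- (3/2) * t)) has_real_derivative exp (- (3/2) * s) * (- (3/2))) (at_left s)"
      by (auto intro!: derivative_eq_intros)
    have "exp (- (3/2) * s) * (- (3/2)) * ?m s + ?j s * exp (- (3/2) * s) = exp (- (3/2) * s) * (?j s - 3/2 * ?m s)"
      by (simp add: algebra_simps)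
    then show "(?v has_real_derivative exp (- (3/2) * s) * (?j s - 3/2 * ?m s)) (at_left s)"
      using DERIV_mult[OF de dyn_left_derivative[OF d s(1)]] by (simp only:)
    have "?j s \<le> expectation (\<lambda>\<omega>. 3/2 * emp_mean N f (Y s \<omega>))"
    proof (rule integral_mono[OF bdd_cyl_Y_integrable[OF cbd(2) s(1)]])
      show "integrable M (\<lambda>\<omega>. 3/2 * emp_mean N f (Y s \<omega>))"
        by (intro integrable_mult_right bdd_cyl_Y_integrable[OF cbd(1) s(1)])
      fix \<omega>
      show "1/2 * emp_mean N f2 (Y s \<omega>) + jump N (emp_mean N f) (Y s \<omega>) \<le> 3/2 * emp_mean N f (Y s \<omega>)"
        using emp_mean_mono[where f = f2 and g = f and N = N and x = "Y s \<omega>", OF f2] jump_emp_mean_le_nonneg[where f = f and x = "Y s \<omega>", OF N2 f0] by linarith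
    qed
    also have "\<dots> = 3/2 * ?m s" using dyn_left_eq[OF d s(1)] by simp
    finally have "?j s - 3/2 * ?m s \<le> 0" by linarith
    then show "exp (- (3/2) * s) * (?j s - 3/2 * ?m s) \<le> 0"
      by (intro mult_nonneg_nonpos) auto
  qed
  then have "exp (3/2 * t) * ?v t \<le> exp (3/2 * t) * ?m 0" by (intro mult_left_mono) auto
  moreover have "exp (3/2 * t) * ?v t = ?m t" by (simp add: mult.assoc[symmetric] exp_minus)
  ultimately show ?thesis by linarith
qed

text \<open>For fixed \<open>N\<close> and \<open>k\<close> the moments are Lipschitz down to time
  0, and \<open>u\<close> converges at continuity points of the monotone \<open>u0\<close>, hence
  almost everywhere. As the squared deviation is bounded, the Gaussian integral converges.\<close>

lemma second_moment_limit:
  fixes u ux uxx :: "real \<Rightarrow> real \<Rightarrow> real"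
  assumes ub: "\<And>t x. 0 < t \<Longrightarrow> \<bar>u t x\<bar> \<le> C"
    and uc: "continuous_on ({0<..} \<times> UNIV) (\<lambda>(t, x). u t x)"
    and ux: "\<And>t x. 0 < t \<Longrightarrow> (u t has_real_derivative ux t x) (at x)"
    and uxx: "\<And>t x. 0 < t \<Longrightarrow> (ux t has_real_derivative uxx t x) (at x)"
    and ut: "\<And>t x. 0 < t \<Longrightarrow> ((\<lambda>s. u s x) has_real_derivative (1/2 * uxx t x + (u t x)^2 - u t x)) (at t)"
    and u0: "mono u0" "\<And>x. isCont u0 x \<Longrightarrow> ((\<lambda>s. u s x) \<longlongrightarrow> u0 x) (at_right 0)"
    and k: "0 < k" and l: "0 < l" and n: "0 < n" and T: "0 < T"
  defines "A \<equiv> 1 / (real N * k ^ 2) + 1 / (2 * real N) + 2 * (1 + C) / (real N - 1)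
      + 4 * (1 + C) * (1 / (2 * real n) + 2 / l ^ 2 + exp (- (1 / (real n * l * k))))"
  shows "sq_dev k u T x \<le> exp (2 * (1 + C) * T) *
    (sqrt 2 * (\<integral>y. heat_majorant T (x - y) * sq_dev k (\<lambda>_. u0) 0 y \<partial>lborel) + A * T + 4 * (1 + C) / (l ^ 2 / 2))"
proof -
  have C0: "0 \<le> C" using ub[of 1 0] by linarith
  have n': "1 < real N" using N2 by auto
  have A0: "0 \<le> A" unfolding A_def using C0 n' k by (intro add_nonneg_nonneg mult_nonneg_nonneg) auto
  obtain B where B: "\<And>t s x y. 0 \<le> t \<Longrightarrow> 0 \<le> s \<Longrightarrow> \<bar>step_mean k t x - step_mean k s y\<bar> \<le> B * \<bar>t - s\<bar> + 2 / k * \<bar>x - y\<bar>"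
    "\<And>t s x y. 0 \<le> t \<Longrightarrow> 0 \<le> s \<Longrightarrow> \<bar>step_sq_mean k t x - step_sq_mean k s y\<bar> \<le> B * \<bar>t - s\<bar> + 2 / k * \<bar>x - y\<bar>"
    using m_lipschitz[OF k] by blast
  have pos: "0 \<le> sq_dev k u t x \<and> sq_dev k u t x \<le> (1 + C) ^ 2" if t: "0 < t" for t x
    using sq_dev_bounds[where u = u, OF k less_imp_le[OF t] ub[OF t]] by blast
  have mc: "continuous_on UNIV (step_mean k t)" "continuous_on UNIV (step_sq_mean k t)" if "0 \<le> t" for t
  proof -
    have "(2 / k)-lipschitz_on UNIV (step_mean k t)" "(2 / k)-lipschitz_on UNIV (step_sq_mean k t)"
      using B[OF that that] k by (auto intro!: lipschitz_onI simp: dist_real_def)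
    then show "continuous_on UNIV (step_mean k t)" "continuous_on UNIV (step_sq_mean k t)"
      by (auto intro: lipschitz_on_continuous_on)
  qed
  have meas: "(\<lambda>y. sq_dev k u t y) \<in> borel_measurable borel" if t: "0 < t" for t
  proof -
    have "continuous_on UNIV (u t)" by (rule DERIV_continuous_on) (rule has_field_derivative_at_within[OF ux[OF t]])
    then show ?thesis unfolding sq_dev_def
      by (intro borel_measurable_continuous_onI continuous_intros mc) (use t in auto)
  qed
  have meas0: "(\<lambda>y. sq_dev k (\<lambda>_. u0) 0 y) \<in> borel_measurable borel"
  proof -
    have [measurable]: "u0 \<in> borel_measurable borel" by (rule borel_measurable_mono[OF u0(1)])
    have [measurable]: "step_mean k 0 \<in> borel_measurable borel" "step_sq_mean k 0 \<in> borel_measurable borel"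
      by (auto intro: borel_measurable_continuous_onI mc)
    show ?thesis unfolding sq_dev_def by measurable
  qed
  \<comment> \<open>Starting the denominators at 2 keeps \<open>\<tau> j \<le> T / 2\<close>, as the
    envelope with factor \<open>sqrt 2\<close> requires.\<close>
  define \<tau> where "\<tau> j = T / real (Suc (Suc j))" for j
  have \<tau>: "0 < \<tau> j" "\<tau> j < T" "\<tau> j \<le> T / 2" for j
  proof -
    show "0 < \<tau> j" using T by (simp add: \<tau>_def)
    show 2: "\<tau> j \<le> T / 2" unfolding \<tau>_def using T by (intro divide_left_mono) auto
    then show "\<tau> j < T" using T by simp
  qed
  have \<tau>l: "filterlim \<tau> (at_right 0) sequentially"
  proof (rule tendsto_imp_filterlim_at_right)
    have "(\<lambda>j. T * inverse (real (Suc (Suc j)))) \<longlonglongrightarrow> T * 0"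
      by (intro tendsto_intros LIMSEQ_Suc[OF LIMSEQ_inverse_real_of_nat])
    then show "\<tau> \<longlonglongrightarrow> 0" by (simp add: \<tau>_def[abs_def] divide_inverse)
  qed (use \<tau> in auto)
  let ?K = "exp (2 * (1 + C) * T)" and ?D = "4 * (1 + C) / (l ^ 2 / 2)"
  let ?I = "\<lambda>j. \<integral>y. heat_majorant T (x - y) * sq_dev k u (\<tau> j) y \<partial>lborel"
  have step: "sq_dev k u T x \<le> ?K * (sqrt 2 * ?I j + A * T + ?D)" for j
  proof -
    have g0: "0 < T - \<tau> j" using \<tau>(2)[of j] by simp
    have "sq_dev k u T x \<le> exp (2 * (1 + C) * (T - \<tau> j)) *
      ((\<integral>y. heat_majorant (T - \<tau> j) (x - y) * sq_dev k u (\<tau> j) y \<partial>lborel) + A * (T - \<tau> j) + ?D)"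
      unfolding A_def by (rule second_moment_bound[OF ub uc ux uxx ut k l n \<tau>(1,2)])
    also have "\<dots> \<le> ?K * (sqrt 2 * ?I j + A * T + ?D)"
    proof (rule mult_mono)
      show "exp (2 * (1 + C) * (T - \<tau> j)) \<le> ?K" using C0 \<tau>(1)[of j] by (simp add: mult_left_mono)
      have "(\<integral>y. heat_majorant (T - \<tau> j) (x - y) * sq_dev k u (\<tau> j) y \<partial>lborel)
        \<le> (\<integral>y. sqrt 2 * (heat_majorant T (x - y) * sq_dev k u (\<tau> j) y) \<partial>lborel)"
      proof (rule integral_mono)
        have b: "\<bar>sq_dev k u (\<tau> j) y\<bar> \<le> (1 + C) ^ 2" for y using pos[OF \<tau>(1)] by auto
        show "integrable lborel (\<lambda>y. heat_majorant (T - \<tau> j) (x - y) * sq_dev k u (\<tau> j) y)"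
          by (rule heat_majorant_mult_integrable[OF g0 meas[OF \<tau>(1)] b])
        show "integrable lborel (\<lambda>y. sqrt 2 * (heat_majorant T (x - y) * sq_dev k u (\<tau> j) y))"
          by (intro integrable_mult_right heat_majorant_mult_integrable[OF T meas[OF \<tau>(1)] b])
        show "heat_majorant (T - \<tau> j) (x - y) * sq_dev k u (\<tau> j) y \<le> sqrt 2 * (heat_majorant T (x - y) * sq_dev k u (\<tau> j) y)" for y
          unfolding mult.assoc[symmetric]
          by (intro mult_right_mono heat_majorant_shift_le T \<tau> less_imp_le[OF \<tau>(1)]) (use pos[OF \<tau>(1)] in auto)
      qed
      then have "(\<integral>y. heat_majorant (T - \<tau> j) (x - y) * sq_dev k u (\<tau> j) y \<partial>lborel) \<le> sqrt 2 * ?I j" by simp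
      moreover have "A * (T - \<tau> j) \<le> A * T" using A0 \<tau>(1)[of j] by (intro mult_left_mono) auto
      ultimately show "(\<integral>y. heat_majorant (T - \<tau> j) (x - y) * sq_dev k u (\<tau> j) y \<partial>lborel) + A * (T - \<tau> j) + ?D
        \<le> sqrt 2 * ?I j + A * T + ?D" by linarith
      show "0 \<le> (\<integral>y. heat_majorant (T - \<tau> j) (x - y) * sq_dev k u (\<tau> j) y \<partial>lborel) + A * (T - \<tau> j) + ?D"
      proof (intro add_nonneg_nonneg Bochner_Integration.integral_nonneg mult_nonneg_nonneg heat_majorant_nonneg g0 A0)
        show "0 \<le> sq_dev k u (\<tau> j) y" for y using pos[OF \<tau>(1)] by auto
      qed (use C0 g0 in auto)
    qed auto
    finally show ?thesis .
  qed
  have "?I \<longlonglongrightarrow> (\<integral>y. heat_majorant T (x - y) * sq_dev k (\<lambda>_. u0) 0 y \<partial>lborel)"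
  proof (rule integral_dominated_convergence[where w = "\<lambda>y. (1 + C) ^ 2 * heat_majorant T (x - y)"])
    show "(\<lambda>y. heat_majorant T (x - y) * sq_dev k (\<lambda>_. u0) 0 y) \<in> borel_measurable lborel"
      using meas0 heat_majorant_measurable[of T x] by measurable
    show "(\<lambda>y. heat_majorant T (x - y) * sq_dev k u (\<tau> j) y) \<in> borel_measurable lborel" for j
      using meas[OF \<tau>(1)] heat_majorant_measurable[of T x] by measurable
    show "integrable lborel (\<lambda>y. (1 + C) ^ 2 * heat_majorant T (x - y))"
      by (intro integrable_mult_right heat_majorant_integrable T)
    show "AE y in lborel. norm (heat_majorant T (x - y) * sq_dev k u (\<tau> j) y) \<le> (1 + C) ^ 2 * heat_majorant T (x - y)" for j
    proof (rule AE_I2)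
      fix y
      show "norm (heat_majorant T (x - y) * sq_dev k u (\<tau> j) y) \<le> (1 + C) ^ 2 * heat_majorant T (x - y)"
        using pos[OF \<tau>(1), of j y] heat_majorant_nonneg[OF T, of "x - y"]
        by (simp add: abs_mult mult.commute mult_left_mono)
    qed
    have "(\<lambda>j. sq_dev k u (\<tau> j) y) \<longlonglongrightarrow> sq_dev k (\<lambda>_. u0) 0 y" if c: "isCont u0 y" for y
    proof -
      have u: "(\<lambda>j. u (\<tau> j) y) \<longlonglongrightarrow> u0 y" by (rule filterlim_compose[OF u0(2)[OF c] \<tau>l])
      have t0: "\<tau> \<longlonglongrightarrow> 0" using \<tau>l by (simp add: filterlim_at)
      have lim: "(\<lambda>j. m (\<tau> j) y) \<longlonglongrightarrow> m 0 y" if "\<And>t. 0 \<le> t \<Longrightarrow> \<bar>m t y - m 0 y\<bar> \<le> B * t" for m :: "real \<Rightarrow> real \<Rightarrow> real"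
      proof (rule LIM_zero_cancel, rule tendsto_rabs_zero_cancel, rule tendsto_sandwich[OF _ _ tendsto_const])
        show "(\<lambda>j. B * \<tau> j) \<longlonglongrightarrow> 0" using tendsto_mult_right_zero[OF t0] .
        show "\<forall>\<^sub>F j in sequentially. \<bar>m (\<tau> j) y - m 0 y\<bar> \<le> B * \<tau> j"
          by (intro always_eventually allI that less_imp_le \<tau>)
      qed auto
      have "(\<lambda>j. step_mean k (\<tau> j) y) \<longlonglongrightarrow> step_mean k 0 y" "(\<lambda>j. step_sq_mean k (\<tau> j) y) \<longlonglongrightarrow> step_sq_mean k 0 y"
        using B(1)[of _ 0 y y] B(2)[of _ 0 y y] by (intro lim; simp)+
      then show ?thesis unfolding sq_dev_def by (intro tendsto_intros u)
    qed
    then show "AE y in lborel. (\<lambda>j. heat_majorant T (x - y) * sq_dev k u (\<tau> j) y) \<longlonglongrightarrow> heat_majorant T (x - y) * sq_dev k (\<lambda>_. u0) 0 y"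
      using mono_AE_isCont[OF u0(1)] by (auto elim!: eventually_mono intro!: tendsto_mult)
  qed
  then have "(\<lambda>j. ?K * (sqrt 2 * ?I j + A * T + ?D)) \<longlonglongrightarrow>
      ?K * (sqrt 2 * (\<integral>y. heat_majorant T (x - y) * sq_dev k (\<lambda>_. u0) 0 y \<partial>lborel) + A * T + ?D)"
    by (intro tendsto_intros)
  then show ?thesis by (rule LIMSEQ_le_const) (use step in auto)
qed

text \<open>On the bad event the deviation is at most 1; elsewhere its square is at most its
  modulus, and monotonicity bounds that by the oscillation of \<open>u0\<close> over a window. At a
  jump of \<open>u0\<close> this oscillation stays large for every \<open>d\<close>, so it is kept
  as a function of \<open>y\<close> to be integrated later.\<close>

lemma initial_second_moment:
  assumes u0: "distribution_function u0" and k: "0 < k" and d: "0 \<le> d"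
    and \<delta>: "0 \<le> \<delta>"
  shows "sq_dev k (\<lambda>_. u0) 0 y \<le> prob {\<omega> \<in> space M. \<exists>x. \<delta> < \<bar>emp_cdf N (X 0 \<omega>) x - u0 x\<bar>}
    + \<delta> + exp (- (d / k)) + (u0 (y + d) - u0 (y - d))"
proof -
  define Bad where "Bad = {\<omega> \<in> space M. \<exists>x. \<delta> < \<bar>emp_cdf N (X 0 \<omega>) x - u0 x\<bar>}"
  have m: "mono u0" and rc: "\<And>x. continuous (at_right x) u0"
    using u0 by (auto simp: distribution_function_def)
  note ub = distribution_function_bounds[OF u0]
  have Bm [measurable]: "Bad \<in> sets M"
    unfolding Bad_def by (rule emp_cdf_deviation_measurable[OF X_measurable rc]) auto
  have mo: "u0 (y - d) \<le> u0 y" "u0 y \<le> u0 (y + d)" using m d by (auto simp: mono_def)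
  let ?c = "\<delta> + exp (- (d / k)) + (u0 (y + d) - u0 (y - d))"
  have c0: "0 \<le> ?c" using \<delta> mo exp_ge_zero[of "- (d / k)"] by linarith
  have "sq_dev k (\<lambda>_. u0) 0 y = expectation (\<lambda>\<omega>. (emp_mean N (smooth_step k y) (X 0 \<omega>) - u0 y) ^ 2)"
    by (rule sq_dev_eq[OF k order_refl])
  also have "\<dots> \<le> expectation (\<lambda>\<omega>. indicator Bad \<omega> + ?c)"
  proof (rule integral_mono)
    show "integrable M (\<lambda>\<omega>. (emp_mean N (smooth_step k y) (X 0 \<omega>) - u0 y) ^ 2)"
      by (intro bdd_cyl_X_integrable[where f = "\<lambda>z. (emp_mean N (smooth_step k y) z - u0 y) ^ 2"] bdd_cyl_power2 bdd_cyl_diff bdd_cyl_emp_mean_smooth_step bdd_cyl_const k) auto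
    show "integrable M (\<lambda>\<omega>. indicator Bad \<omega> + ?c)"
      by (intro Bochner_Integration.integrable_add integrable_real_indicator Bm) (auto simp: less_top[symmetric])
    fix \<omega> assume w: "\<omega> \<in> space M"
    let ?s = "emp_mean N (smooth_step k y) (X 0 \<omega>)"
    have s: "0 \<le> ?s" "?s \<le> 1" by (rule emp_mean_smooth_step_bounds[OF N0])+
    have a1: "\<bar>?s - u0 y\<bar> \<le> 1" using s ub[of y] by linarith
    have sq: "(?s - u0 y) ^ 2 \<le> \<bar>?s - u0 y\<bar>"
      using mult_left_mono[OF a1 abs_ge_zero, of "?s - u0 y"] by (simp add: power2_eq_square flip: abs_mult)
    show "(?s - u0 y) ^ 2 \<le> indicator Bad \<omega> + ?c"
    proof (cases "\<omega> \<in> Bad")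
      case True
      then show ?thesis using sq a1 c0 by simp
    next
      case False
      then have e: "\<bar>emp_cdf N (X 0 \<omega>) z - u0 z\<bar> \<le> \<delta>" for z using w by (auto simp: Bad_def not_less)
      have "\<bar>?s - u0 y\<bar> \<le> ?c"
        using emp_mean_smooth_step_le_emp_cdf[where x = y and z = "X 0 \<omega>", OF N0 k d] e[of "y + d"] e[of "y - d"] mo by linarith
      then show ?thesis using sq False by simp
    qed
  qed
  also have "\<dots> = prob Bad + ?c"
    by (subst Bochner_Integration.integral_add) (auto simp: prob_space less_top[symmetric] Bm)
  finally show ?thesis by (simp add: Bad_def)
qed

lemma deviation_probability:
  assumes "0 < k" "0 \<le> t" "0 < \<epsilon>" "sq_dev k u t x \<le> \<gamma>"
  shows "prob {\<omega> \<in> space M. \<epsilon> \<le> \<bar>emp_mean N (smooth_step k x) (X t \<omega>) - u t x\<bar>} \<le> \<gamma> / \<epsilon> ^ 2"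
proof -
  let ?q = "\<lambda>\<omega>. (emp_mean N (smooth_step k x) (X t \<omega>) - u t x) ^ 2"
  have i: "integrable M ?q"
    by (intro bdd_cyl_X_integrable[where f = "\<lambda>z. (emp_mean N (smooth_step k x) z - u t x) ^ 2"] bdd_cyl_power2 bdd_cyl_diff bdd_cyl_emp_mean_smooth_step bdd_cyl_const assms)
  have "{\<omega> \<in> space M. \<epsilon> \<le> \<bar>emp_mean N (smooth_step k x) (X t \<omega>) - u t x\<bar>} = {\<omega> \<in> space M. \<epsilon> ^ 2 \<le> ?q \<omega>}"
    using assms(3) by (simp add: abs_le_square_iff[symmetric])
  also have "prob \<dots> \<le> expectation ?q / \<epsilon> ^ 2"
    by (rule integral_Markov_inequality_measure[OF i, where A = "{}"]) (use assms in auto)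
  also have "\<dots> \<le> \<gamma> / \<epsilon> ^ 2"
    using assms sq_dev_eq[OF assms(1,2), of u x] by (intro divide_right_mono) auto
  finally show ?thesis .
qed

end

lemma exp_neg_div_tendsto_0:
  fixes c :: real
  assumes "0 < c" shows "((\<lambda>k. exp (- (c / k))) \<longlongrightarrow> 0) (at_right 0)"
proof -
  have "filterlim (\<lambda>k. c * inverse k) at_top (at_right 0)"
    by (rule filterlim_tendsto_pos_mult_at_top[OF tendsto_const assms filterlim_inverse_at_top_right])
  then have "filterlim (\<lambda>k. - (c / k)) at_bot (at_right 0)"
    by (simp add: filterlim_uminus_at_bot divide_inverse)
  then show ?thesis by (rule filterlim_compose[OF exp_at_bot])
qed

text \<open>This one-sided bound is the hypothesis \<open>f2 \<le> f\<close> of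
  \<open>tail_growth\<close> for logistic profiles.\<close>

lemma logistic_d2_le: "logistic_d2 z \<le> logistic z"
proof -
  have s: "0 < logistic z" "logistic z < 1" by (rule logistic_bounds)+
  have "(1 - logistic z) * (1 - 2 * logistic z) \<le> 1"
    using mult_left_mono[of "logistic z" 1 "2 * logistic z"] s by (simp add: algebra_simps)
  then have "logistic z * ((1 - logistic z) * (1 - 2 * logistic z)) \<le> logistic z * 1" using s by (intro mult_left_mono) auto
  then show ?thesis by (simp add: logistic_d2_def mult.assoc)
qed

text \<open>The factor 2 is \<open>1 / logistic 0\<close>: on the half line in question the logistic
  function is at least one half.\<close>

lemma emp_cdf_le_two_emp_mean: "0 < N \<Longrightarrow> emp_cdf N z x \<le> 2 * emp_mean N (\<lambda>y. logistic (x - y)) z"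
  and one_minus_emp_cdf_le_two_emp_mean: "0 < N \<Longrightarrow> 1 - emp_cdf N z x \<le> 2 * emp_mean N (\<lambda>y. logistic (y - x)) z"
proof -
  assume N: "0 < N"
  have h: "1 \<le> 2 * logistic w" if "0 \<le> w" for w using logistic_mono[OF that] by (simp add: logistic_def)
  have h1: "(if y \<le> x then 1 else 0) \<le> 2 * logistic (x - y)" for y
    using h[of "x - y"] logistic_bounds(1)[of "x - y"] by simp
  have h2: "1 \<le> (if y \<le> x then 1 else 0) + 2 * logistic (y - x)" for y
    using h[of "y - x"] logistic_bounds(1)[of "y - x"] by simp
  have "emp_cdf N z x \<le> emp_mean N (\<lambda>y. 2 * logistic (x - y)) z"
    unfolding emp_cdf_eq_emp_mean by (rule emp_mean_mono) (rule h1)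
  then show "emp_cdf N z x \<le> 2 * emp_mean N (\<lambda>y. logistic (x - y)) z" by (simp only: emp_mean_cmult)
  have "emp_mean N (\<lambda>_. 1) z \<le> emp_mean N (\<lambda>y. (if y \<le> x then 1 else 0) + 2 * logistic (y - x)) z"
    by (rule emp_mean_mono) (rule h2)
  then show "1 - emp_cdf N z x \<le> 2 * emp_mean N (\<lambda>y. logistic (y - x)) z"
    unfolding emp_cdf_eq_emp_mean emp_mean_add emp_mean_cmult emp_mean_const[OF N] by linarith
qed

section \<open>The limit of many particles at a fixed time\<close>

locale hydrodynamic =
  fixes M :: "nat \<Rightarrow> 'a measure" and X :: "nat \<Rightarrow> real \<Rightarrow> 'a \<Rightarrow> nat \<Rightarrow> real"
    and u0 :: "real \<Rightarrow> real" and u ux uxx :: "real \<Rightarrow> real \<Rightarrow> real" and C T :: real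
  assumes ps: "2 \<le> N \<Longrightarrow> particle_system (M N) N (X N)"
    and u0: "distribution_function u0"
    and init: "\<epsilon> > 0 \<Longrightarrow>
      (\<lambda>N. measure (M N) {\<omega> \<in> space (M N). \<exists>x. \<bar>emp_cdf N (X N 0 \<omega>) x - u0 x\<bar> > \<epsilon>}) \<longlonglongrightarrow> 0"
    and ub: "0 < t \<Longrightarrow> \<bar>u t x\<bar> \<le> C"
    and uc: "continuous_on ({0<..} \<times> UNIV) (\<lambda>(t, x). u t x)"
    and ux: "0 < t \<Longrightarrow> (u t has_real_derivative ux t x) (at x)"
    and uxx: "0 < t \<Longrightarrow> (ux t has_real_derivative uxx t x) (at x)"
    and ut: "0 < t \<Longrightarrow> ((\<lambda>s. u s x) has_real_derivative (1/2 * uxx t x + (u t x)^2 - u t x)) (at t)"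
    and ulim: "isCont u0 x \<Longrightarrow> ((\<lambda>s. u s x) \<longlongrightarrow> u0 x) (at_right 0)"
    and T: "0 < T"
begin

definition bad :: "real \<Rightarrow> nat \<Rightarrow> real" where
  "bad \<delta> N = measure (M N) {\<omega> \<in> space (M N). \<exists>x. \<delta> < \<bar>emp_cdf N (X N 0 \<omega>) x - u0 x\<bar>}"

lemma bad_tendsto: "\<delta> > 0 \<Longrightarrow> bad \<delta> \<longlonglongrightarrow> 0"
  using init[of \<delta>] by (simp add: bad_def[abs_def])

lemma u0_mono: "mono u0" using u0 by (simp add: distribution_function_def)

text \<open>The oscillation of \<open>u0\<close> over windows of half-width \<open>d\<close>,
  averaged against the Gaussian envelope. It vanishes with \<open>d\<close> even if
  \<open>u0\<close> jumps, because a monotone function is continuous almost everywhere.\<close>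

definition osc :: "real \<Rightarrow> real \<Rightarrow> real" where
  "osc x d = (\<integral>y. heat_majorant T (x - y) * (u0 (y + d) - u0 (y - d)) \<partial>lborel)"

lemma u0_diff_bounds: "0 \<le> d \<Longrightarrow> 0 \<le> u0 (y + d) - u0 (y - d) \<and> u0 (y + d) - u0 (y - d) \<le> 1"
  using u0_mono distribution_function_bounds[OF u0, of "y + d"] distribution_function_bounds[OF u0, of "y - d"]
  unfolding mono_def by (smt (verit))

lemma u0_diff_measurable: "(\<lambda>y. u0 (y + d) - u0 (y - d)) \<in> borel_measurable borel"
proof -
  have [measurable]: "u0 \<in> borel_measurable borel" by (rule borel_measurable_mono[OF u0_mono])
  show ?thesis by measurable
qed

lemma osc_tendsto:
  assumes "d \<longlonglongrightarrow> 0" "\<And>i. 0 \<le> d i"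
  shows "(\<lambda>i. osc x (d i)) \<longlonglongrightarrow> 0"
proof -
  have "(\<lambda>i. osc x (d i)) \<longlonglongrightarrow> integral\<^sup>L lborel (\<lambda>y::real. 0::real)"
    unfolding osc_def
  proof (rule integral_dominated_convergence[where w = "\<lambda>y. heat_majorant T (x - y)"])
    show "(\<lambda>y. heat_majorant T (x - y) * (u0 (y + d i) - u0 (y - d i))) \<in> borel_measurable lborel" for i
      using u0_diff_measurable[of "d i"] heat_majorant_measurable[of T x] by measurable
    show "integrable lborel (\<lambda>y. heat_majorant T (x - y))" by (rule heat_majorant_integrable[OF T])
    show "AE y in lborel. norm (heat_majorant T (x - y) * (u0 (y + d i) - u0 (y - d i))) \<le> heat_majorant T (x - y)" for i
    proof (rule AE_I2)
      fix y
      show "norm (heat_majorant T (x - y) * (u0 (y + d i) - u0 (y - d i))) \<le> heat_majorant T (x - y)"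
        using u0_diff_bounds[OF assms(2), of y i] heat_majorant_nonneg[OF T, of "x - y"]
        by (simp add: abs_mult mult_left_le)
    qed
    have "(\<lambda>i. u0 (y + d i) - u0 (y - d i)) \<longlonglongrightarrow> u0 y - u0 y" if "isCont u0 y" for y
    proof (intro tendsto_diff isCont_tendsto_compose[OF that])
      show "(\<lambda>i. y + d i) \<longlonglongrightarrow> y" using tendsto_add[OF tendsto_const[of y] assms(1)] by simp
      show "(\<lambda>i. y - d i) \<longlonglongrightarrow> y" using tendsto_diff[OF tendsto_const[of y] assms(1)] by simp
    qed
    then have "(\<lambda>i. heat_majorant T (x - y) * (u0 (y + d i) - u0 (y - d i))) \<longlonglongrightarrow> 0" if "isCont u0 y" for y
      using tendsto_mult_right_zero[of "\<lambda>i. u0 (y + d i) - u0 (y - d i)" sequentially "heat_majorant T (x - y)"] that by simp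
    then show "AE y in lborel. (\<lambda>i. heat_majorant T (x - y) * (u0 (y + d i) - u0 (y - d i))) \<longlonglongrightarrow> 0"
      using mono_AE_isCont[OF u0_mono] by (auto elim!: eventually_mono)
  qed auto
  then show ?thesis by simp
qed

abbreviation mom :: "nat \<Rightarrow> real \<Rightarrow> real \<Rightarrow> real" where
  "mom N k x \<equiv> particle_system.sq_dev (M N) N (X N) k u T x"

lemma mom_bound:
  assumes N: "2 \<le> N" and k: "0 < k" and d: "0 \<le> d" and \<delta>: "0 \<le> \<delta>" and l: "0 < l" and n: "0 < n"
  shows "mom N k x \<le> exp (2 * (1 + C) * T) *
    (sqrt 2 * ((bad \<delta> N + \<delta> + exp (- (d / k))) * (\<integral>y. heat_majorant T (x - y) \<partial>lborel) + osc x d)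
     + (1 / (real N * k ^ 2) + 1 / (2 * real N) + 2 * (1 + C) / (real N - 1)
      + 4 * (1 + C) * (1 / (2 * real n) + 2 / l ^ 2 + exp (- (1 / (real n * l * k))))) * T + 4 * (1 + C) / (l ^ 2 / 2))"
proof -
  interpret particle_system "M N" N "X N" by (rule ps[OF N])
  let ?c = "bad \<delta> N + \<delta> + exp (- (d / k))"
  have i1: "integrable lborel (\<lambda>y. ?c * heat_majorant T (x - y))"
    by (intro integrable_mult_right heat_majorant_integrable T)
  have i2: "integrable lborel (\<lambda>y. heat_majorant T (x - y) * (u0 (y + d) - u0 (y - d)))"
    by (rule heat_majorant_mult_integrable[OF T u0_diff_measurable, where K = 1]) (use u0_diff_bounds[OF d] in auto)
  have c0: "0 \<le> ?c" using \<delta> by (simp add: bad_def add_nonneg_nonneg)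
  have "(\<integral>y. heat_majorant T (x - y) * sq_dev k (\<lambda>_. u0) 0 y \<partial>lborel)
    \<le> (\<integral>y. ?c * heat_majorant T (x - y) + heat_majorant T (x - y) * (u0 (y + d) - u0 (y - d)) \<partial>lborel)"
  proof (rule integral_mono')
    show "integrable lborel (\<lambda>y. ?c * heat_majorant T (x - y) + heat_majorant T (x - y) * (u0 (y + d) - u0 (y - d)))"
      using i1 i2 by (rule Bochner_Integration.integrable_add)
    fix y
    have g: "0 \<le> heat_majorant T (x - y)" by (rule heat_majorant_nonneg[OF T])
    have "heat_majorant T (x - y) * sq_dev k (\<lambda>_. u0) 0 y \<le> heat_majorant T (x - y) * (?c + (u0 (y + d) - u0 (y - d)))"
      using initial_second_moment[OF u0 k d \<delta>, of y] by (intro mult_left_mono g) (simp add: bad_def)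
    then show "heat_majorant T (x - y) * sq_dev k (\<lambda>_. u0) 0 y \<le> ?c * heat_majorant T (x - y) + heat_majorant T (x - y) * (u0 (y + d) - u0 (y - d))"
      by (simp only: distrib_left mult.commute[of ?c])
    show "0 \<le> ?c * heat_majorant T (x - y) + heat_majorant T (x - y) * (u0 (y + d) - u0 (y - d))"
      by (rule add_nonneg_nonneg[OF mult_nonneg_nonneg[OF c0 g] mult_nonneg_nonneg[OF g conjunct1[OF u0_diff_bounds[OF d]]]])
  qed
  also have "\<dots> = ?c * (\<integral>y. heat_majorant T (x - y) \<partial>lborel) + osc x d"
    unfolding osc_def Bochner_Integration.integral_add[OF i1 i2] by simp
  finally have "sqrt 2 * (\<integral>y. heat_majorant T (x - y) * sq_dev k (\<lambda>_. u0) 0 y \<partial>lborel)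
    \<le> sqrt 2 * (?c * (\<integral>y. heat_majorant T (x - y) \<partial>lborel) + osc x d)" by simp
  then show ?thesis
    by (intro order_trans[OF second_moment_limit[OF ub uc ux uxx ut u0_mono ulim k l n T]] mult_left_mono add_right_mono) auto
qed

text \<open>The order of the choices is the point. The index \<open>i\<close> fixes
  \<open>n = l = i + 1\<close> and \<open>d = \<delta> = 1 / (i + 1)\<close>, then \<open>k\<close>
  makes \<open>exp (- (d / k))\<close> and the tail of the window bound small, and only then
  \<open>N\<close> removes the noise \<open>1 / (N * k ^ 2)\<close> and the bad event.\<close>

lemma small_second_moment:
  assumes \<gamma>: "0 < \<gamma>" and \<eta>: "0 < \<eta>"
  obtains k d where "0 < k" "0 < d" "d \<le> \<eta>" "exp (- (d / k)) \<le> \<gamma>"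
    "\<forall>\<^sub>F N in sequentially. mom N k x \<le> \<gamma>"
proof -
  let ?K = "exp (2 * (1 + C) * T)" and ?G = "\<integral>y. heat_majorant T (x - y) \<partial>lborel"
  define r where "r i = inverse (real (Suc i))" for i
  have r0: "0 < r i" for i by (simp add: r_def)
  have rl: "r \<longlonglongrightarrow> 0" unfolding r_def by (rule LIMSEQ_inverse_real_of_nat)
  \<comment> \<open>The literal zeros mark the terms that the later choices of \<open>k\<close> and
    \<open>N\<close> send to 0. Written this way, \<open>?B0\<close>, \<open>?B1\<close> and
    \<open>?B2\<close> are limits of one another term by term.\<close>
  let ?B2 = "\<lambda>i. ?K * (sqrt 2 * ((0 + r i + 0) * ?G + osc x (r i)) + (0 + 0 + 0 + 4 * (1 + C) * (r i / 2 + 2 * r i ^ 2 + 0)) * T + 8 * (1 + C) * r i ^ 2)"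
  have "?B2 \<longlonglongrightarrow> ?K * (sqrt 2 * ((0 + 0 + 0) * ?G + 0) + (0 + 0 + 0 + 4 * (1 + C) * (0 / 2 + 2 * 0 ^ 2 + 0)) * T + 8 * (1 + C) * 0 ^ 2)"
    by (intro tendsto_intros rl osc_tendsto less_imp_le r0) auto
  then have "?B2 \<longlonglongrightarrow> 0" by simp
  then have "\<forall>\<^sub>F i in sequentially. ?B2 i < \<gamma>" using \<gamma> by (rule order_tendstoD)
  moreover have "\<forall>\<^sub>F i in sequentially. r i < \<eta>" using rl \<eta> by (rule order_tendstoD)
  ultimately have "\<forall>\<^sub>F i in sequentially. ?B2 i < \<gamma> \<and> r i < \<eta>" by eventually_elim auto
  then obtain i where i: "?B2 i < \<gamma>" "r i < \<eta>" by (auto simp: eventually_sequentially)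
  define d where "d = r i"
  define l where "l = real (Suc i)"
  have d0: "0 < d" and l0: "0 < l" by (simp_all add: d_def r0 l_def)
  let ?w = "\<lambda>k. 1 / (2 * real (Suc i)) + 2 / l ^ 2 + exp (- (1 / (real (Suc i) * l * k)))"
  let ?B1 = "\<lambda>k. ?K * (sqrt 2 * ((0 + d + exp (- (d / k))) * ?G + osc x d) + (0 + 0 + 0 + 4 * (1 + C) * ?w k) * T + 4 * (1 + C) / (l ^ 2 / 2))"
  have e1: "((\<lambda>k. exp (- (1 / (real (Suc i) * l * k)))) \<longlongrightarrow> 0) (at_right 0)"
    using exp_neg_div_tendsto_0[of "1 / (real (Suc i) * l)"] l0 by (simp add: mult.assoc)
  have e2: "((\<lambda>k. exp (- (d / k))) \<longlongrightarrow> 0) (at_right 0)" by (rule exp_neg_div_tendsto_0[OF d0])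
  have "(?B1 \<longlongrightarrow> ?K * (sqrt 2 * ((0 + d + 0) * ?G + osc x d) + (0 + 0 + 0 + 4 * (1 + C) * (1 / (2 * real (Suc i)) + 2 / l ^ 2 + 0)) * T + 4 * (1 + C) / (l ^ 2 / 2))) (at_right 0)"
    by (intro tendsto_intros e1 e2)
  moreover have "?K * (sqrt 2 * ((0 + d + 0) * ?G + osc x d) + (0 + 0 + 0 + 4 * (1 + C) * (1 / (2 * real (Suc i)) + 2 / l ^ 2 + 0)) * T + 4 * (1 + C) / (l ^ 2 / 2)) = ?B2 i"
  proof -
    have "1 / (2 * real (Suc i)) = r i / 2"
      by (simp only: r_def divide_inverse inverse_mult_distrib mult_1_left mult.commute)
    moreover have "c / l ^ 2 = c * r i ^ 2" for c by (simp only: l_def r_def power_inverse divide_inverse)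
    moreover from this have "4 * (1 + C) / (l ^ 2 / 2) = 8 * (1 + C) * r i ^ 2"
      by (simp only: divide_divide_eq_right)
    ultimately show ?thesis by (simp only: d_def)
  qed
  ultimately have "(?B1 \<longlongrightarrow> ?B2 i) (at_right 0)" by simp
  then have "\<forall>\<^sub>F k in at_right 0. ?B1 k < \<gamma>" using i(1) by (rule order_tendstoD)
  moreover have "\<forall>\<^sub>F k in at_right 0. exp (- (d / k)) < \<gamma>" using e2 \<gamma> by (rule order_tendstoD)
  moreover have "\<forall>\<^sub>F k in at_right (0::real). 0 < k" by (rule eventually_at_right_less)
  ultimately have "\<forall>\<^sub>F k in at_right 0. ?B1 k < \<gamma> \<and> exp (- (d / k)) < \<gamma> \<and> 0 < k" by eventually_elim auto
  then obtain k where k: "?B1 k < \<gamma>" "exp (- (d / k)) < \<gamma>" "0 < k"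
    using eventually_happens'[OF trivial_limit_at_right_real] by blast
  let ?B0 = "\<lambda>N. ?K * (sqrt 2 * ((bad d N + d + exp (- (d / k))) * ?G + osc x d)
    + (1 / (real N * k ^ 2) + 1 / (2 * real N) + 2 * (1 + C) / (real N - 1) + 4 * (1 + C) * ?w k) * T + 4 * (1 + C) / (l ^ 2 / 2))"
  have n1: "(\<lambda>N. 1 / (real N * k ^ 2)) \<longlonglongrightarrow> 0" "(\<lambda>N. 1 / (2 * real N)) \<longlonglongrightarrow> 0"
    using tendsto_mult_left_zero[OF lim_1_over_n, of "1 / k ^ 2"] tendsto_mult_left_zero[OF lim_1_over_n, of "1 / 2"]
    by (simp_all add: mult.commute)
  have n2: "(\<lambda>N. 2 * (1 + C) / (real N - 1)) \<longlonglongrightarrow> 0"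
  proof (rule LIMSEQ_imp_Suc)
    show "(\<lambda>N. 2 * (1 + C) / (real (Suc N) - 1)) \<longlonglongrightarrow> 0"
      using tendsto_mult_right_zero[OF lim_1_over_n, of "2 * (1 + C)"] by simp
  qed
  have "?B0 \<longlonglongrightarrow> ?B1 k" by (intro tendsto_intros bad_tendsto d0 n1 n2)
  then have "\<forall>\<^sub>F N in sequentially. ?B0 N < \<gamma>" using k(1) by (rule order_tendstoD)
  moreover have "\<forall>\<^sub>F N in sequentially. 2 \<le> N" by (rule eventually_ge_at_top)
  ultimately have "\<forall>\<^sub>F N in sequentially. mom N k x \<le> \<gamma>"
  proof eventually_elim
    case (elim N)
    show ?case
      using mom_bound[OF elim(2) k(3) less_imp_le[OF d0] less_imp_le[OF d0] l0, of "Suc i" x] elim(1) by simp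
  qed
  then show thesis
    using that[of k d] k d0 i(2) by (auto simp: d_def)
qed

text \<open>The distribution function at \<open>x\<close> lies between its smoothed versions at
  \<open>x - \<eta>\<close> and \<open>x + \<eta>\<close>, up to a small error. Chebyshev's
  inequality controls these two, and continuity of \<open>u T\<close> removes
  \<open>\<eta>\<close>.\<close>

lemma pointwise_convergence:
  assumes \<epsilon>: "0 < \<epsilon>"
  shows "(\<lambda>N. measure (M N) {\<omega> \<in> space (M N). \<epsilon> < \<bar>emp_cdf N (X N T \<omega>) x - u T x\<bar>}) \<longlonglongrightarrow> 0"
proof (rule tendstoI)
  fix \<gamma>0 :: real assume g0: "0 < \<gamma>0"
  define e where "e = \<epsilon> / 3"
  have e: "0 < e" using \<epsilon> by (simp add: e_def)
  have "isCont (u T) x" by (rule DERIV_isCont[OF ux[OF T]])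
  then obtain \<eta>0 where \<eta>0: "0 < \<eta>0" "\<And>y. \<bar>y - x\<bar> < \<eta>0 \<Longrightarrow> \<bar>u T y - u T x\<bar> < e"
    using e unfolding continuous_at_eps_delta dist_real_def by blast
  define \<eta> where "\<eta> = \<eta>0 / 2"
  have \<eta>: "0 < \<eta>" and uu: "\<bar>u T (x + \<eta>) - u T x\<bar> < e" "\<bar>u T (x - \<eta>) - u T x\<bar> < e"
    using \<eta>0(1) by (auto simp: \<eta>_def intro!: \<eta>0(2))
  \<comment> \<open>The bound \<open>e\<close> covers the smoothing error; the other makes each
    Chebyshev bound at most \<open>\<gamma>0 / 4\<close>, so that the two together stay below
    \<open>\<gamma>0\<close>.\<close>
  define \<gamma> where "\<gamma> = min e (\<gamma>0 * e ^ 2 / 4)"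
  have \<gamma>: "0 < \<gamma>" "\<gamma> \<le> e" "\<gamma> / e ^ 2 \<le> \<gamma>0 / 4"
    using e g0 by (auto simp: \<gamma>_def min_def field_simps)
  obtain k1 d1 where k1: "0 < k1" "0 < d1" "d1 \<le> \<eta>" "exp (- (d1 / k1)) \<le> \<gamma>"
    "\<forall>\<^sub>F N in sequentially. mom N k1 (x + \<eta>) \<le> \<gamma>"
    by (rule small_second_moment[OF \<gamma>(1) \<eta>])
  obtain k2 d2 where k2: "0 < k2" "0 < d2" "d2 \<le> \<eta>" "exp (- (d2 / k2)) \<le> \<gamma>"
    "\<forall>\<^sub>F N in sequentially. mom N k2 (x - \<eta>) \<le> \<gamma>"
    by (rule small_second_moment[OF \<gamma>(1) \<eta>])
  have "\<forall>\<^sub>F N in sequentially. 2 \<le> (N::nat)" by (rule eventually_ge_at_top)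
  with k1(5) k2(5)
  show "\<forall>\<^sub>F N in sequentially. dist (measure (M N) {\<omega> \<in> space (M N). \<epsilon> < \<bar>emp_cdf N (X N T \<omega>) x - u T x\<bar>}) 0 < \<gamma>0"
  proof eventually_elim
    case (elim N)
    interpret particle_system "M N" N "X N" by (rule ps[OF elim(3)])
    let ?E1 = "{\<omega> \<in> space (M N). e \<le> \<bar>emp_mean N (smooth_step k1 (x + \<eta>)) (X N T \<omega>) - u T (x + \<eta>)\<bar>}"
    let ?E2 = "{\<omega> \<in> space (M N). e \<le> \<bar>emp_mean N (smooth_step k2 (x - \<eta>)) (X N T \<omega>) - u T (x - \<eta>)\<bar>}"
    have m: "(\<lambda>\<omega>. emp_mean N (smooth_step k y) (X N T \<omega>)) \<in> borel_measurable (M N)" if "0 < k" for k y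
      by (rule bdd_cyl_X_measurable[OF bdd_cyl_emp_mean_smooth_step(1)[OF that] less_imp_le[OF T]])
    have E [measurable]: "?E1 \<in> sets (M N)" "?E2 \<in> sets (M N)"
      using m[OF k1(1), of "x + \<eta>"] m[OF k2(1), of "x - \<eta>"] by measurable
    have sub: "{\<omega> \<in> space (M N). \<epsilon> < \<bar>emp_cdf N (X N T \<omega>) x - u T x\<bar>} \<subseteq> ?E1 \<union> ?E2"
    proof (rule ccontr)
      assume "\<not> ?thesis"
      then obtain \<omega> where "\<omega> \<in> {\<omega> \<in> space (M N). \<epsilon> < \<bar>emp_cdf N (X N T \<omega>) x - u T x\<bar>}" "\<omega> \<notin> ?E1 \<union> ?E2"
        by blast
      then have w: "\<epsilon> < \<bar>emp_cdf N (X N T \<omega>) x - u T x\<bar>"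
        "\<not> e \<le> \<bar>emp_mean N (smooth_step k1 (x + \<eta>)) (X N T \<omega>) - u T (x + \<eta>)\<bar>"
        "\<not> e \<le> \<bar>emp_mean N (smooth_step k2 (x - \<eta>)) (X N T \<omega>) - u T (x - \<eta>)\<bar>" by auto
      let ?z = "X N T \<omega>"
      have "emp_cdf N ?z x \<le> emp_cdf N ?z (x + \<eta> - d1)" using k1(3) by (intro emp_cdf_mono) auto
      also have "\<dots> \<le> emp_mean N (smooth_step k1 (x + \<eta>)) ?z + exp (- (d1 / k1))"
        by (rule emp_mean_smooth_step_le_emp_cdf(2)[OF N0 k1(1) less_imp_le[OF k1(2)]])
      finally have up: "emp_cdf N ?z x \<le> emp_mean N (smooth_step k1 (x + \<eta>)) ?z + e" using k1(4) \<gamma>(2) by linarith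
      have "emp_mean N (smooth_step k2 (x - \<eta>)) ?z \<le> emp_cdf N ?z (x - \<eta> + d2) + exp (- (d2 / k2))"
        by (rule emp_mean_smooth_step_le_emp_cdf(1)[OF N0 k2(1) less_imp_le[OF k2(2)]])
      moreover have "emp_cdf N ?z (x - \<eta> + d2) \<le> emp_cdf N ?z x" using k2(3) by (intro emp_cdf_mono) auto
      ultimately have lo: "emp_mean N (smooth_step k2 (x - \<eta>)) ?z \<le> emp_cdf N ?z x + e" using k2(4) \<gamma>(2) by linarith
      have "\<epsilon> = e + e + e" by (simp add: e_def)
      then show False using w up lo uu by linarith
    qed
    have "measure (M N) {\<omega> \<in> space (M N). \<epsilon> < \<bar>emp_cdf N (X N T \<omega>) x - u T x\<bar>} \<le> prob (?E1 \<union> ?E2)"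
      by (rule finite_measure_mono[OF sub]) (use E in auto)
    also have "\<dots> \<le> prob ?E1 + prob ?E2" by (rule measure_Un_le) (use E in auto)
    also have "\<dots> \<le> \<gamma> / e ^ 2 + \<gamma> / e ^ 2"
      by (intro add_mono deviation_probability k1 k2 e less_imp_le[OF T] elim)
    also have "\<dots> < \<gamma>0" using \<gamma>(3) g0 by linarith
    finally show ?case by simp
  qed
qed

text \<open>Two events of probability below one half cannot cover the space, so some configuration
  is close to \<open>u T\<close> at both points. Monotonicity and bounds for \<open>u T\<close> are
  thus inherited from empirical distribution functions, without any theory of the equation.\<close>

lemma common_point:
  assumes "0 < \<epsilon>"
  shows "\<exists>N z. 0 < N \<and> \<bar>emp_cdf N z x - u T x\<bar> \<le> \<epsilon> \<and> \<bar>emp_cdf N z y - u T y\<bar> \<le> \<epsilon>"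
proof -
  let ?E = "\<lambda>x N. {\<omega> \<in> space (M N). \<epsilon> < \<bar>emp_cdf N (X N T \<omega>) x - u T x\<bar>}"
  have "\<forall>\<^sub>F N in sequentially. measure (M N) (?E x N) < 1 / 2"
    "\<forall>\<^sub>F N in sequentially. measure (M N) (?E y N) < 1 / 2"
    by (rule order_tendstoD(2)[OF pointwise_convergence[OF assms]]; simp)+
  moreover have "\<forall>\<^sub>F N in sequentially. 2 \<le> (N::nat)" by (rule eventually_ge_at_top)
  ultimately have "\<forall>\<^sub>F N in sequentially. measure (M N) (?E x N) < 1 / 2 \<and> measure (M N) (?E y N) < 1 / 2 \<and> 2 \<le> N"
    by eventually_elim auto
  then obtain N where N: "measure (M N) (?E x N) < 1 / 2" "measure (M N) (?E y N) < 1 / 2" "2 \<le> N"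
    by (auto simp: eventually_sequentially)
  interpret particle_system "M N" N "X N" by (rule ps[OF N(3)])
  have [measurable]: "(\<lambda>\<omega>. emp_cdf N (X N T \<omega>) v) \<in> borel_measurable (M N)" for v
    by (rule emp_cdf_measurable) (use X_measurable T in auto)
  have E: "?E v N \<in> sets (M N)" for v by measurable
  have "prob (?E x N \<union> ?E y N) \<le> prob (?E x N) + prob (?E y N)" by (rule measure_Un_le) (rule E)+
  then have "prob (?E x N \<union> ?E y N) < 1" using N by simp
  then have "?E x N \<union> ?E y N \<noteq> space (M N)" using prob_space by auto
  then obtain \<omega> where "\<omega> \<in> space (M N)" "\<omega> \<notin> ?E x N" "\<omega> \<notin> ?E y N" by auto
  then show ?thesis using N(3) by (intro exI[of _ N] exI[of _ "X N T \<omega>"]) auto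
qed

lemma u_mono: "x \<le> y \<Longrightarrow> u T x \<le> u T y"
proof (rule field_le_epsilon)
  fix e :: real assume xy: "x \<le> y" and e: "0 < e"
  then obtain N z where "\<bar>emp_cdf N z x - u T x\<bar> \<le> e / 2" "\<bar>emp_cdf N z y - u T y\<bar> \<le> e / 2"
    using common_point[of "e / 2" x y] by auto
  then show "u T x \<le> u T y + e" using emp_cdf_mono[OF xy, of N z] by linarith
qed

lemma u_bounds: "0 \<le> u T x" "u T x \<le> 1"
proof -
  have "0 \<le> u T x + e \<and> u T x \<le> 1 + e" if "0 < e" for e
    using common_point[OF that, of x x] emp_cdf_bounds[of _ _ x] by (smt (verit))
  then show "0 \<le> u T x" "u T x \<le> 1" by (auto intro: field_le_epsilon)
qed

text \<open>With probability at least one half the final empirical function is close to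
  \<open>u T x\<close>, so \<open>w - \<delta>\<close> is at most four times the expected mean of
  \<open>f\<close> at time \<open>T\<close>. That expectation exceeds the initial one by at most
  \<open>exp (3/2 * T)\<close>, and the initial one is at most \<open>\<delta> + b\<close>. The
  number \<open>w\<close> is left free so that both tails are covered.\<close>

lemma tail_bound:
  assumes f: "C2b f f1 f2" and f0: "\<And>y. 0 \<le> f y" "\<And>y. f y \<le> 1" and f2: "\<And>y. f2 y \<le> f y"
    and \<delta>: "0 < \<delta>" and b: "0 \<le> b"
    and initial: "\<And>N z. 0 < N \<Longrightarrow> (\<And>x. \<bar>emp_cdf N z x - u0 x\<bar> \<le> \<delta>) \<Longrightarrow> emp_mean N f z \<le> b"
    and final: "\<And>N z. 0 < N \<Longrightarrow> \<bar>emp_cdf N z x - u T x\<bar> \<le> \<delta> \<Longrightarrow> w - \<delta> \<le> 2 * emp_mean N f z"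
  shows "w \<le> \<delta> + 4 * exp (3/2 * T) * (\<delta> + b)"
proof (cases "w \<le> \<delta>")
  case True
  then show ?thesis using \<delta> b by (simp add: add_increasing2)
next
  case False
  let ?E = "\<lambda>N. {\<omega> \<in> space (M N). \<delta> < \<bar>emp_cdf N (X N T \<omega>) x - u T x\<bar>}"
  have "\<forall>\<^sub>F N in sequentially. measure (M N) (?E N) < 1 / 2"
    by (rule order_tendstoD(2)[OF pointwise_convergence[OF \<delta>]]) simp
  moreover have "\<forall>\<^sub>F N in sequentially. bad \<delta> N < \<delta>"
    by (rule order_tendstoD(2)[OF bad_tendsto[OF \<delta>] \<delta>])
  moreover have "\<forall>\<^sub>F N in sequentially. 2 \<le> (N::nat)" by (rule eventually_ge_at_top)
  ultimately have "\<forall>\<^sub>F N in sequentially. measure (M N) (?E N) < 1 / 2 \<and> bad \<delta> N < \<delta> \<and> 2 \<le> N"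
    by eventually_elim auto
  then obtain N where N: "measure (M N) (?E N) < 1 / 2" "bad \<delta> N < \<delta>" "2 \<le> N"
    by (auto simp: eventually_sequentially)
  interpret particle_system "M N" N "X N" by (rule ps[OF N(3)])
  have cf: "bdd_cyl N (emp_mean N f)" by (intro bdd_cyl_emp_mean C2bD[OF f])
  have S1: "emp_mean N f z \<le> 1" "0 \<le> emp_mean N f z" for z
    using emp_mean_mono[of f "\<lambda>_. 1" N z] emp_mean_mono[of "\<lambda>_. 0" f N z] f0 by (auto simp: emp_mean_const[OF N0])
  define B where "B = {\<omega> \<in> space (M N). \<exists>x. \<delta> < \<bar>emp_cdf N (X N 0 \<omega>) x - u0 x\<bar>}"
  have Bm: "B \<in> sets (M N)"
    unfolding B_def by (rule emp_cdf_deviation_measurable[OF X_measurable])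
      (use u0 in \<open>auto simp: distribution_function_def\<close>)
  have [measurable]: "(\<lambda>\<omega>. emp_cdf N (X N T \<omega>) v) \<in> borel_measurable (M N)" for v
    by (rule emp_cdf_measurable) (use X_measurable T in auto)
  have E: "?E N \<in> sets (M N)" by measurable
  have i: "integrable (M N) (\<lambda>\<omega>. indicator A \<omega> * c)" if "A \<in> sets (M N)" for A and c :: real
    by (intro integrable_mult_left integrable_real_indicator that) (simp add: less_top[symmetric])
  have "expectation (\<lambda>\<omega>. emp_mean N f (X N 0 \<omega>)) \<le> expectation (\<lambda>\<omega>. indicator B \<omega> * 1 + b)"
  proof (rule integral_mono)
    fix \<omega> assume w: "\<omega> \<in> space (M N)"
    show "emp_mean N f (X N 0 \<omega>) \<le> indicator B \<omega> * 1 + b"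
    proof (cases "\<omega> \<in> B")
      case True then show ?thesis using S1(1)[of "X N 0 \<omega>"] b by simp
    next
      case False then show ?thesis using initial[OF N0, of "X N 0 \<omega>"] w by (auto simp: B_def not_less)
    qed
  qed (intro bdd_cyl_X_integrable[OF cf order_refl], intro Bochner_Integration.integrable_add i Bm, simp)
  also have "\<dots> = prob B + b"
    by (subst Bochner_Integration.integral_add[OF i[OF Bm]]) (auto simp: prob_space Bm)
  also have "\<dots> \<le> \<delta> + b" using N(2) by (simp add: bad_def B_def)
  finally have in0: "expectation (\<lambda>\<omega>. emp_mean N f (X N 0 \<omega>)) \<le> \<delta> + b" .
  have "(w - \<delta>) / 4 \<le> (1 - prob (?E N)) * ((w - \<delta>) / 2)"
    using mult_right_mono[of "1/2" "1 - prob (?E N)" "(w - \<delta>) / 2"] N(1) False by simp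
  also have "\<dots> = expectation (\<lambda>\<omega>. indicator (space (M N) - ?E N) \<omega> * ((w - \<delta>) / 2))"
    using prob_compl[OF E] E by simp
  also have "\<dots> \<le> expectation (\<lambda>\<omega>. emp_mean N f (X N T \<omega>))"
  proof (rule integral_mono[OF i bdd_cyl_X_integrable[OF cf less_imp_le[OF T]]])
    show "space (M N) - ?E N \<in> sets (M N)" using E by auto
    fix \<omega> assume "\<omega> \<in> space (M N)"
    then show "indicator (space (M N) - ?E N) \<omega> * ((w - \<delta>) / 2) \<le> emp_mean N f (X N T \<omega>)"
      using final[OF N0, of "X N T \<omega>"] S1(2)[of "X N T \<omega>"] by (auto simp: indicator_def not_less)
  qed
  also have "\<dots> \<le> exp (3/2 * T) * expectation (\<lambda>\<omega>. emp_mean N f (X N 0 \<omega>))"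
    by (rule tail_growth[OF f f0(1) f2 less_imp_le[OF T]])
  also have "\<dots> \<le> exp (3/2 * T) * (\<delta> + b)" by (intro mult_left_mono in0) auto
  finally have "w - \<delta> \<le> exp (3/2 * T) * (\<delta> + b) * 4" by (simp only: divide_le_eq_numeral1)
  then have "w - \<delta> \<le> 4 * (exp (3/2 * T) * (\<delta> + b))" by (simp only: mult.commute)
  then show ?thesis by (simp add: mult.assoc)
qed

lemma emp_mean_logistic_eq_smooth_step: "emp_mean N (\<lambda>y. logistic (x - y)) z = emp_mean N (smooth_step 1 x) z"
  by (simp add: smooth_step_def[abs_def])

text \<open>A logistic profile centred at distance \<open>d\<close> beyond a point where
  \<open>u0\<close> is within \<open>\<delta>\<close> of its limit has initial mean at most
  \<open>3 * \<delta>\<close>: one \<open>\<delta>\<close> each for \<open>u0\<close>, for the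
  uniform deviation and for the logistic tail. The choice of \<open>\<delta>\<close> solves
  \<open>\<delta> + \<kappa> * (4 * \<delta>) = \<epsilon>\<close>.\<close>

lemma tails:
  assumes \<epsilon>: "0 < \<epsilon>"
  obtains a b where "u T a \<le> \<epsilon>" "1 - \<epsilon> \<le> u T b"
proof -
  define \<kappa> where "\<kappa> = 4 * exp (3/2 * T)"
  have \<kappa>: "0 < \<kappa>" by (simp add: \<kappa>_def)
  define \<delta> where "\<delta> = \<epsilon> / (1 + 4 * \<kappa>)"
  have \<delta>: "0 < \<delta>" using \<epsilon> \<kappa> by (simp add: \<delta>_def add_pos_pos)
  have "\<delta> * (1 + 4 * \<kappa>) = \<epsilon>" using \<kappa> by (simp add: \<delta>_def)
  then have \<delta>\<epsilon>: "\<delta> + \<kappa> * (\<delta> + 3 * \<delta>) = \<epsilon>" by (simp add: algebra_simps)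
  define d where "d = max 0 (- ln \<delta>)"
  have d: "0 \<le> d" "exp (- (d / 1)) \<le> \<delta>"
  proof -
    have "exp (- d) \<le> exp (ln \<delta>)" by (simp add: d_def)
    then show "exp (- (d / 1)) \<le> \<delta>" using \<delta> by simp
  qed (simp add: d_def)
  have lims: "(u0 \<longlongrightarrow> 0) at_bot" "(u0 \<longlongrightarrow> 1) at_top"
    using u0 by (auto simp: distribution_function_def)
  obtain p where p: "u0 p < \<delta>"
    using order_tendstoD(2)[OF lims(1) \<delta>] by (auto simp: eventually_at_bot_linorder)
  obtain q where q: "1 - \<delta> < u0 q"
    using order_tendstoD(1)[OF lims(2), of "1 - \<delta>"] \<delta> by (auto simp: eventually_at_top_linorder)
  have "u T (p - d) \<le> \<delta> + 4 * exp (3/2 * T) * (\<delta> + 3 * \<delta>)"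
  proof (rule tail_bound[where f = "\<lambda>y. logistic ((-1) * y + (p - d))" and x = "p - d"])
    show "C2b (\<lambda>y. logistic ((-1) * y + (p - d))) (\<lambda>y. (-1) * logistic_d1 ((-1) * y + (p - d))) (\<lambda>y. (-1) ^ 2 * logistic_d2 ((-1) * y + (p - d)))"
      by (rule C2b_affine[OF C2b_logistic])
    fix N z assume N: "0 < (N::nat)"
    have e: "emp_mean N (\<lambda>y. logistic ((-1) * y + (p - d))) z = emp_mean N (\<lambda>y. logistic ((p - d) - y)) z" by simp
    show "u T (p - d) - \<delta> \<le> 2 * emp_mean N (\<lambda>y. logistic ((-1) * y + (p - d))) z" if "\<bar>emp_cdf N z (p - d) - u T (p - d)\<bar> \<le> \<delta>"
      unfolding e using emp_cdf_le_two_emp_mean[OF N, of z "p - d"] that by linarith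
    show "emp_mean N (\<lambda>y. logistic ((-1) * y + (p - d))) z \<le> 3 * \<delta>" if "\<And>x. \<bar>emp_cdf N z x - u0 x\<bar> \<le> \<delta>"
      unfolding e emp_mean_logistic_eq_smooth_step using emp_mean_smooth_step_le_emp_cdf(1)[OF N zero_less_one d(1), of "p - d" z] d(2) that[of p] p by simp
  qed (use \<delta> logistic_bounds logistic_d2_le in \<open>auto simp: less_imp_le\<close>)
  then have a: "u T (p - d) \<le> \<epsilon>" using \<delta>\<epsilon> by (simp add: \<kappa>_def)
  have "1 - u T (q + d) \<le> \<delta> + 4 * exp (3/2 * T) * (\<delta> + 3 * \<delta>)"
  proof (rule tail_bound[where f = "\<lambda>y. logistic (1 * y + (- (q + d)))" and x = "q + d"])
    show "C2b (\<lambda>y. logistic (1 * y + (- (q + d)))) (\<lambda>y. 1 * logistic_d1 (1 * y + (- (q + d)))) (\<lambda>y. 1 ^ 2 * logistic_d2 (1 * y + (- (q + d))))"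
      by (rule C2b_affine[OF C2b_logistic])
    fix N z assume N: "0 < (N::nat)"
    have e: "emp_mean N (\<lambda>y. logistic (1 * y + (- (q + d)))) z = emp_mean N (\<lambda>y. logistic (y - (q + d))) z" by (simp add: algebra_simps)
    have e': "emp_mean N (\<lambda>y. logistic (y - (q + d))) z = 1 - emp_mean N (smooth_step 1 (q + d)) z"
    proof -
      have "emp_mean N (\<lambda>y. logistic (y - (q + d)) + logistic ((q + d) - y)) z = emp_mean N (\<lambda>_. 1) z"
        using logistic_minus[of "(q + d) - _"] by (intro arg_cong[where f = "\<lambda>f. emp_mean N f z"] ext) (simp add: algebra_simps)
      then show ?thesis unfolding emp_mean_add emp_mean_logistic_eq_smooth_step emp_mean_const[OF N] by linarith
    qed
    show "1 - u T (q + d) - \<delta> \<le> 2 * emp_mean N (\<lambda>y. logistic (1 * y + (- (q + d)))) z" if "\<bar>emp_cdf N z (q + d) - u T (q + d)\<bar> \<le> \<delta>"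
      unfolding e using one_minus_emp_cdf_le_two_emp_mean[OF N, of z "q + d"] that by linarith
    show "emp_mean N (\<lambda>y. logistic (1 * y + (- (q + d)))) z \<le> 3 * \<delta>" if "\<And>x. \<bar>emp_cdf N z x - u0 x\<bar> \<le> \<delta>"
      unfolding e e' using emp_mean_smooth_step_le_emp_cdf(2)[OF N zero_less_one d(1), of z "q + d"] d(2) that[of q] q by simp
  qed (use \<delta> logistic_bounds logistic_d2_le in \<open>auto simp: less_imp_le\<close>)
  then have "1 - \<epsilon> \<le> u T (q + d)" using \<delta>\<epsilon> by (simp add: \<kappa>_def)
  with a show thesis by (rule that)
qed

text \<open>Polya's argument: both functions are monotone and the limit is continuous, so closeness on
  a finite grid implies uniform closeness.\<close>

lemma finite_grid:
  assumes \<epsilon>: "0 < \<epsilon>"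
  obtains P where "finite P"
    "\<And>N z x. (\<And>p. p \<in> P \<Longrightarrow> \<bar>emp_cdf N z p - u T p\<bar> \<le> \<epsilon>) \<Longrightarrow> \<bar>emp_cdf N z x - u T x\<bar> \<le> 2 * \<epsilon>"
proof -
  obtain a b where ab: "u T a \<le> \<epsilon>" "1 - \<epsilon> \<le> u T b" by (rule tails[OF \<epsilon>])
  \<comment> \<open>The two tail points come in no particular order. Moving the right one outwards
    preserves its bound by monotonicity and yields a nondegenerate interval.\<close>
  define b' where "b' = max b (a + 1)"
  have b': "a < b'" "1 - \<epsilon> \<le> u T b'" using ab(2) u_mono[of b b'] by (auto simp: b'_def)
  have "continuous_on {a..b'} (u T)"
    by (rule DERIV_continuous_on) (rule has_field_derivative_at_within[OF ux[OF T]])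
  then have "uniformly_continuous_on {a..b'} (u T)" by (rule compact_uniformly_continuous) simp
  then obtain h where h: "h > 0" "\<And>x y. x \<in> {a..b'} \<Longrightarrow> y \<in> {a..b'} \<Longrightarrow> dist y x < h \<Longrightarrow> dist (u T y) (u T x) < \<epsilon>"
    unfolding uniformly_continuous_on_def using \<epsilon> by meson
  obtain m :: nat where m: "(b' - a) / h < real m" using reals_Archimedean2 by blast
  have m0: "0 < real m" using m b'(1) h(1) by (smt (verit) divide_pos_pos)
  define s where "s = (b' - a) / real m"
  have s: "0 < s" "s < h" using m m0 h b' by (auto simp: s_def field_simps)
  define g where "g j = a + real j * s" for j
  have gm: "g m = b'" using m0 by (simp add: g_def s_def)
  have gin: "g j \<in> {a..b'}" if "j \<le> m" for j
  proof -
    have "real j * s \<le> real m * s" using that s by (intro mult_right_mono) auto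
    then have "g j \<le> b'" unfolding gm[symmetric] by (simp only: g_def add_le_cancel_left)
    moreover have "a \<le> g j" using s by (simp add: g_def)
    ultimately show ?thesis by simp
  qed
  show thesis
  proof (rule that[of "g ` {..m}"])
    fix N z x assume P: "\<And>p. p \<in> g ` {..m} \<Longrightarrow> \<bar>emp_cdf N z p - u T p\<bar> \<le> \<epsilon>"
    then have P: "\<bar>emp_cdf N z (g j) - u T (g j)\<bar> \<le> \<epsilon>" if "j \<le> m" for j using that by auto
    note eb = emp_cdf_bounds[of N z x] and ub = u_bounds[of x]
    consider "x \<le> a" | "b' \<le> x" | "a < x" "x < b'" by linarith
    then show "\<bar>emp_cdf N z x - u T x\<bar> \<le> 2 * \<epsilon>"
    proof cases
      case 1
      have "g 0 = a" by (simp add: g_def)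
      then show ?thesis using P[of 0] emp_cdf_mono[OF 1, of N z] u_mono[OF 1] ab eb ub \<epsilon> by (simp add: abs_le_iff)
    next
      case 2
      then show ?thesis using P[of m] emp_cdf_mono[OF 2, of N z] u_mono[OF 2] b' eb ub \<epsilon> unfolding gm by (simp add: abs_le_iff)
    next
      case 3
      define j where "j = nat \<lfloor>(x - a) / s\<rfloor>"
      have q: "0 \<le> (x - a) / s" using 3 s by simp
      have j: "real j \<le> (x - a) / s" "(x - a) / s < real j + 1"
        using q by (simp_all add: j_def)
      have gx: "g j \<le> x" "x \<le> g (Suc j)"
        using j s by (auto simp: g_def field_simps)
      have "real j < real m"
      proof -
        have "(x - a) / s < (b' - a) / s" using 3 s by (intro divide_strict_right_mono) auto
        also have "\<dots> = real m" using m0 b' by (simp add: s_def)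
        finally show ?thesis using j by linarith
      qed
      then have jm: "j \<le> m" "Suc j \<le> m" by auto
      have "dist (g (Suc j)) (g j) < h" using s by (simp add: g_def dist_real_def algebra_simps)
      then have "dist (u T (g (Suc j))) (u T (g j)) < \<epsilon>" by (intro h gin jm)
      then show ?thesis
        using P[OF jm(1)] P[OF jm(2)] emp_cdf_mono[OF gx(1), of N z] emp_cdf_mono[OF gx(2), of N z]
          u_mono[OF gx(1)] u_mono[OF gx(2)] by (simp add: dist_real_def abs_le_iff)
    qed
  qed simp
qed

theorem uniform_convergence:
  assumes \<epsilon>: "0 < \<epsilon>"
  shows "(\<lambda>N. measure (M N) {\<omega> \<in> space (M N). \<exists>x. \<epsilon> < \<bar>emp_cdf N (X N T \<omega>) x - u T x\<bar>}) \<longlonglongrightarrow> 0"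
proof -
  have e2: "0 < \<epsilon> / 2" using \<epsilon> by simp
  obtain P where P: "finite P"
    "\<And>N z x. (\<And>p. p \<in> P \<Longrightarrow> \<bar>emp_cdf N z p - u T p\<bar> \<le> \<epsilon> / 2) \<Longrightarrow> \<bar>emp_cdf N z x - u T x\<bar> \<le> 2 * (\<epsilon> / 2)"
    using finite_grid[OF e2] by blast
  let ?E = "\<lambda>p N. {\<omega> \<in> space (M N). \<epsilon> / 2 < \<bar>emp_cdf N (X N T \<omega>) p - u T p\<bar>}"
  have "(\<lambda>N. \<Sum>p\<in>P. measure (M N) (?E p N)) \<longlonglongrightarrow> (\<Sum>p\<in>P. 0)"
    by (intro tendsto_sum pointwise_convergence e2)
  then have lim: "(\<lambda>N. \<Sum>p\<in>P. measure (M N) (?E p N)) \<longlonglongrightarrow> 0" by simp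
  have le: "\<forall>\<^sub>F N in sequentially. measure (M N) {\<omega> \<in> space (M N). \<exists>x. \<epsilon> < \<bar>emp_cdf N (X N T \<omega>) x - u T x\<bar>}
    \<le> (\<Sum>p\<in>P. measure (M N) (?E p N))"
    using eventually_ge_at_top[of 2]
  proof eventually_elim
    case (elim N)
    interpret particle_system "M N" N "X N" by (rule ps[OF elim])
    have [measurable]: "(\<lambda>\<omega>. emp_cdf N (X N T \<omega>) v) \<in> borel_measurable (M N)" for v
      by (rule emp_cdf_measurable) (use X_measurable T in auto)
    have E: "?E p N \<in> sets (M N)" for p by measurable
    have "{\<omega> \<in> space (M N). \<exists>x. \<epsilon> < \<bar>emp_cdf N (X N T \<omega>) x - u T x\<bar>} \<subseteq> (\<Union>p\<in>P. ?E p N)"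
    proof
      fix \<omega> assume "\<omega> \<in> {\<omega> \<in> space (M N). \<exists>x. \<epsilon> < \<bar>emp_cdf N (X N T \<omega>) x - u T x\<bar>}"
      then obtain x where w: "\<omega> \<in> space (M N)" and x: "\<epsilon> < \<bar>emp_cdf N (X N T \<omega>) x - u T x\<bar>" by auto
      then have "\<not> (\<forall>p\<in>P. \<bar>emp_cdf N (X N T \<omega>) p - u T p\<bar> \<le> \<epsilon> / 2)" using P(2)[of N "X N T \<omega>" x] by auto
      then show "\<omega> \<in> (\<Union>p\<in>P. ?E p N)" using w by (auto simp: not_le)
    qed
    then have "prob {\<omega> \<in> space (M N). \<exists>x. \<epsilon> < \<bar>emp_cdf N (X N T \<omega>) x - u T x\<bar>} \<le> prob (\<Union>p\<in>P. ?E p N)"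
      by (rule finite_measure_mono) (use E P(1) in auto)
    also have "\<dots> \<le> (\<Sum>p\<in>P. prob (?E p N))"
      by (rule finite_measure_subadditive_finite[OF P(1)]) (use E in auto)
    finally show ?case .
  qed
  show ?thesis
    by (rule tendsto_sandwich[OF _ le tendsto_const lim]) simp
qed

end

theorem theorem2p1:
  fixes M :: "nat \<Rightarrow> 'a measure"
    and X :: "nat \<Rightarrow> real \<Rightarrow> 'a \<Rightarrow> nat \<Rightarrow> real"
    and u0 :: "real \<Rightarrow> real"
    and u :: "real \<Rightarrow> real \<Rightarrow> real"
  assumes prob: "\<And>N. N \<ge> 2 \<Longrightarrow> prob_space (M N)"
    and proc: "\<And>N. N \<ge> 2 \<Longrightarrow> solves_mp (M N) N (X N)"
    and u0: "distribution_function u0"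
    and init: "\<And>\<epsilon>. \<epsilon> > 0 \<Longrightarrow>
      (\<lambda>N. measure (M N) {\<omega> \<in> space (M N). \<exists>x. \<bar>emp_cdf N (X N 0 \<omega>) x - u0 x\<bar> > \<epsilon>})
        \<longlonglongrightarrow> 0"
    and sol: "fkpp_solution u0 u"
    and t: "t > 0"
    and eps: "\<epsilon> > 0"
  shows "(\<lambda>N. measure (M N) {\<omega> \<in> space (M N). \<exists>x. \<bar>emp_cdf N (X N t \<omega>) x - u t x\<bar> > \<epsilon>})
           \<longlonglongrightarrow> 0"
proof -
  obtain C where C: "\<forall>t>0. \<forall>x. \<bar>u t x\<bar> \<le> C"
    using sol unfolding fkpp_solution_def by blast
  obtain ux uxx where d: "\<forall>t>0. \<forall>x.
        ((u t) has_real_derivative ux t x) (at x) \<and>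
        ((ux t) has_real_derivative uxx t x) (at x) \<and>
        ((\<lambda>s. u s x) has_real_derivative (1/2 * uxx t x + (u t x)^2 - u t x)) (at t)"
    using sol unfolding fkpp_solution_def by blast
  interpret hydrodynamic M X u0 u ux uxx C t
  proof (rule hydrodynamic.intro)
    show "particle_system (M N) N (X N)" if "2 \<le> N" for N
      using prob[OF that] proc[OF that] that
      by (simp add: particle_system_def particle_system_axioms_def)
    show "(\<lambda>N. measure (M N) {\<omega> \<in> space (M N). \<exists>x. \<bar>emp_cdf N (X N 0 \<omega>) x - u0 x\<bar> > \<epsilon>}) \<longlonglongrightarrow> 0"
      if "\<epsilon> > 0" for \<epsilon> by (rule init[OF that])
    show "\<bar>u s x\<bar> \<le> C" if "0 < s" for s x using C that by blast
    show "continuous_on ({0<..} \<times> UNIV) (\<lambda>(t, x). u t x)" 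
      using sol unfolding fkpp_solution_def by (elim conjE)
    show "(u s has_real_derivative ux s x) (at x)" "(ux s has_real_derivative uxx s x) (at x)"
      "((\<lambda>r. u r x) has_real_derivative (1/2 * uxx s x + (u s x)^2 - u s x)) (at s)" if "0 < s" for s x
      using d[rule_format, OF that, of x] by simp_all
    show "((\<lambda>s. u s x) \<longlongrightarrow> u0 x) (at_right 0)" if "isCont u0 x" for x
      using sol that unfolding fkpp_solution_def by simp
  qed (rule u0, rule t)
  show ?thesis by (rule uniform_convergence[OF eps])
qed

end
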